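(* Let $\lambda\vdash k$, fix $r\ge2$, take $n\ge\max\{k+\lambda_1,r\}$, and let $\sigma\in S_n$ be an $r$-cycle. Let $P_\lambda$ be the polynomial with $P_\lambda(n)=\chi^{(n-k,\lambda)}(\sigma)$ for all such $n$, and write $P_\lambda(x)=\sum_{h=0}^{k}(-1)^h b^{(r)}_{\lambda,h}\binom{x-r}{k-h}$. Then for every $0\le h\le\min\{k,\ell(\lambda)+r\}$, \[b^{(r)}_{\lambda,h}=\sum_{\nu\in\Gamma^r_h}\varepsilon^r_\nu\,f^{\lambda\setminus\nu}.\]
   Context: For $\mu\vdash n$, $\chi^\mu$ is the irreducible character of $S_n$ indexed by $\mu$; $(n-k,\lambda)$ is the partition of $n$ with first row $n-k$ followed by the rows of $\lambda$; $\ell(\lambda)$ is the number of parts and $\lambda_1$ the largest part of $\lambda$. An $r$-cycle in $S_r$ is viewed in $S_n$, $n\ge r$, via the standard embedding, and $\chi^{(n-k,\lambda)}(\sigma)$ is, for $n\ge\max\{k+\lambda_1,r\}$, the value at $n$ of a polynomial $P_\lambda$ of degree $k$ (taken as given). For partitions $\lambda,\nu$: if $\nu\subseteq\lambda$ as Young diagrams, $f^{\lambda\setminus\nu}$ is the number of standard Young tableaux of skew shape $\lambda\setminus\nu$ ($f^{\lambda\setminus\lambda}=1$); otherwise $f^{\lambda\setminus\nu}:=0$. Definition ($r$-primary partitions and $r$-signs): the following partitions are $r$-primary, with $r$-sign $\varepsilon^r_\nu$: (1) $(1^t)\vdash t$ for $0\le t\le r-1$ (including $\emptyset$), sign $+1$;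 (2) for $u,v\ge0$ with $u+v\le r-2$, $(r-u-v,2^u,1^v)\vdash r+u$, sign $(-1)^{r-u-v}$; (3) for $0\le u\le r-1$ and $v\ge0$, $(r+1-u,2^u,1^v)\vdash r+1+u+v$, sign $(-1)^{r-u}$. Here $(a,2^u,1^v)$ denotes first part $a$, then $u$ parts equal to $2$, then $v$ parts equal to $1$. $\Gamma^r_h$ denotes the set of $r$-primary partitions of $h$. *)

theory Defs
  imports Complex_Main
    "HOL-Combinatorics.Permutations"
    "HOL-Combinatorics.Cycles"
    "HOL-Computational_Algebra.Polynomial"
    "HOL-Library.Function_Algebras"
    "HOL-Library.FuncSet"
begin

section \<open>Partitions and Young diagrams\<close>

definition partition_of :: "nat list \<Rightarrow> nat \<Rightarrow> bool"  (infix "\<turnstile>\<^sub>p" 50)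
  where "lam \<turnstile>\<^sub>p n \<longleftrightarrow> sorted_wrt (\<ge>) lam \<and> 0 \<notin> set lam \<and> sum_list lam = n"

text \<open>The value for the empty partition is \<open>0\<close>.\<close>

definition largest_part :: "nat list \<Rightarrow> nat"
  where "largest_part lam = Max (insert 0 (set lam))"

text \<open>Cells are pairs (row, column), both counted from \<open>0\<close>.\<close>

definition young_diagram :: "nat list \<Rightarrow> (nat \<times> nat) set"
  where "young_diagram lam = {(i, j). i < length lam \<and> j < lam ! i}"

definition skew_SYT :: "nat list \<Rightarrow> nat list \<Rightarrow> (nat \<times> nat \<Rightarrow> nat) set"
  where "skew_SYT lam nu =
    (let D = young_diagram lam - young_diagram nu in
      {T \<in> extensional D. bij_betw T D {1..card D} \<and>
        (\<forall>i j j'. (i, j) \<in> D \<and> (i, j') \<in> D \<and> j < j' \<longrightarrow> T (i, j) < T (i, j')) \<and>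
        (\<forall>i i' j. (i, j) \<in> D \<and> (i', j) \<in> D \<and> i < i' \<longrightarrow> T (i, j) < T (i', j))})"

definition num_skew_SYT :: "nat list \<Rightarrow> nat list \<Rightarrow> nat"
  where "num_skew_SYT lam nu =
    (if young_diagram nu \<subseteq> young_diagram lam then card (skew_SYT lam nu) else 0)"


section \<open>Traces on subspaces of complex function spaces\<close>

definition fscale :: "complex \<Rightarrow> ('a \<Rightarrow> complex) \<Rightarrow> ('a \<Rightarrow> complex)"
  where "fscale c v = (\<lambda>x. c * v x)"

global_interpretation cfun: vector_space "fscale :: complex \<Rightarrow> ('a \<Rightarrow> complex) \<Rightarrow> ('a \<Rightarrow> complex)"
  by unfold_locales (auto simp: fscale_def fun_eq_iff algebra_simps)

text \<open>
  The trace of the restriction of a linear map \<open>f\<close> to an \<open>f\<close>-invariant finite-dimensional subspace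
  \<open>V\<close>: the sum of the diagonal entries of its matrix with respect to a basis \<open>B\<close> of \<open>V\<close>
  (the choice of \<open>B\<close> is immaterial).
\<close>

definition trace_on :: "('a \<Rightarrow> complex) set \<Rightarrow> (('a \<Rightarrow> complex) \<Rightarrow> ('a \<Rightarrow> complex)) \<Rightarrow> complex"
  where "trace_on V f =
    (let B = (SOME B. cfun.independent B \<and> cfun.span B = V)
     in \<Sum>v\<in>B. cfun.representation B (f v) v)"


section \<open>Specht modules and irreducible characters of the symmetric groups\<close>

text \<open>
  \<open>S\<^sub>n\<close> is the group of all \<open>\<sigma>\<close> with \<open>\<sigma> permutes {1..n}\<close>, so that \<open>S\<^sub>r \<subseteq> S\<^sub>n\<close> for \<open>r \<le> n\<close>.
  A Young tableau of shape \<open>\<mu>\<close> is a bijective filling of the diagram of \<open>\<mu>\<close> with \<open>1, \<dots>, n\<close>.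
\<close>

definition tableaux :: "nat list \<Rightarrow> (nat \<times> nat \<Rightarrow> nat) set"
  where "tableaux \<mu> = {t. bij_betw t (young_diagram \<mu>) {1..sum_list \<mu>}}"

text \<open>The tabloid of \<open>t\<close>, encoded as the function that sends \<open>i\<close> to the set of entries in row \<open>i\<close>.\<close>

definition tabloid :: "nat list \<Rightarrow> (nat \<times> nat \<Rightarrow> nat) \<Rightarrow> (nat \<Rightarrow> nat set)"
  where "tabloid \<mu> t = (\<lambda>i. {t (i, j) | j. (i, j) \<in> young_diagram \<mu>})"

definition column_stabilizer :: "nat list \<Rightarrow> (nat \<times> nat \<Rightarrow> nat) \<Rightarrow> (nat \<Rightarrow> nat) set"
  where "column_stabilizer \<mu> t =
    {\<pi>. \<pi> permutes {1..sum_list \<mu>} \<and>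
        (\<forall>j. \<pi> ` {t (i, j) | i. (i, j) \<in> young_diagram \<mu>} = {t (i, j) | i. (i, j) \<in> young_diagram \<mu>})}"

text \<open>
  A formal complex combination of tabloids is encoded by its coefficient function. The polytabloid
  of \<open>t\<close> is the sum of \<open>sgn \<pi> \<cdot> {\<pi> t}\<close> over the column stabilizer of \<open>t\<close>.
\<close>

definition polytabloid :: "nat list \<Rightarrow> (nat \<times> nat \<Rightarrow> nat) \<Rightarrow> ((nat \<Rightarrow> nat set) \<Rightarrow> complex)"
  where "polytabloid \<mu> t = (\<lambda>X. \<Sum>\<pi>\<in>column_stabilizer \<mu> t.
    of_int (sign \<pi>) * (if X = tabloid \<mu> (\<pi> \<circ> t) then 1 else 0))"

definition specht_module :: "nat list \<Rightarrow> ((nat \<Rightarrow> nat set) \<Rightarrow> complex) set"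
  where "specht_module \<mu> = cfun.span (polytabloid \<mu> ` tableaux \<mu>)"

text \<open>
  The linear action induced by \<open>\<sigma> \<cdot> X = (\<lambda>i. \<sigma> ` X i)\<close> on tabloids; the coefficient of \<open>X\<close> in
  \<open>\<sigma> \<cdot> v\<close> is the coefficient of \<open>\<sigma>\<^sup>-\<^sup>1 \<cdot> X\<close> in \<open>v\<close>.
\<close>

definition perm_action ::
    "(nat \<Rightarrow> nat) \<Rightarrow> ((nat \<Rightarrow> nat set) \<Rightarrow> complex) \<Rightarrow> ((nat \<Rightarrow> nat set) \<Rightarrow> complex)"
  where "perm_action \<sigma> v = (\<lambda>X. v (\<lambda>i. inv \<sigma> ` X i))"

text \<open>
  The irreducible character of \<open>S\<^sub>n\<close> indexed by \<open>\<mu>\<close> is the character of the Specht module of \<open>\<mu>\<close>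
  over the complex numbers; \<open>\<mu> = (n)\<close> gives the trivial character and \<open>\<mu> = (1\<^sup>n)\<close> the sign.
\<close>

definition irr_char :: "nat list \<Rightarrow> (nat \<Rightarrow> nat) \<Rightarrow> complex"
  where "irr_char \<mu> \<sigma> = trace_on (specht_module \<mu>) (perm_action \<sigma>)"

definition r_cycle :: "nat \<Rightarrow> nat \<Rightarrow> (nat \<Rightarrow> nat) \<Rightarrow> bool"
  where "r_cycle r n \<sigma> \<longleftrightarrow>
    (\<exists>cs. distinct cs \<and> length cs = r \<and> set cs \<subseteq> {1..n} \<and> \<sigma> = cycle_of_list cs)"


section \<open>Primary partitions and their signs\<close>

text \<open>
  \<open>primary_sign r nu e\<close>: the partition \<open>nu\<close> is \<open>r\<close>-primary with \<open>r\<close>-sign \<open>e\<close>. The sign is determined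
  by \<open>nu\<close>, see \<open>primary_sign_unique\<close> below.
\<close>

inductive primary_sign :: "nat \<Rightarrow> nat list \<Rightarrow> int \<Rightarrow> bool" for r :: nat where
  column: "t < r \<Longrightarrow> primary_sign r (replicate t 1) 1"
| short: "u + v + 2 \<le> r \<Longrightarrow>
    primary_sign r ((r - u - v) # replicate u 2 @ replicate v 1) ((- 1) ^ (r - u - v))"
| long: "u < r \<Longrightarrow>
    primary_sign r ((r + 1 - u) # replicate u 2 @ replicate v 1) ((- 1) ^ (r - u))"

lemma primary_sign_unique:
  assumes "primary_sign r nu e" "primary_sign r nu e'"
  shows "e = e'"
proof -
  have hook: "a = a' \<and> u = u' \<and> v = v'"
    if "a # replicate u 2 @ replicate v 1 = a' # replicate u' 2 @ replicate v' (1::nat)"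
    for a a' u u' v v' :: nat
  proof -
    let ?t = "replicate u 2 @ replicate v (1::nat)" and ?t' = "replicate u' 2 @ replicate v' (1::nat)"
    have eq: "?t = ?t'" "a = a'"
      using that by blast+
    have "u + v = u' + v'"
      using arg_cong[OF eq(1), of length] by simp
    moreover have "2 * u + v = 2 * u' + v'"
      using arg_cong[OF eq(1), of sum_list] by (simp add: sum_list_replicate)
    ultimately show ?thesis
      using eq(2) by simp
  qed
  have col: "a \<le> 1" if "nu = a # xs" "nu = replicate t 1" for t a :: nat and xs
    using that by (cases t) auto
  show ?thesis
    using assms(1)
  proof cases
    case (column t)
    from assms(2) show ?thesis
    proof cases
      case (column t')
      then show ?thesis using \<open>e = 1\<close> by simp
    next
      case (short u v)
      then show ?thesis using col[OF short(1) \<open>nu = replicate t 1\<close>] by simp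
    next
      case (long u v)
      then show ?thesis using col[OF long(1) \<open>nu = replicate t 1\<close>] by simp
    qed
  next
    case (short u v)
    from assms(2) show ?thesis
    proof cases
      case (column t)
      then show ?thesis using col[OF short(1) column(1)] short(3) by simp
    next
      case (short u' v')
      have "u = u' \<and> v = v'"
        using hook[OF trans[OF sym[OF \<open>nu = (r - u - v) # _\<close>] short(1)]] by blast
      then show ?thesis
        using \<open>e = _\<close> short(2) by simp
    next
      case (long u' v')
      have "r - u - v = r + 1 - u' \<and> u = u' \<and> v = v'"
        by (rule hook[OF trans[OF sym[OF short(1)] long(1)]])
      then show ?thesis
        using short(3) long(3) by linarith
    qed
  next
    case (long u v)
    from assms(2) show ?thesis
    proof cases
      case (column t)
      then show ?thesis using col[OF long(1) column(1)] long(3) by simp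
    next
      case (short u' v')
      have "r + 1 - u = r - u' - v' \<and> u = u' \<and> v = v'"
        by (rule hook[OF trans[OF sym[OF long(1)] short(1)]])
      then show ?thesis
        using short(3) long(3) by linarith
    next
      case (long u' v')
      have "u = u' \<and> v = v'"
        using hook[OF trans[OF sym[OF \<open>nu = (r + 1 - u) # _\<close>] long(1)]] by blast
      then show ?thesis
        using \<open>e = _\<close> long(2) by simp
    qed
  qed
qed

definition r_primary :: "nat \<Rightarrow> nat \<Rightarrow> nat list set"
  where "r_primary r h = {nu. nu \<turnstile>\<^sub>p h \<and> (\<exists>e. primary_sign r nu e)}"

definition r_sign :: "nat \<Rightarrow> nat list \<Rightarrow> int"
  where "r_sign r nu = (THE e. primary_sign r nu e)"

end

theory Submission
  imports Defs
begin

text \<open>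
  The product of the Jucys--Murphy elements \<open>J\<^sub>2, \<dots>, J\<^sub>r\<close> is the sum of the \<open>(r - 1)!\<close> cycles of length
  \<open>r\<close> on \<open>{1, \<dots>, r}\<close>. On the basis of standard polytabloids the Jucys--Murphy elements are triangular
  with respect to the weight \<open>\<Sum> (column) * (entry)\<close>, with the contents on the diagonal. Hence
  \<open>(r - 1)! \<chi>\<^sup>\<mu>(\<sigma>)\<close> is the sum over the standard tableaux of shape \<open>\<mu>\<close> of the products of the contents
  of the cells with entries \<open>2, \<dots>, r\<close>. Removing the largest entry gives the branching rule for
  \<open>n > r\<close>. The same recursion holds for an antisymmetric function of the beta numbers of \<open>\<mu>\<close>, which
  also makes sense when the first row is too short, and for the claimed expansion. So everything
  is reduced to \<open>n = r\<close>, where for the first row \<open>r - k\<close> the antisymmetric function is nonzero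
  exactly if \<open>\<lambda>\<close> is primary.
\<close>

section \<open>Traces\<close>

text \<open>For fixed \<lambda> an induction on d = n - r has to come down to d = 0, whereas a
  Specht module requires a first row at least as long as that of \<lambda>; characters alone cannot
  be followed down that far. Integer sequences can: \<open>beta_char\<close> vanishes on a sequence
  with a repeated or a negative entry, so lowering a row without removable cell contributes 0 by
  itself. In the expansion, lowering the first row keeps \<lambda> and lowering another row reduces
  k by one, and this is Pascal's rule for \<open>d choose (k - h)\<close>. At d = 0 only the term h
  = k survives, and the only \<nu> of size k inside \<lambda> is \<lambda> itself. This is the
  origin of the list of primary partitions: their signs are the values at d = 0 times (-1)^k. The
  product of Jucys--Murphy elements replaces a single cycle because its trace can be read off a
  triangular basis, while all (r - 1)! cycles in it have equal trace by conjugacy.\<close>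

text \<open>Both sides are the same double sum over matrix entries of f and g. Two bases are allowed
  so that one lemma gives both facts about traces: g = id yields independence of the basis, B = B'
  yields invariance under cyclic exchange.\<close>

lemma trace_commute_bases:
  assumes B: "cfun.independent B" "finite B" "cfun.span B = V"
    and B': "cfun.independent B'" "finite B'" "cfun.span B' = V"
    and f: "Vector_Spaces.linear fscale fscale f" "f ` V \<subseteq> V"
    and g: "Vector_Spaces.linear fscale fscale g" "g ` V \<subseteq> V"
  shows "(\<Sum>v\<in>B. cfun.representation B (f (g v)) v) = (\<Sum>w\<in>B'. cfun.representation B' (g (f w)) w)"
proof -
  interpret f: Vector_Spaces.linear fscale fscale f by fact
  interpret g: Vector_Spaces.linear fscale fscale g by fact
  have BV: "v \<in> V" if "v \<in> B" for v using that B(3) cfun.span_base by blast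
  have BV': "v \<in> V" if "v \<in> B'" for v using that B'(3) cfun.span_base by blast
  have fV: "f v \<in> V" if "v \<in> V" for v using f(2) that by blast
  have gV: "g v \<in> V" if "v \<in> V" for v using g(2) that by blast
  \<comment> \<open>Coordinates of \<open>h u\<close> in C are the coordinates of u in C' multiplied
    by the matrix of h. It is applied to f and to g with the roles of B and B' exchanged.\<close>
  have expand: "cfun.representation C (h u) v =
      (\<Sum>w\<in>C'. cfun.representation C' u w * cfun.representation C (h w) v)"
    if C: "cfun.independent C" "finite C" "cfun.span C = V"
      and C': "cfun.independent C'" "finite C'" "cfun.span C' = V"
      and h: "Vector_Spaces.linear fscale fscale h" "h ` V \<subseteq> V" and u: "u \<in> V"
    for C C' h u v
  proof -
    interpret h: Vector_Spaces.linear fscale fscale h by fact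
    have hC: "h w \<in> cfun.span C" if "w \<in> C'" for w
      using that C'(3) C(3) h(2) cfun.span_base by blast
    have "u = (\<Sum>w\<in>C'. fscale (cfun.representation C' u w) w)"
      using cfun.sum_representation_eq[OF C'(1) _ C'(2) subset_refl] u C'(3) by metis
    then have "h u = (\<Sum>w\<in>C'. fscale (cfun.representation C' u w) (h w))"
      by (metis (no_types, lifting) h.sum h.scale sum.cong)
    then have "cfun.representation C (h u) v =
        cfun.representation C (\<Sum>w\<in>C'. fscale (cfun.representation C' u w) (h w)) v"
      by simp
    also have "\<dots> = (\<Sum>w\<in>C'. cfun.representation C (fscale (cfun.representation C' u w) (h w)) v)"
      by (subst cfun.representation_sum[OF C(1)]) (auto intro: cfun.span_scale hC)
    also have "\<dots> = (\<Sum>w\<in>C'. cfun.representation C' u w * cfun.representation C (h w) v)"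
      by (intro sum.cong refl) (simp add: cfun.representation_scale[OF C(1) hC])
    finally show ?thesis .
  qed
  have "(\<Sum>v\<in>B. cfun.representation B (f (g v)) v)
      = (\<Sum>v\<in>B. \<Sum>w\<in>B'. cfun.representation B' (g v) w * cfun.representation B (f w) v)"
    by (intro sum.cong refl expand[OF B B' f]) (auto intro: gV BV)
  also have "\<dots> = (\<Sum>w\<in>B'. \<Sum>v\<in>B. cfun.representation B (f w) v * cfun.representation B' (g v) w)"
    by (subst sum.swap) (simp add: mult.commute)
  also have "\<dots> = (\<Sum>w\<in>B'. cfun.representation B' (g (f w)) w)"
    by (intro sum.cong refl expand[OF B' B g, symmetric]) (auto intro: fV BV')
  finally show ?thesis .
qed

text \<open>Unpacks the choice inside \<open>trace_on\<close> once and for all. Finiteness of the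
  chosen basis is not part of the definition; it follows from the finite spanning set.\<close>

lemma span_basis_ex:
  assumes "finite S" "cfun.span S = V"
  obtains B where "cfun.independent B" "finite B" "cfun.span B = V"
    "\<And>f. trace_on V f = (\<Sum>v\<in>B. cfun.representation B (f v) v)"
proof -
  let ?P = "\<lambda>B. cfun.independent B \<and> cfun.span B = V"
  obtain C where "C \<subseteq> S" "cfun.independent C" "S \<subseteq> cfun.span C"
    using cfun.maximal_independent_subset by blast
  then have "?P C"
    using assms(2) by (metis cfun.span_mono cfun.span_span subset_antisym)
  then have P: "?P (Eps ?P)" by (rule someI)
  moreover have "finite (Eps ?P)"
    using cfun.independent_span_bound[OF assms(1)] P assms(2) cfun.span_superset by metis
  ultimately show thesis
    by (intro that[of "Eps ?P"]) (auto simp: trace_on_def Let_def)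
qed

lemma trace_on_basis:
  assumes "cfun.independent B" "finite B" "cfun.span B = V"
    and f: "Vector_Spaces.linear fscale fscale f" "f ` V \<subseteq> V"
  shows "trace_on V f = (\<Sum>v\<in>B. cfun.representation B (f v) v)"
proof -
  obtain C where C: "cfun.independent C" "finite C" "cfun.span C = V"
    "trace_on V f = (\<Sum>v\<in>C. cfun.representation C (f v) v)"
    using span_basis_ex[OF assms(2,3)] by metis
  show ?thesis
    using trace_commute_bases[OF C(1-3) assms(1-3) f cfun.linear_id] C(4) by simp
qed

lemma trace_on_commute:
  assumes V: "finite S" "cfun.span S = V"
    and f: "Vector_Spaces.linear fscale fscale f" "f ` V \<subseteq> V"
    and g: "Vector_Spaces.linear fscale fscale g" "g ` V \<subseteq> V"
  shows "trace_on V (\<lambda>v. f (g v)) = trace_on V (\<lambda>v. g (f v))"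
proof -
  obtain C where C: "cfun.independent C" "finite C" "cfun.span C = V"
    "\<And>f. trace_on V f = (\<Sum>v\<in>C. cfun.representation C (f v) v)"
    using span_basis_ex[OF V] by metis
  show ?thesis
    using trace_commute_bases[OF C(1-3) C(1-3) f g] C(4) by simp
qed

text \<open>Over lists, since the cycles in the Jucys--Murphy product are enumerated by a list and
  counted by its length.\<close>

lemma trace_on_sum_list:
  assumes V: "finite S" "cfun.span S = V" and fs: "\<And>x. x \<in> set xs \<Longrightarrow> f x ` V \<subseteq> V"
  shows "trace_on V (\<lambda>v. \<Sum>x\<leftarrow>xs. f x v) = (\<Sum>x\<leftarrow>xs. trace_on V (f x))"
proof -
  obtain C where C: "cfun.independent C" "finite C" "cfun.span C = V"
    "\<And>f. trace_on V f = (\<Sum>v\<in>C. cfun.representation C (f v) v)"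
    using span_basis_ex[OF V] by metis
  have CV: "v \<in> V" if "v \<in> C" for v using that C(3) cfun.span_base by blast
  have "(\<Sum>x\<leftarrow>xs. f x v) \<in> V \<and>
      cfun.representation C (\<Sum>x\<leftarrow>xs. f x v) = (\<lambda>w. \<Sum>x\<leftarrow>xs. cfun.representation C (f x v) w)"
    if v: "v \<in> C" for v
    using fs
  proof (induction xs)
    case Nil
    have "(0 :: 'a \<Rightarrow> complex) \<in> V" using C(3) cfun.span_zero by metis
    then show ?case by (simp add: cfun.representation_zero flip: zero_fun_def)
  next
    case (Cons x xs)
    have "f x v \<in> V" using Cons.prems[of x] CV[OF v] by auto
    moreover have "(\<Sum>x\<leftarrow>xs. f x v) \<in> V"
      "cfun.representation C (\<Sum>x\<leftarrow>xs. f x v) = (\<lambda>w. \<Sum>x\<leftarrow>xs. cfun.representation C (f x v) w)"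
      using Cons by auto
    moreover have "(\<Sum>x\<leftarrow>x # xs. f x v) = f x v + (\<Sum>x\<leftarrow>xs. f x v)" by simp
    ultimately show ?case
      using C(1,3) cfun.span_add cfun.representation_add
      by (metis (mono_tags, lifting) list.simps(9) sum_list.Cons)
  qed
  then have "trace_on V (\<lambda>v. \<Sum>x\<leftarrow>xs. f x v) = (\<Sum>v\<in>C. \<Sum>x\<leftarrow>xs. cfun.representation C (f x v) v)"
    by (simp add: C(4))
  also have "\<dots> = (\<Sum>x\<leftarrow>xs. trace_on V (f x))"
    by (induction xs) (auto simp: C(4) sum.distrib)
  finally show ?thesis .
qed

lemma perm_action_linear: "Vector_Spaces.linear fscale fscale (perm_action \<sigma>)"
  by unfold_locales (auto simp: perm_action_def fscale_def fun_eq_iff)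

lemma perm_action_comp:
  assumes "bij \<sigma>" "bij \<tau>"
  shows "perm_action (\<sigma> \<circ> \<tau>) v = perm_action \<sigma> (perm_action \<tau> v)"
  using assms by (simp add: perm_action_def o_inv_distrib image_comp)

lemma perm_action_id: "perm_action id v = v"
  by (simp add: perm_action_def)

section \<open>Polytabloids\<close>

lemma sum_fun_apply: "(\<Sum>i\<in>A. f i) x = (\<Sum>i\<in>A. f i x)"
  for f :: "'i \<Rightarrow> 'a \<Rightarrow> 'b::comm_monoid_add"
  by (induction A rule: infinite_finite_induct) auto

text \<open>A bijection from \<open>B - B'\<close> to \<open>B' - B\<close> raises every element,
  and the common part contributes equally. In the application B' is the image of B under a
  permutation that mixes B with larger numbers.\<close>

lemma sum_less_sum_of_card_eq:
  fixes B B' :: "nat set"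
  assumes "finite B" "finite B'" "card B = card B'" "B \<noteq> B'"
    and less: "\<And>x y. x \<in> B' - B \<Longrightarrow> y \<in> B \<Longrightarrow> y < x"
  shows "\<Sum>B < \<Sum>B'"
proof -
  have c: "card (B - B') = card (B' - B)"
    using assms(1-3) by (metis card_Diff_subset_Int finite_Int inf_commute)
  then obtain h where h: "bij_betw h (B - B') (B' - B)"
    using assms(1,2) finite_same_card_bij by blast
  have "B - B' \<noteq> {}"
    using assms(1,2,4) c by (metis Diff_eq_empty_iff card_0_eq card_eq_0_iff finite_Diff subset_antisym)
  then have "\<Sum>(B - B') < (\<Sum>y\<in>B - B'. h y)"
    using assms(1) less h by (intro sum_strict_mono) (auto simp: bij_betw_def)
  also have "\<dots> = \<Sum>(B' - B)"
    using sum.reindex_bij_betw[OF h, of "\<lambda>x. x"] by simp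
  finally have "\<Sum>(B - B') < \<Sum>(B' - B)" .
  moreover have "\<Sum>B = \<Sum>(B - B') + \<Sum>(B \<inter> B')"
    using sum.Int_Diff[OF assms(1), of "\<lambda>x. x" B'] by simp
  moreover have "\<Sum>B' = \<Sum>(B' - B) + \<Sum>(B \<inter> B')"
    using sum.Int_Diff[OF assms(2), of "\<lambda>x. x" B] by (simp add: Int_commute)
  ultimately show ?thesis by linarith
qed

abbreviation sg :: "(nat \<Rightarrow> nat) \<Rightarrow> complex"
  where "sg \<pi> \<equiv> of_int (sign \<pi>)"

lemma sg_sq: "sg \<pi> * sg \<pi> = 1"
  by (metis of_int_1 of_int_mult sign_idempotent)

lemma sg_comp: "\<pi> permutes A \<Longrightarrow> \<rho> permutes B \<Longrightarrow> finite A \<Longrightarrow> finite B \<Longrightarrow>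
    sg (\<pi> \<circ> \<rho>) = sg \<pi> * sg \<rho>"
  using sign_compose permutation_permutes by (metis of_int_mult)

lemma sg_inv: "\<pi> permutes A \<Longrightarrow> finite A \<Longrightarrow> sg (inv \<pi>) = sg \<pi>"
  using permutation_permutes sign_inverse by metis

locale partition =
  fixes mu :: "nat list" and n :: nat
  assumes part: "mu \<turnstile>\<^sub>p n"
begin

abbreviation "D \<equiv> young_diagram mu"
abbreviation "pt \<equiv> polytabloid mu"
abbreviation "tabs \<equiv> tableaux mu"
abbreviation "cst \<equiv> column_stabilizer mu"
abbreviation "tbd \<equiv> tabloid mu"

definition colset :: "(nat \<times> nat \<Rightarrow> nat) \<Rightarrow> nat \<Rightarrow> nat set"
  where "colset t j = {t (i, j) | i. (i, j) \<in> D}"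

lemma sum_mu: "sum_list mu = n"
  using part by (simp add: partition_of_def)

lemma D_eq: "D = Sigma {..<length mu} (\<lambda>i. {..<mu ! i})"
  by (auto simp: young_diagram_def)

lemma finite_D: "finite D"
  by (simp add: D_eq)

lemma card_D: "card D = n"
proof -
  have "card D = (\<Sum>i<length mu. mu ! i)"
    unfolding D_eq by (subst card_SigmaI) auto
  then show ?thesis
    using sum_mu by (simp add: sum_list_sum_nth atLeast0LessThan)
qed

lemma D_down: "(i, j) \<in> D \<Longrightarrow> i' \<le> i \<Longrightarrow> j' \<le> j \<Longrightarrow> (i', j') \<in> D"
proof -
  assume a: "(i, j) \<in> D" "i' \<le> i" "j' \<le> j"
  have "mu ! i \<le> mu ! i'"
    using part a sorted_wrt_nth_less[of "(\<ge>)" mu i' i]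
    by (cases "i' = i") (auto simp: partition_of_def young_diagram_def)
  then show ?thesis
    using a by (auto simp: young_diagram_def)
qed

definition clen :: "nat \<Rightarrow> nat"
  where "clen j = card {i. (i, j) \<in> D}"

text \<open>Columns have no gaps. Working with \<open>clen\<close> takes the place of the conjugate
  partition.\<close>

lemma D_iff: "(i, j) \<in> D \<longleftrightarrow> i < clen j"
proof -
  have fin: "finite {i. (i, j) \<in> D}"
    by (rule finite_subset[of _ "fst ` D"]) (force simp: finite_D)+
  have "\<exists>m. {i. (i, j) \<in> D} = {..<m}"
  proof (cases "{i. (i, j) \<in> D} = {}")
    case True
    then show ?thesis by (intro exI[of _ 0]) auto
  next
    case False
    then have "(Max {i. (i, j) \<in> D}, j) \<in> D"
      using Max_in[OF fin] by blast
    then have "i \<in> {i. (i, j) \<in> D} \<longleftrightarrow> i < Suc (Max {i. (i, j) \<in> D})" for i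
      using Max_ge[OF fin, of i] D_down[of _ j i j] by (metis le_refl less_Suc_eq_le mem_Collect_eq)
    then show ?thesis by blast
  qed
  then obtain m where m: "{i. (i, j) \<in> D} = {..<m}" by blast
  then have "clen j = m" by (simp add: clen_def)
  with m show ?thesis by auto
qed

lemma clen_antimono: "j \<le> j' \<Longrightarrow> clen j' \<le> clen j"
  by (metis D_down D_iff le_refl not_le)

lemma tabs_iff: "t \<in> tabs \<longleftrightarrow> bij_betw t D {1..n}"
  by (simp add: tableaux_def sum_mu)

lemma tabs_inj: "t \<in> tabs \<Longrightarrow> x \<in> D \<Longrightarrow> y \<in> D \<Longrightarrow> t x = t y \<longleftrightarrow> x = y"
  by (auto simp: tabs_iff bij_betw_def inj_on_def)

lemma tabs_range: "t \<in> tabs \<Longrightarrow> x \<in> D \<Longrightarrow> t x \<in> {1..n}"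
  by (auto simp: tabs_iff bij_betw_def)

lemma tabs_cell:
  assumes "t \<in> tabs" "m \<in> {1..n}"
  obtains i j where "(i, j) \<in> D" "t (i, j) = m"
  using assms that unfolding tabs_iff bij_betw_def by (metis imageE surj_pair)

lemma tabs_perm: "t \<in> tabs \<Longrightarrow> \<sigma> permutes {1..n} \<Longrightarrow> \<sigma> \<circ> t \<in> tabs"
  unfolding tabs_iff using bij_betw_trans permutes_imp_bij by blast

lemma colset_eq: "colset t j = (\<lambda>i. t (i, j)) ` {..<clen j}"
  by (auto simp: colset_def D_iff)

lemma colset_comp: "colset (\<sigma> \<circ> t) j = \<sigma> ` colset t j"
  by (auto simp: colset_def)

lemma colset_sub: "t \<in> tabs \<Longrightarrow> colset t j \<subseteq> {1..n}"
  using tabs_range by (auto simp: colset_def)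

lemma finite_colset [simp]: "finite (colset t j)"
  by (simp add: colset_eq)

lemma card_colset: "t \<in> tabs \<Longrightarrow> card (colset t j) = clen j"
  unfolding colset_eq by (subst card_image) (auto simp: inj_on_def tabs_inj D_iff)

lemma tbd_comp: "tbd (\<sigma> \<circ> t) = (\<lambda>i. \<sigma> ` tbd t i)"
  by (auto simp: tabloid_def fun_eq_iff)

lemma cst_iff: "\<pi> \<in> cst t \<longleftrightarrow> \<pi> permutes {1..n} \<and> (\<forall>j. \<pi> ` colset t j = colset t j)"
  by (simp add: column_stabilizer_def sum_mu colset_def)

lemma cst_perm: "\<pi> \<in> cst t \<Longrightarrow> \<pi> permutes {1..n}"
  by (simp add: cst_iff)

lemma finite_cst: "finite (cst t)"
  by (rule finite_subset[of _ "{\<pi>. \<pi> permutes {1..n}}"]) (auto simp: cst_iff finite_permutations)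

lemma cst_comp: "\<pi> \<in> cst t \<Longrightarrow> \<rho> \<in> cst t \<Longrightarrow> \<pi> \<circ> \<rho> \<in> cst t"
  unfolding cst_iff using permutes_compose by (metis image_comp)

lemma cst_inv:
  assumes "\<pi> \<in> cst t"
  shows "inv \<pi> \<in> cst t"
proof -
  have p: "\<pi> permutes {1..n}" and c: "\<And>j. \<pi> ` colset t j = colset t j"
    using assms by (auto simp: cst_iff)
  have "inv \<pi> ` colset t j = colset t j" for j
    using image_inv_f_f[OF permutes_inj[OF p], of "colset t j"] c[of j] by simp
  then show ?thesis using p by (simp add: cst_iff permutes_inv)
qed

lemma cst_cst: "\<pi> \<in> cst t \<Longrightarrow> cst (\<pi> \<circ> t) = cst t"
  by (auto simp: cst_iff colset_comp)

lemma pt_apply: "pt t X = (\<Sum>\<pi>\<in>cst t. sg \<pi> * (if X = tbd (\<pi> \<circ> t) then 1 else 0))"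
  by (simp add: polytabloid_def)

text \<open>Conjugation by g carries the column stabilizer of t to that of
  \<open>g \<circ> t\<close> and keeps signs. Thus all polytabloids of \<open>g \<circ> t\<close>
  are indexed by the one stabilizer of t, which allows the exchange of sums over g and
  \<pi>.\<close>

lemma pt_comp_apply:
  assumes g: "g permutes {1..n}"
  shows "pt (g \<circ> t) X = (\<Sum>\<pi>\<in>cst t. sg \<pi> * (if X = tbd (g \<circ> \<pi> \<circ> t) then 1 else 0))"
  unfolding pt_apply
proof (rule sum.reindex_bij_witness[of _ "\<lambda>\<pi>. g \<circ> \<pi> \<circ> inv g" "\<lambda>\<pi>. inv g \<circ> \<pi> \<circ> g"])
  note b = permutes_bij[OF g]
  have gg: "g \<circ> inv g = id" "inv g \<circ> g = id"
    using permutes_inv_o[OF g] by auto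
  fix \<pi> :: "nat \<Rightarrow> nat"
  show "g \<circ> (inv g \<circ> \<pi> \<circ> g) \<circ> inv g = \<pi>" "inv g \<circ> (g \<circ> \<pi> \<circ> inv g) \<circ> g = \<pi>"
    using permutes_inverses[OF g] by (auto simp: fun_eq_iff)
  {
    assume a: "\<pi> \<in> cst t"
    have "(g \<circ> \<pi> \<circ> inv g) ` colset (g \<circ> t) j = colset (g \<circ> t) j" for j
    proof -
      have "(g \<circ> \<pi> \<circ> inv g) ` colset (g \<circ> t) j = g ` \<pi> ` inv g ` g ` colset t j"
        by (simp add: colset_comp image_comp comp_assoc)
      also have "\<dots> = g ` colset t j"
        using a image_inv_f_f[OF permutes_inj[OF g]] by (simp add: cst_iff)
      finally show ?thesis by (simp add: colset_comp)
    qed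
    then show "g \<circ> \<pi> \<circ> inv g \<in> cst (g \<circ> t)"
      using a g by (auto simp: cst_iff intro!: permutes_compose permutes_inv)
  }
  assume a: "\<pi> \<in> cst (g \<circ> t)"
  have "\<pi> ` (g ` colset t j) = g ` colset t j" for j
    using a by (simp add: cst_iff colset_comp)
  then have "inv g ` (\<pi> ` (g ` colset t j)) = colset t j" for j
    using image_inv_f_f[OF permutes_inj[OF g]] by simp
  then show "inv g \<circ> \<pi> \<circ> g \<in> cst t"
    using a g by (auto simp: cst_iff image_comp o_assoc intro!: permutes_compose permutes_inv)
  have "sg (inv g \<circ> \<pi> \<circ> g) = sg (inv g) * sg \<pi> * sg g"
    using a g sg_comp[of "inv g \<circ> \<pi>" "{1..n}" g "{1..n}"] sg_comp[of "inv g" "{1..n}" \<pi> "{1..n}"]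
    by (simp add: permutes_compose permutes_inv cst_iff del: One_nat_def)
  also have "\<dots> = sg \<pi>"
    using sg_sq[of g] sg_inv[OF g] by simp
  finally show "sg (inv g \<circ> \<pi> \<circ> g) * (if X = tbd (g \<circ> (inv g \<circ> \<pi> \<circ> g) \<circ> t) then 1 else 0) =
      sg \<pi> * (if X = tbd (\<pi> \<circ> (g \<circ> t)) then 1 else 0)"
    by (simp add: o_assoc gg)
qed

lemma perm_action_pt:
  assumes g: "g permutes {1..n}"
  shows "perm_action g (pt t) = pt (g \<circ> t)"
proof
  fix X :: "nat \<Rightarrow> nat set"
  have "inv g ` A = B \<longleftrightarrow> A = g ` B" for A B
    using permutes_bij[OF g] by (metis bij_is_inj bij_is_surj image_f_inv_f image_inv_f_f)
  then have "(\<lambda>i. inv g ` X i) = Y \<longleftrightarrow> X = (\<lambda>i. g ` Y i)" for Y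
    by (simp add: fun_eq_iff)
  then show "perm_action g (pt t) X = pt (g \<circ> t) X"
    by (subst pt_comp_apply[OF g]) (simp add: perm_action_def pt_apply comp_assoc tbd_comp[of g])
qed

lemma pt_cst:
  assumes p: "\<pi> \<in> cst t"
  shows "pt (\<pi> \<circ> t) = fscale (sg \<pi>) (pt t)"
proof
  fix X :: "nat \<Rightarrow> nat set"
  have pp: "\<pi> permutes {1..n}" using p cst_perm by blast
  have "sg \<pi> * pt t X = (\<Sum>\<rho>\<in>cst t. sg \<pi> * (sg \<rho> * (if X = tbd (\<rho> \<circ> t) then 1 else 0)))"
    by (simp add: pt_apply sum_distrib_left)
  also have "\<dots> = (\<Sum>\<rho>\<in>cst t. sg \<rho> * (if X = tbd (\<rho> \<circ> \<pi> \<circ> t) then 1 else 0))"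
  proof (rule sum.reindex_bij_witness[of _ "\<lambda>\<rho>. \<rho> \<circ> \<pi>" "\<lambda>\<rho>. \<rho> \<circ> inv \<pi>"])
    fix \<rho> :: "nat \<Rightarrow> nat"
    show "\<rho> \<circ> inv \<pi> \<circ> \<pi> = \<rho>" "\<rho> \<circ> \<pi> \<circ> inv \<pi> = \<rho>"
      using permutes_inverses[OF pp] by (auto simp: fun_eq_iff)
    assume r: "\<rho> \<in> cst t"
    show "\<rho> \<circ> inv \<pi> \<in> cst t" "\<rho> \<circ> \<pi> \<in> cst t"
      using r p cst_comp cst_inv by auto
    have "sg (\<rho> \<circ> inv \<pi>) = sg \<rho> * sg \<pi>"
      using sg_comp[OF cst_perm[OF r] permutes_inv[OF pp]] sg_inv[OF pp] by simp
    then show "sg (\<rho> \<circ> inv \<pi>) * (if X = tbd (\<rho> \<circ> inv \<pi> \<circ> \<pi> \<circ> t) then 1 else 0) =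
         sg \<pi> * (sg \<rho> * (if X = tbd (\<rho> \<circ> t) then 1 else 0))"
      using permutes_inv_o[OF pp] by (simp add: comp_assoc)
  qed
  also have "\<dots> = pt (\<pi> \<circ> t) X"
    by (simp add: pt_apply cst_cst[OF p] comp_assoc)
  finally show "pt (\<pi> \<circ> t) X = fscale (sg \<pi>) (pt t) X"
    by (simp add: fscale_def)
qed

section \<open>Garnir relations\<close>

text \<open>Fix \<pi> and pair g with \<open>g \<circ> transpose x y\<close>: since x and y share a
  row of the tabloid, the tabloid stays the same and the sign flips. Hence the sum over g for each
  \<pi> equals its own negative.\<close>

lemma antisymmetrizer_pt_eq_0:
  assumes U: "U \<subseteq> {1..n}"
    and ex: "\<And>\<pi>. \<pi> \<in> cst t \<Longrightarrow>
      \<exists>x\<in>U. \<exists>y\<in>U. x \<noteq> y \<and> (\<exists>i. x \<in> tbd (\<pi> \<circ> t) i \<and> y \<in> tbd (\<pi> \<circ> t) i) \<and>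
        (\<forall>i. x \<in> tbd (\<pi> \<circ> t) i \<longleftrightarrow> y \<in> tbd (\<pi> \<circ> t) i)"
  shows "(\<Sum>g | g permutes U. fscale (sg g) (pt (g \<circ> t))) = 0"
proof
  fix X :: "nat \<Rightarrow> nat set"
  have finU: "finite U" using U finite_subset by blast
  have inner: "(\<Sum>g | g permutes U. sg g * (if X = tbd (g \<circ> \<pi> \<circ> t) then 1 else 0)) = 0"
    (is "?S = 0") if \<pi>: "\<pi> \<in> cst t" for \<pi>
  proof -
    obtain x y where xy: "x \<in> U" "y \<in> U" "x \<noteq> y"
      "\<And>i. x \<in> tbd (\<pi> \<circ> t) i \<longleftrightarrow> y \<in> tbd (\<pi> \<circ> t) i"
      using ex[OF \<pi>] by blast
    let ?\<tau> = "transpose x y"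
    have tau: "?\<tau> permutes U" using xy by (simp add: permutes_swap_id)
    have im: "?\<tau> ` tbd (\<pi> \<circ> t) i = tbd (\<pi> \<circ> t) i" for i
      using xy(4)[of i] transpose_image_eq by metis
    have "?S = (\<Sum>g | g permutes U. - (sg g * (if X = tbd (g \<circ> \<pi> \<circ> t) then 1 else 0)))"
    proof (rule sum.reindex_bij_witness[of _ "\<lambda>g. g \<circ> ?\<tau>" "\<lambda>g. g \<circ> ?\<tau>"])
      fix g assume "g \<in> {g. g permutes U}"
      then have g: "g permutes U" by simp
      show gtt: "g \<circ> ?\<tau> \<circ> ?\<tau> = g" by (simp add: comp_assoc)
      show "g \<circ> ?\<tau> \<circ> ?\<tau> = g" by (fact gtt)
      show "g \<circ> ?\<tau> \<in> {g. g permutes U}" using g tau permutes_compose by auto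
      then show "g \<circ> ?\<tau> \<in> {g. g permutes U}" .
      have "tbd (g \<circ> ?\<tau> \<circ> \<pi> \<circ> t) = tbd (g \<circ> \<pi> \<circ> t)"
        using im by (simp add: comp_assoc tbd_comp[of g] tbd_comp[of ?\<tau>])
      moreover have "sg (g \<circ> ?\<tau>) = - sg g"
        using sg_comp[OF g tau finU finU] xy(3) by (simp add: sign_swap_id)
      ultimately show "- (sg (g \<circ> ?\<tau>) * (if X = tbd (g \<circ> ?\<tau> \<circ> \<pi> \<circ> t) then 1 else 0)) =
          sg g * (if X = tbd (g \<circ> \<pi> \<circ> t) then 1 else 0)"
        by simp
    qed
    then show ?thesis by (simp add: sum_negf)
  qed
  have "(\<Sum>g | g permutes U. fscale (sg g) (pt (g \<circ> t))) X =
      (\<Sum>g | g permutes U. sg g * (\<Sum>\<pi>\<in>cst t. sg \<pi> * (if X = tbd (g \<circ> \<pi> \<circ> t) then 1 else 0)))"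
    unfolding sum_fun_apply fscale_def
    by (intro sum.cong refl arg_cong2[of _ _ _ _ "(*)"] pt_comp_apply)
      (use U permutes_subset in blast)
  also have "\<dots> = (\<Sum>g | g permutes U. \<Sum>\<pi>\<in>cst t. sg \<pi> * (sg g * (if X = tbd (g \<circ> \<pi> \<circ> t) then 1 else 0)))"
    by (simp add: sum_distrib_left algebra_simps)
  also have "\<dots> = (\<Sum>\<pi>\<in>cst t. sg \<pi> * (\<Sum>g | g permutes U. sg g * (if X = tbd (g \<circ> \<pi> \<circ> t) then 1 else 0)))"
    by (subst sum.swap) (simp add: sum_distrib_left)
  also have "\<dots> = 0" using inner by simp
  finally show "(\<Sum>g | g permutes U. fscale (sg g) (pt (g \<circ> t))) X = 0 X" by simp
qed

text \<open>If \<open>A\<close> and \<open>B\<close> together have more elements than the two columns have rows, then every tabloid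
  occurring in the polytabloid has an element of \<open>A\<close> and an element of \<open>B\<close> in a common row.\<close>

lemma garnir:
  assumes t: "t \<in> tabs" and A: "A \<subseteq> colset t j" and B: "B \<subseteq> colset t j'" and "j \<noteq> j'"
    and m: "clen j \<le> m" "clen j' \<le> m" "m < card A + card B"
  shows "(\<Sum>g | g permutes A \<union> B. fscale (sg g) (pt (g \<circ> t))) = 0"
proof (rule antisymmetrizer_pt_eq_0)
  show "A \<union> B \<subseteq> {1..n}" using A B colset_sub[OF t] by blast
next
  fix \<pi> assume p: "\<pi> \<in> cst t"
  let ?s = "\<pi> \<circ> t"
  have s: "?s \<in> tabs" using tabs_perm[OF t] p cst_perm by blast
  have col: "colset ?s k = colset t k" for k
    using p by (simp add: colset_comp cst_iff)
  \<comment> \<open>The rows in which column k of \<open>?s\<close> holds an element of C. For A and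
    B these are sets of rows below m whose sizes add up to more than m, so they share a row.\<close>
  define R where "R k C = {i. i < clen k \<and> ?s (i, k) \<in> C}" for k C
  have R: "card (R k C) = card C" if "C \<subseteq> colset t k" for k C
  proof -
    have "(\<lambda>i. ?s (i, k)) ` R k C = C"
      using that unfolding col[symmetric] by (auto simp: R_def colset_eq)
    moreover have "inj_on (\<lambda>i. ?s (i, k)) (R k C)"
      using tabs_inj[OF s] by (auto simp: inj_on_def R_def D_iff)
    ultimately show ?thesis using card_image by metis
  qed
  have "R j A \<inter> R j' B \<noteq> {}"
  proof
    assume "R j A \<inter> R j' B = {}"
    then have "card (R j A \<union> R j' B) = card A + card B"
      using R[OF A] R[OF B] by (subst card_Un_disjoint) (auto simp: R_def)
    moreover have "card (R j A \<union> R j' B) \<le> card {..<m}"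
      using m by (intro card_mono) (auto simp: R_def)
    ultimately show False using m by simp
  qed
  then obtain i where i: "i < clen j" "i < clen j'" "?s (i, j) \<in> A" "?s (i, j') \<in> B"
    by (auto simp: R_def)
  have row: "?s (i, k) \<in> tbd ?s i' \<longleftrightarrow> i' = i" if "i < clen k" for i' k
  proof
    assume "?s (i, k) \<in> tbd ?s i'"
    then obtain k' where k': "(i', k') \<in> D" "?s (i', k') = ?s (i, k)"
      unfolding tabloid_def by (smt (verit, ccfv_SIG) mem_Collect_eq)
    then show "i' = i" using tabs_inj[OF s k'(1), of "(i, k)"] that by (simp add: D_iff)
  next
    assume "i' = i"
    then show "?s (i, k) \<in> tbd ?s i'" using that D_iff unfolding tabloid_def by blast
  qed
  have "?s (i, j) \<noteq> ?s (i, j')" using tabs_inj[OF s] i assms(4) by (auto simp: D_iff)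
  then show "\<exists>x\<in>A \<union> B. \<exists>y\<in>A \<union> B. x \<noteq> y \<and> (\<exists>i. x \<in> tbd ?s i \<and> y \<in> tbd ?s i) \<and>
        (\<forall>i. x \<in> tbd ?s i \<longleftrightarrow> y \<in> tbd ?s i)"
    using i row by blast
qed

end

text \<open>The set in \<open>skew_SYT\<close> as a function of the cells alone, so that one notion
  covers diagrams, skew shapes and shapes with a cell removed.\<close>

definition SYT :: "(nat \<times> nat) set \<Rightarrow> (nat \<times> nat \<Rightarrow> nat) set"
  where "SYT D = {T \<in> extensional D. bij_betw T D {1..card D} \<and>
        (\<forall>i j j'. (i, j) \<in> D \<and> (i, j') \<in> D \<and> j < j' \<longrightarrow> T (i, j) < T (i, j')) \<and>
        (\<forall>i i' j. (i, j) \<in> D \<and> (i', j) \<in> D \<and> i < i' \<longrightarrow> T (i, j) < T (i', j))}"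

lemma skew_SYT_eq: "skew_SYT lam nu = SYT (young_diagram lam - young_diagram nu)"
  by (simp add: skew_SYT_def SYT_def Let_def)

lemma permutes_image_eq:
  assumes "g permutes U" "g ` (C \<inter> U) = C \<inter> U"
  shows "g ` C = C"
proof -
  have "g ` (C - U) = C - U"
    using permutes_not_in[OF assms(1)] by force
  then have "g ` (C \<inter> U \<union> (C - U)) = C \<inter> U \<union> (C - U)"
    using assms(2) by (simp only: image_Un)
  then show ?thesis by (simp add: Int_Diff_Un)
qed

lemma strict_mono_image_unique:
  fixes f g :: "nat \<Rightarrow> nat"
  assumes "f ` {..<m} = g ` {..<m}"
    and "\<And>i j. i < j \<Longrightarrow> j < m \<Longrightarrow> f i < f j" "\<And>i j. i < j \<Longrightarrow> j < m \<Longrightarrow> g i < g j"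
    and "i < m"
  shows "f i = g i"
proof -
  have *: "sorted (map h [0..<m]) \<and> distinct (map h [0..<m])"
    if "\<And>i j. i < j \<Longrightarrow> j < m \<Longrightarrow> h i < h j" for h :: "nat \<Rightarrow> nat"
  proof -
    have "sorted_wrt (<) (map h [0..<m])"
      using that by (auto simp: sorted_wrt_iff_nth_less)
    then show ?thesis by (simp add: strict_sorted_iff)
  qed
  have "map f [0..<m] = map g [0..<m]"
    using *[of f] *[of g] assms(1-3)
    by (intro sorted_distinct_set_unique) (auto simp: atLeast0LessThan)
  with assms(4) show ?thesis by simp
qed

context partition
begin

lemma colset_disjoint: "t \<in> tabs \<Longrightarrow> j \<noteq> j' \<Longrightarrow> colset t j \<inter> colset t j' = {}"
  by (auto simp: colset_def tabs_inj)

lemma permutes_tabs: "t \<in> tabs \<Longrightarrow> A \<subseteq> colset t j \<Longrightarrow> B \<subseteq> colset t j' \<Longrightarrow>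
    g permutes A \<union> B \<Longrightarrow> g permutes {1..n}"
  using permutes_subset[of g "A \<union> B" "{1..n}"] colset_sub[of t j] colset_sub[of t j'] by blast

text \<open>If g fixes B setwise it also fixes A, and every column meets \<open>A \<union> B\<close>
  in A, in B or not at all. These g are the terms of a Garnir relation that reproduce
  \<open>pt t\<close>.\<close>

lemma permutes_cst:
  assumes t: "t \<in> tabs" and A: "A \<subseteq> colset t j" and B: "B \<subseteq> colset t j'" and "j \<noteq> j'"
    and g: "g permutes A \<union> B" and gB: "g ` B = B"
  shows "g \<in> cst t"
proof -
  have disj: "A \<inter> B = {}" using colset_disjoint[OF t assms(4)] A B by blast
  then have AB: "A \<union> B - B = A" by blast
  have gA: "g ` A = A"
    using image_set_diff[OF permutes_inj[OF g], of "A \<union> B" B]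
    unfolding permutes_image[OF g] gB AB .
  have "g ` colset t k = colset t k" for k
  proof (rule permutes_image_eq[OF g])
    consider "k = j" | "k = j'" | "k \<noteq> j" "k \<noteq> j'" by blast
    then have "colset t k \<inter> (A \<union> B) \<in> {A, B, {}}"
    proof cases
      case 1
      then show ?thesis using A B colset_disjoint[OF t, of k j'] assms(4) by blast
    next
      case 2
      then show ?thesis using A B colset_disjoint[OF t, of k j] assms(4) by blast
    next
      case 3
      then show ?thesis using A B colset_disjoint[OF t, of k] by blast
    qed
    then show "g ` (colset t k \<inter> (A \<union> B)) = colset t k \<inter> (A \<union> B)"
      using gA gB by auto
  qed
  then show ?thesis using permutes_tabs[OF t A B g] by (simp add: cst_iff)
qed

lemma pt_cst_sg: "\<pi> \<in> cst t \<Longrightarrow> fscale (sg \<pi>) (pt (\<pi> \<circ> t)) = pt t"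
  using pt_cst[of \<pi> t] sg_sq[of \<pi>] by (simp add: fscale_def fun_eq_iff mult.assoc[symmetric])

lemma transpose_cst:
  assumes t: "t \<in> tabs" and "a \<in> colset t j" "b \<in> colset t j"
  shows "transpose a b \<in> cst t"
proof -
  have "transpose a b ` colset t k = colset t k" for k
    using assms colset_disjoint[OF t, of k j] by (cases "k = j") (auto simp: disjoint_iff intro!: transpose_image_eq)
  moreover have "transpose a b permutes {1..n}"
    using assms colset_sub by (blast intro: permutes_swap_id)
  ultimately show ?thesis by (simp add: cst_iff)
qed

text \<open>The Garnir relation for a whole column and a single entry b. The permutations of
  \<open>insert b ?A\<close> split into cosets represented by the \<open>transpose b c\<close>
  modulo the permutations of the column; the terms in a coset coincide, and their common number N is
  cancelled.\<close>

lemma garnir_one: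
  assumes t: "t \<in> tabs" and b: "b \<in> colset t j'" and "j \<noteq> j'" "clen j' \<le> clen j"
  shows "pt t = (\<Sum>a\<in>colset t j. pt (transpose a b \<circ> t))"
proof -
  let ?A = "colset t j" and ?P = "{q. q permutes colset t j}"
  let ?F = "\<lambda>g. fscale (sg g) (pt (g \<circ> t))"
  have bA: "b \<notin> ?A" using b colset_disjoint[OF t assms(3)] by blast
  define N where "N = of_nat (card ?P) * (1 :: complex)"
  have "card ?P \<noteq> 0"
    using finite_permutations[of ?A] by (auto simp: card_eq_0_iff intro: permutes_id)
  then have N: "N \<noteq> 0" by (simp add: N_def)
  have F: "?F (transpose b c \<circ> q) = fscale (sg (transpose b c)) (pt (transpose b c \<circ> t))"
    if c: "c \<in> insert b ?A" and q: "q permutes ?A" for c q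
  proof -
    have qc: "q \<in> cst t" using permutes_cst[OF t _ _ assms(3), of ?A "{}" q] q by simp
    have tr: "transpose b c permutes {1..n}"
      using b c colset_sub[OF t] by (intro permutes_swap_id) blast+
    have "sg (transpose b c \<circ> q) = sg (transpose b c) * sg q"
      using sg_comp[OF tr cst_perm[OF qc]] by simp
    moreover have "pt (transpose b c \<circ> q \<circ> t) = fscale (sg q) (pt (transpose b c \<circ> t))"
      using perm_action_pt[OF tr, of "q \<circ> t"] perm_action_pt[OF tr, of t]
      by (simp add: pt_cst[OF qc] comp_assoc) (simp add: perm_action_def fscale_def fun_eq_iff)
    ultimately show ?thesis
      using sg_sq[of q] by (simp add: fscale_def fun_eq_iff mult.assoc[symmetric])
  qed
  have "0 = (\<Sum>g | g permutes insert b ?A. ?F g)"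
    using garnir[OF t subset_refl _ assms(3), of "{b}" "clen j"] b assms(4) card_colset[OF t] by simp
  also have "\<dots> = (\<Sum>c\<in>insert b ?A. \<Sum>q\<in>?P. ?F (transpose b c \<circ> q))"
    by (rule sum_over_permutations_insert[OF finite_colset bA])
  also have "\<dots> = (\<Sum>c\<in>insert b ?A. \<Sum>q\<in>?P. fscale (sg (transpose b c)) (pt (transpose b c \<circ> t)))"
    using F by (intro sum.cong refl) simp
  finally have 0: "(\<Sum>c\<in>insert b ?A. \<Sum>q\<in>?P. fscale (sg (transpose b c)) (pt (transpose b c \<circ> t))) = 0"
    by simp
  show ?thesis
  proof
    fix X
    have sgn: "sg (transpose b c) = -1" if "c \<in> ?A" for c
      using that bA by (subst sign_swap_id) auto
    have "0 = (\<Sum>c\<in>insert b ?A. \<Sum>q\<in>?P. fscale (sg (transpose b c)) (pt (transpose b c \<circ> t))) X"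
      unfolding 0 by simp
    also have "\<dots> = N * (\<Sum>c\<in>insert b ?A. sg (transpose b c) * pt (transpose b c \<circ> t) X)"
      by (simp add: sum_fun_apply fscale_def N_def sum_distrib_left del: sum.insert)
    also have "(\<Sum>c\<in>insert b ?A. sg (transpose b c) * pt (transpose b c \<circ> t) X) =
        pt t X + (\<Sum>c\<in>?A. - pt (transpose b c \<circ> t) X)"
      using bA by (simp add: sgn sign_id)
    finally show "pt t X = (\<Sum>a\<in>?A. pt (transpose a b \<circ> t)) X"
      using N by (simp add: sum_fun_apply sum_negf transpose_commute)
  qed
qed

section \<open>Weights that order the tableaux\<close>

text \<open>Large entries further to the right increase \<open>wc\<close>, large entries further
  down increase \<open>wr\<close>. The first is constant under column permutations and grades the
  Specht module; the second depends only on the tabloid and selects leading terms.\<close>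

definition wt :: "(nat \<times> nat \<Rightarrow> int) \<Rightarrow> (nat \<times> nat \<Rightarrow> nat) \<Rightarrow> int"
  where "wt \<phi> t = (\<Sum>x\<in>D. \<phi> x * int (t x))"

abbreviation "wc \<equiv> wt (\<lambda>x. int (snd x))"
abbreviation "wr \<equiv> wt (\<lambda>x. int (fst x))"

text \<open>The total of the entries in \<open>A \<union> B\<close> is preserved by g. So the weight
  changes by \<open>q - p\<close> times the growth of the sum over B, and B can only receive larger
  elements.\<close>

lemma wt_less:
  assumes t: "t \<in> tabs" and AB: "A \<subseteq> {1..n}" "B \<subseteq> {1..n}" "A \<inter> B = {}"
    and less: "\<And>a b. a \<in> A \<Longrightarrow> b \<in> B \<Longrightarrow> b < a"
    and p: "\<And>x. x \<in> D \<Longrightarrow> t x \<in> A \<Longrightarrow> \<phi> x = p" and q: "\<And>x. x \<in> D \<Longrightarrow> t x \<in> B \<Longrightarrow> \<phi> x = q"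
    and "p < q" and g: "g permutes A \<union> B" and gB: "g ` B \<noteq> B"
  shows "wt \<phi> t < wt \<phi> (g \<circ> t)"
proof -
  have fin: "finite A" "finite B" using AB finite_subset by blast+
  \<comment> \<open>The weight of a cell as a function of its entry: the sum then runs over entries,
    and those outside \<open>A \<union> B\<close> drop out.\<close>
  define \<psi> where "\<psi> y = \<phi> (inv_into D t y)" for y
  have bij: "bij_betw t D {1..n}" using t tabs_iff by blast
  have psi: "\<psi> (t x) = \<phi> x" if "x \<in> D" for x
    using that bij by (simp add: \<psi>_def bij_betw_inv_into_left)
  let ?d = "\<lambda>y. int (g y) - int y"
  have "wt \<phi> (g \<circ> t) - wt \<phi> t = (\<Sum>x\<in>D. \<psi> (t x) * ?d (t x))"
    by (simp add: wt_def psi sum_subtractf[symmetric] algebra_simps)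
  also have "\<dots> = (\<Sum>y\<in>{1..n}. \<psi> y * ?d y)"
    by (rule sum.reindex_bij_betw[OF bij])
  also have "\<dots> = (\<Sum>y\<in>A \<union> B. \<psi> y * ?d y)"
    using AB permutes_not_in[OF g] by (intro sum.mono_neutral_right) auto
  also have "\<dots> = (\<Sum>y\<in>A. \<psi> y * ?d y) + (\<Sum>y\<in>B. \<psi> y * ?d y)"
    using fin AB(3) by (rule sum.union_disjoint)
  also have "(\<Sum>y\<in>A. \<psi> y * ?d y) = (\<Sum>y\<in>A. p * ?d y)"
  proof (intro sum.cong refl)
    fix y assume "y \<in> A"
    then obtain x where "x \<in> D" "t x = y" using AB(1) bij by (metis bij_betw_def imageE subsetD)
    then show "\<psi> y * ?d y = p * ?d y" using psi p \<open>y \<in> A\<close> by metis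
  qed
  also have "(\<Sum>y\<in>B. \<psi> y * ?d y) = (\<Sum>y\<in>B. q * ?d y)"
  proof (intro sum.cong refl)
    fix y assume "y \<in> B"
    then obtain x where "x \<in> D" "t x = y" using AB(2) bij by (metis bij_betw_def imageE subsetD)
    then show "\<psi> y * ?d y = q * ?d y" using psi q \<open>y \<in> B\<close> by metis
  qed
  also have "(\<Sum>y\<in>A. p * ?d y) + (\<Sum>y\<in>B. q * ?d y) = p * sum ?d (A \<union> B) + (q - p) * sum ?d B"
    using sum.union_disjoint[OF fin AB(3), of ?d]
    by (simp only: sum_distrib_left[symmetric]) (simp add: algebra_simps)
  also have "sum ?d (A \<union> B) = 0"
    using sum.permute[OF g, of int] by (simp add: sum_subtractf o_def)
  also have "sum ?d B = int (\<Sum>(g ` B)) - int (\<Sum>B)"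
    using permutes_inj_on[OF g, of B] by (simp add: sum_subtractf sum.reindex)
  finally have "wt \<phi> (g \<circ> t) - wt \<phi> t = (q - p) * (int (\<Sum>(g ` B)) - int (\<Sum>B))"
    by (simp add: o_def)
  moreover have "\<Sum>B < \<Sum>(g ` B)"
  proof (rule sum_less_sum_of_card_eq)
    show "card B = card (g ` B)" using permutes_inj_on[OF g, of B] by (simp add: card_image)
    fix x y assume "x \<in> g ` B - B" "y \<in> B"
    then have "x \<in> A" using permutes_in_image[OF g] by blast
    then show "y < x" using less \<open>y \<in> B\<close> by blast
  qed (use fin gB in auto)
  ultimately show ?thesis
    using \<open>p < q\<close> by (smt (verit, best) mult_pos_pos of_nat_less_iff)
qed

lemma wc_less:
  assumes t: "t \<in> tabs" and A: "A \<subseteq> colset t j" and B: "B \<subseteq> colset t j'" and "j < j'"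
    and less: "\<And>a b. a \<in> A \<Longrightarrow> b \<in> B \<Longrightarrow> b < a"
    and g: "g permutes A \<union> B" "g ` B \<noteq> B"
  shows "wc t < wc (g \<circ> t)"
proof (rule wt_less[OF t _ _ _ less _ _ _ g])
  show "A \<subseteq> {1..n}" "B \<subseteq> {1..n}" using A B colset_sub[OF t] by blast+
  show "A \<inter> B = {}" using colset_disjoint[OF t, of j j'] A B \<open>j < j'\<close> by blast
  have "snd x = k" if x: "x \<in> D" and k: "t x \<in> colset t k" for x k
  proof -
    obtain i where i: "(i, k) \<in> D" "t x = t (i, k)" using k by (auto simp: colset_def)
    then have "x = (i, k)" using tabs_inj[OF t x] by metis
    then show ?thesis by simp
  qed
  then show "int (snd x) = int j" if "x \<in> D" "t x \<in> A" for x using that A by blast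
  show "int (snd x) = int j'" if "x \<in> D" "t x \<in> B" for x
    using that B \<open>\<And>x k. x \<in> D \<Longrightarrow> t x \<in> colset t k \<Longrightarrow> snd x = k\<close> by blast
qed (use \<open>j < j'\<close> in auto)

lemma wc_transpose:
  assumes t: "t \<in> tabs" and "a \<in> colset t j" "b \<in> colset t j'" "j < j'" "b < a"
  shows "wc t < wc (transpose a b \<circ> t)"
  by (rule wc_less[OF t, of "{a}" j "{b}" j']) (use assms in \<open>auto intro: permutes_swap_id\<close>)

text \<open>Grouped by h, the weight sees only the set of entries on each level: column sets
  determine \<open>wc\<close>, and row sets, that is the tabloid, determine
  \<open>wr\<close>.\<close>

lemma wt_group:
  assumes t: "t \<in> tabs"
  shows "wt (\<lambda>x. int (h x)) t = (\<Sum>y\<in>h ` D. int y * int (\<Sum>(t ` {x \<in> D. h x = y})))"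
proof -
  have "wt (\<lambda>x. int (h x)) t = (\<Sum>y\<in>h ` D. \<Sum>x\<in>{x \<in> D. h x = y}. int (h x) * int (t x))"
    unfolding wt_def by (rule sum.image_gen[OF finite_D])
  also have "\<dots> = (\<Sum>y\<in>h ` D. int y * int (\<Sum>(t ` {x \<in> D. h x = y})))"
  proof (intro sum.cong refl)
    fix y
    have "inj_on t {x \<in> D. h x = y}" using tabs_inj[OF t] by (auto simp: inj_on_def)
    then show "(\<Sum>x\<in>{x \<in> D. h x = y}. int (h x) * int (t x)) = int y * int (\<Sum>(t ` {x \<in> D. h x = y}))"
      by (simp add: sum.reindex sum_distrib_left)
  qed
  finally show ?thesis .
qed

lemma wc_cst: "t \<in> tabs \<Longrightarrow> \<pi> \<in> cst t \<Longrightarrow> wc (\<pi> \<circ> t) = wc t"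
proof -
  assume a: "t \<in> tabs" "\<pi> \<in> cst t"
  have "s ` {x \<in> D. snd x = y} = colset s y" for s y
    by (force simp: colset_def)
  then show ?thesis
    using a wt_group[of _ snd] tabs_perm[OF a(1)] by (auto simp: colset_comp cst_iff)
qed

lemma wr_tbd: "t \<in> tabs \<Longrightarrow> s \<in> tabs \<Longrightarrow> tbd s = tbd t \<Longrightarrow> wr s = wr t"
proof -
  assume a: "t \<in> tabs" "s \<in> tabs" "tbd s = tbd t"
  have "u ` {x \<in> D. fst x = y} = tbd u y" for u y
    by (force simp: tabloid_def)
  then show ?thesis
    using a wt_group[of _ fst] by auto
qed

lemma wt_le: "t \<in> tabs \<Longrightarrow> wt (\<lambda>x. int (h x)) t \<le> (\<Sum>x\<in>D. int (h x) * int n)"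
  unfolding wt_def using tabs_range by (intro sum_mono mult_left_mono) auto

text \<open>Transposing an out-of-order pair of a column moves the larger entry down. The weight
  \<open>wr\<close> grows while the polytabloid merely changes sign.\<close>

lemma column_descent:
  assumes t: "t \<in> tabs" and D: "(i, j) \<in> D" "(i', j) \<in> D" and "i < i'" "t (i', j) < t (i, j)"
  obtains \<pi> where "\<pi> \<in> cst t" "sg \<pi> = -1" "wr t < wr (\<pi> \<circ> t)"
proof
  let ?p = "transpose (t (i, j)) (t (i', j))"
  show "?p \<in> cst t" using D by (intro transpose_cst[OF t, of _ j]) (auto simp: colset_def)
  show "sg ?p = -1" using assms(5) by (subst sign_swap_id) auto
  show "wr t < wr (?p \<circ> t)"
  proof (rule wt_less[OF t, of "{t (i, j)}" "{t (i', j)}" _ "int i" "int i'"])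
    show "int (fst x) = int i" if "x \<in> D" "t x \<in> {t (i, j)}" for x
      using that tabs_inj[OF t _ D(1)] by auto
    show "int (fst x) = int i'" if "x \<in> D" "t x \<in> {t (i', j)}" for x
      using that tabs_inj[OF t _ D(2)] by auto
    show "?p permutes {t (i, j)} \<union> {t (i', j)}" by (intro permutes_swap_id) auto
  qed (use assms tabs_range[OF t D(1)] tabs_range[OF t D(2)] in auto)
qed

text \<open>Members of \<open>tableaux\<close> are arbitrary outside the diagram, members of
  \<open>SYT\<close> are extensional there; this passes between the two.\<close>

lemma pt_cong:
  assumes "\<And>x. x \<in> D \<Longrightarrow> s x = t x"
  shows "pt s = pt t"
proof -
  have "colset s j = colset t j" for j
    using assms by (simp add: colset_eq D_iff)
  then have "cst s = cst t" by (intro set_eqI) (simp only: cst_iff)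
  moreover have "tbd (\<pi> \<circ> s) = tbd (\<pi> \<circ> t)" for \<pi>
  proof
    fix i show "tbd (\<pi> \<circ> s) i = tbd (\<pi> \<circ> t) i"
      using assms by (auto simp: tabloid_def) metis+
  qed
  ultimately show ?thesis by (simp add: pt_apply fun_eq_iff)
qed

lemma SYT_iff: "t \<in> SYT D \<longleftrightarrow> t \<in> extensional D \<and> t \<in> tabs \<and>
        (\<forall>i j j'. (i, j) \<in> D \<and> (i, j') \<in> D \<and> j < j' \<longrightarrow> t (i, j) < t (i, j')) \<and>
        (\<forall>i i' j. (i, j) \<in> D \<and> (i', j) \<in> D \<and> i < i' \<longrightarrow> t (i, j) < t (i', j))"
  by (simp add: SYT_def card_D tabs_iff)

end

lemma finite_obtain_max:
  fixes f :: "'a \<Rightarrow> 'b::linorder"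
  assumes "finite S" "S \<noteq> {}"
  obtains x where "x \<in> S" "\<And>y. y \<in> S \<Longrightarrow> f y \<le> f x"
proof -
  have "Max (f ` S) \<in> f ` S" using assms by (intro Max_in) auto
  then obtain x where "x \<in> S" "f x = Max (f ` S)" by (metis imageE)
  then show thesis using that assms(1) Max_ge by (metis finite_imageI imageI)
qed

context partition
begin

text \<open>Both weights are bounded, and straightening increases \<open>(wc, wr)\<close> lexicographically.\<close>

lemma straightening:
  assumes "t \<in> tabs"
  shows "pt t \<in> cfun.span (pt ` {s \<in> SYT D. wc t \<le> wc s})"
  using assms
proof (induction t rule: wf_induct_rule[OF wf_measures[of
      "[\<lambda>t. nat ((\<Sum>x\<in>D. int (snd x) * int n) - wc t), \<lambda>t. nat ((\<Sum>x\<in>D. int (fst x) * int n) - wr t)]"]])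
  case (1 t)
  note t = \<open>t \<in> tabs\<close>
  let ?S = "\<lambda>t. cfun.span (pt ` {s \<in> SYT D. wc t \<le> wc s})"
  have mono: "?S s \<subseteq> ?S t" if "wc t \<le> wc s" for s
    using that by (intro cfun.span_mono) auto
  have IH1: "pt s \<in> ?S t" if "s \<in> tabs" "wc t < wc s" for s
    using 1(1)[of s] mono[of s] that wt_le[of s snd] wt_le[OF t, of snd] by auto
  have IH2: "pt s \<in> ?S t" if "s \<in> tabs" "wc t = wc s" "wr t < wr s" for s
    using 1(1)[of s] that wt_le[of s fst] by auto
  let ?col = "\<exists>i i' j. (i, j) \<in> D \<and> (i', j) \<in> D \<and> i < i' \<and> t (i', j) < t (i, j)"
  let ?row = "\<exists>i j j'. (i, j) \<in> D \<and> (i, j') \<in> D \<and> j < j' \<and> t (i, j') < t (i, j)"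
  have inc: "t (i, j) < t (i', j)" if "\<not> ?col" "(i, j) \<in> D" "(i', j) \<in> D" "i < i'" for i i' j
  proof (rule ccontr)
    assume "\<not> t (i, j) < t (i', j)"
    then have "t (i', j) < t (i, j)" using tabs_inj[OF t that(2,3)] that(4) by simp
    then show False using that by blast
  qed
  have inc': "t (i, j) < t (i, j')" if "\<not> ?row" "(i, j) \<in> D" "(i, j') \<in> D" "j < j'" for i j j'
  proof (rule ccontr)
    assume "\<not> t (i, j) < t (i, j')"
    then have "t (i, j') < t (i, j)" using tabs_inj[OF t that(2,3)] that(4) by simp
    then show False using that by blast
  qed
  consider (col) ?col | (row) "\<not> ?col" ?row | (std) "\<not> ?col" "\<not> ?row" by blast
  then show ?case
  proof cases
    case col
    then obtain \<pi> where p: "\<pi> \<in> cst t" "sg \<pi> = -1" "wr t < wr (\<pi> \<circ> t)"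
      using column_descent[OF t] by blast
    have "pt (\<pi> \<circ> t) \<in> ?S t"
      by (intro IH2 tabs_perm[OF t] cst_perm[OF p(1)] p(3)) (simp add: wc_cst[OF t p(1)])
    then have "fscale (sg \<pi>) (pt (\<pi> \<circ> t)) \<in> ?S t" by (rule cfun.span_scale)
    then show ?thesis unfolding pt_cst_sg[OF p(1)] .
  next
    case row
    note nc = row(1)
    from row(2) obtain i j j' where row: "(i, j) \<in> D" "(i, j') \<in> D" "j < j'" "t (i, j') < t (i, j)"
      by blast
    \<comment> \<open>The Garnir sets for a descent in row i: column j from row i downwards and
      column j' down to row i. As columns increase, all of B lies below all of A, and together they
      have one element more than column j has rows.\<close>
    define A where "A = (\<lambda>i'. t (i', j)) ` {i..<clen j}"
    define B where "B = (\<lambda>i'. t (i', j')) ` {..i}"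
    let ?P = "{g. g permutes A \<union> B}" and ?F = "\<lambda>g. fscale (sg g) (pt (g \<circ> t))"
    have ij: "i < clen j" "i < clen j'" using row by (auto simp: D_iff)
    have A: "A \<subseteq> colset t j" by (auto simp: A_def colset_eq)
    have B: "B \<subseteq> colset t j'" using ij by (auto simp: B_def colset_eq)
    have "card A = clen j - i"
      unfolding A_def by (subst card_image) (auto simp: inj_on_def tabs_inj[OF t] D_iff)
    moreover have "card B = Suc i"
      unfolding B_def using ij by (subst card_image) (auto simp: inj_on_def tabs_inj[OF t] D_iff)
    ultimately have "clen j < card A + card B" using ij by simp
    then have 0: "(\<Sum>g\<in>?P. ?F g) = 0"
      using garnir[OF t A B _ order_refl clen_antimono] row(3) by simp
    have fin: "finite ?P" using finite_permutations[of "A \<union> B"] by (simp add: A_def B_def)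
    have less: "b < a" if ab: "a \<in> A" "b \<in> B" for a b
    proof -
      obtain i1 where i1: "a = t (i1, j)" "i \<le> i1" "i1 < clen j" using ab(1) by (auto simp: A_def)
      obtain i2 where i2: "b = t (i2, j')" "i2 \<le> i" using ab(2) by (auto simp: B_def)
      have "t (i, j) \<le> a" using i1 inc[OF nc, of i j i1] ij by (cases "i = i1") (auto simp: D_iff)
      moreover have "b \<le> t (i, j')" using i2 inc[OF nc, of i2 j' i] ij by (cases "i = i2") (auto simp: D_iff)
      ultimately show ?thesis using row(4) by simp
    qed
    \<comment> \<open>Each permutation that preserves B contributes \<open>pt t\<close> itself;
      every other one moves larger entries into column j' and so has larger \<open>wc\<close>. The
      relation is solved for \<open>pt t\<close>, with coefficient \<open>card ?Q\<close>.\<close>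
    let ?Q = "{g \<in> ?P. g ` B = B}"
    have Q: "?F g = pt t" if "g \<in> ?Q" for g
      using that permutes_cst[OF t A B] row(3) pt_cst_sg by simp
    have R: "?F g \<in> ?S t" if "g \<in> ?P - ?Q" for g
    proof -
      have g: "g permutes A \<union> B" "g ` B \<noteq> B" using that by auto
      have "wc t < wc (g \<circ> t)" by (rule wc_less[OF t A B row(3) less g])
      then have "pt (g \<circ> t) \<in> ?S t"
        using IH1 tabs_perm[OF t permutes_tabs[OF t A B g(1)]] by blast
      then show ?thesis by (rule cfun.span_scale)
    qed
    have "id \<in> ?Q" using permutes_id by auto
    moreover have QP: "?Q \<subseteq> ?P" by blast
    ultimately have "card ?Q \<noteq> 0"
      using card_0_eq[OF finite_subset[OF QP fin]] by blast
    have "(\<Sum>g\<in>?Q. ?F g) = (\<Sum>g\<in>?Q. pt t)" by (rule sum.cong[OF refl Q])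
    also have "\<dots> = fscale (of_nat (card ?Q)) (pt t)"
      by (simp add: fun_eq_iff sum_fun_apply fscale_def)
    finally have sumQ: "(\<Sum>g\<in>?Q. ?F g) = fscale (of_nat (card ?Q)) (pt t)" .
    from sum.subset_diff[OF QP fin, of ?F, symmetric] have "fscale (of_nat (card ?Q)) (pt t) = - (\<Sum>g\<in>?P - ?Q. ?F g)"
      unfolding 0 sumQ by (rule minus_unique[symmetric])
    also have "\<dots> \<in> ?S t"
      by (intro cfun.span_neg cfun.span_sum R)
    finally have "fscale (inverse (of_nat (card ?Q))) (fscale (of_nat (card ?Q)) (pt t)) \<in> ?S t"
      by (rule cfun.span_scale)
    also have "fscale (inverse (of_nat (card ?Q))) (fscale (of_nat (card ?Q)) (pt t)) = pt t"
      unfolding cfun.scale_scale using \<open>card ?Q \<noteq> 0\<close> by simp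
    finally show ?thesis .
  next
    case std
    let ?s = "restrict t D"
    have eq: "\<And>x. x \<in> D \<Longrightarrow> ?s x = t x" by simp
    have "?s \<in> SYT D"
      using inc[OF std(1)] inc'[OF std(2)] t by (auto simp: SYT_iff tabs_iff cong: bij_betw_cong)
    moreover have "wc ?s = wc t" by (simp add: wt_def)
    moreover have "pt ?s = pt t" using eq by (rule pt_cong)
    ultimately show ?thesis
      by (metis (mono_tags, lifting) cfun.span_base image_eqI mem_Collect_eq order_refl)
  qed
qed

section \<open>Linear independence of the standard polytabloids\<close>

lemma SYT_tabs: "t \<in> SYT D \<Longrightarrow> t \<in> tabs"
  by (simp add: SYT_iff)

lemma finite_SYT: "finite (SYT D)"
proof (rule finite_subset)
  show "SYT D \<subseteq> (D \<rightarrow>\<^sub>E {1..n})"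
    by (auto simp: SYT_iff PiE_def tabs_range simp del: One_nat_def intro!: funcsetI) (auto simp: tabs_iff bij_betw_def)
  show "finite (D \<rightarrow>\<^sub>E {1..n})" using finite_D by (intro finite_PiE) auto
qed

lemma column_increasing_unique:
  assumes t: "t \<in> SYT D" and p: "\<pi> \<in> cst t"
    and inc: "\<And>i i' j. (i, j) \<in> D \<Longrightarrow> (i', j) \<in> D \<Longrightarrow> i < i' \<Longrightarrow> \<pi> (t (i, j)) < \<pi> (t (i', j))"
    and x: "x \<in> D"
  shows "\<pi> (t x) = t x"
proof -
  obtain i j where ij: "x = (i, j)" by fastforce
  have "\<pi> (t (i, j)) = t (i, j)"
  proof (rule strict_mono_image_unique[where f = "\<lambda>i. \<pi> (t (i, j))" and g = "\<lambda>i. t (i, j)"])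
    show "(\<lambda>i. \<pi> (t (i, j))) ` {..<clen j} = (\<lambda>i. t (i, j)) ` {..<clen j}"
      using p by (simp add: cst_iff colset_eq image_image)
    show "i < clen j" using x ij D_iff by blast
  qed (use inc t in \<open>auto simp: SYT_iff D_iff\<close>)
  then show ?thesis using ij by simp
qed

text \<open>A member of the stabilizer that maximises \<open>wr\<close> leaves no descent in any
  column, by \<open>column_descent\<close>, and therefore fixes the entries of t. So t is the only
  maximum among its column rearrangements, and its tabloid is the leading term of
  \<open>pt t\<close>.\<close>

lemma wr_cst_le:
  assumes t: "t \<in> SYT D" and p: "\<pi> \<in> cst t"
  shows "wr (\<pi> \<circ> t) \<le> wr t" and "wr (\<pi> \<circ> t) = wr t \<Longrightarrow> x \<in> D \<Longrightarrow> \<pi> (t x) = t x"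
proof -
  have fixed: "\<rho> (t x) = t x"
    if r: "\<rho> \<in> cst t" and max: "\<And>\<pi>. \<pi> \<in> cst t \<Longrightarrow> wr (\<pi> \<circ> t) \<le> wr (\<rho> \<circ> t)" and x: "x \<in> D" for \<rho> x
  proof (rule column_increasing_unique[OF t r _ x], rule ccontr)
    fix i i' j assume D: "(i, j) \<in> D" "(i', j) \<in> D" "i < i'" and "\<not> \<rho> (t (i, j)) < \<rho> (t (i', j))"
    have rt: "\<rho> \<circ> t \<in> tabs" using t r SYT_tabs tabs_perm cst_perm by blast
    have "\<rho> (t (i', j)) < \<rho> (t (i, j))"
      using \<open>\<not> _\<close> tabs_inj[OF rt D(1,2)] D(3) by simp
    then obtain \<pi> where "\<pi> \<in> cst (\<rho> \<circ> t)" "wr (\<rho> \<circ> t) < wr (\<pi> \<circ> (\<rho> \<circ> t))"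
      using column_descent[OF rt D] by auto
    then show False
      using max[of "\<pi> \<circ> \<rho>"] cst_cst[OF r] cst_comp[OF _ r] by (auto simp: comp_assoc)
  qed
  have "cst t \<noteq> {}" using p by blast
  then obtain \<rho> where r: "\<rho> \<in> cst t" "\<And>\<pi>. \<pi> \<in> cst t \<Longrightarrow> wr (\<pi> \<circ> t) \<le> wr (\<rho> \<circ> t)"
    using finite_obtain_max[OF finite_cst, where f = "\<lambda>\<pi>. wr (\<pi> \<circ> t)"] by blast
  have *: "wr (\<rho> \<circ> t) = wr t"
    using fixed[OF r] by (simp add: wt_def)
  show "wr (\<pi> \<circ> t) \<le> wr t" using r(2)[OF p] * by simp
  show "\<pi> (t x) = t x" if "wr (\<pi> \<circ> t) = wr t" "x \<in> D"
    using fixed[OF p _ that(2)] r(2) that(1) * by simp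
qed

lemma SYT_tbd_unique:
  assumes s: "s \<in> SYT D" and t: "t \<in> SYT D" and "tbd s = tbd t"
  shows "s = t"
proof (rule extensionalityI[where A = D])
  show "s \<in> extensional D" "t \<in> extensional D" using s t by (auto simp: SYT_iff)
  fix x assume x: "x \<in> D"
  obtain i j where ij: "x = (i, j)" by fastforce
  define m where "m = (if i < length mu then mu ! i else 0)"
  have m: "(i, j) \<in> D \<longleftrightarrow> j < m" for j by (auto simp: m_def young_diagram_def)
  have row: "tbd u i = (\<lambda>j. u (i, j)) ` {..<m}" for u by (auto simp: tabloid_def m)
  have "s (i, j) = t (i, j)"
  proof (rule strict_mono_image_unique[where f = "\<lambda>j. s (i, j)" and g = "\<lambda>j. t (i, j)"])
    show "(\<lambda>j. s (i, j)) ` {..<m} = (\<lambda>j. t (i, j)) ` {..<m}"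
      using row assms(3) by metis
  qed (use s t x ij m in \<open>auto simp: SYT_iff\<close>)
  then show "s x = t x" using ij by simp
qed

lemma pt_leading:
  assumes t: "t \<in> SYT D"
  shows "pt t (tbd t) = 1"
proof -
  have id: "\<pi> = id" if p: "\<pi> \<in> cst t" and eq: "tbd (\<pi> \<circ> t) = tbd t" for \<pi>
  proof
    have "wr (\<pi> \<circ> t) = wr t"
      using wr_tbd[OF SYT_tabs[OF t] tabs_perm[OF SYT_tabs[OF t] cst_perm[OF p]] eq] .
    then have fx: "\<pi> (t x) = t x" if "x \<in> D" for x using wr_cst_le(2)[OF t p _ that] by blast
    fix m show "\<pi> m = id m"
    proof (cases "m \<in> {1..n}")
      case True
      then obtain i j where "(i, j) \<in> D" "t (i, j) = m" by (rule tabs_cell[OF SYT_tabs[OF t]])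
      then show ?thesis using fx[of "(i, j)"] by simp
    next
      case False
      then show ?thesis using permutes_not_in[OF cst_perm[OF p]] by simp
    qed
  qed
  have id_cst: "id \<in> cst t" by (simp add: cst_iff permutes_id)
  have "pt t (tbd t) = (\<Sum>\<pi>\<in>cst t. if \<pi> = id then 1 else 0)"
    unfolding pt_apply
  proof (intro sum.cong refl)
    fix \<pi> assume "\<pi> \<in> cst t"
    then show "sg \<pi> * (if tbd t = tbd (\<pi> \<circ> t) then 1 else 0) = (if \<pi> = id then 1 else 0)"
      using id[of \<pi>] by (auto simp: sign_id)
  qed
  also have "\<dots> = (if id \<in> cst t then 1 else 0)" by (rule sum.delta[OF finite_cst])
  finally show ?thesis using id_cst by (simp only: if_True)
qed

lemma pt_triangular:
  assumes s: "s \<in> SYT D" and t: "t \<in> SYT D" and "s \<noteq> t" and "pt s (tbd t) \<noteq> 0"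
  shows "wr t < wr s"
proof -
  obtain \<pi> where p: "\<pi> \<in> cst s" "tbd t = tbd (\<pi> \<circ> s)"
  proof -
    have "\<exists>\<pi>\<in>cst s. sg \<pi> * (if tbd t = tbd (\<pi> \<circ> s) then 1 else 0) \<noteq> 0"
      using assms(4) unfolding pt_apply by (meson sum.neutral)
    then show thesis using that by (auto split: if_splits)
  qed
  have wr: "wr (\<pi> \<circ> s) = wr t"
    using wr_tbd[OF SYT_tabs[OF t] tabs_perm[OF SYT_tabs[OF s] cst_perm[OF p(1)]]] p(2) by simp
  have "wr t \<noteq> wr s"
  proof
    assume "wr t = wr s"
    then have "\<pi> (s x) = s x" if "x \<in> D" for x using wr_cst_le(2)[OF s p(1) _ that] wr by simp
    then have "tbd (\<pi> \<circ> s) = tbd s" by (force simp: tabloid_def fun_eq_iff)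
    then show False using SYT_tbd_unique[OF s t] p(2) assms(3) by simp
  qed
  then show ?thesis using wr_cst_le(1)[OF s p(1)] wr by simp
qed

text \<open>Among the tableaux with nonzero coefficient take u with the largest \<open>wr\<close>
  and evaluate at its tabloid: another polytabloid that involves this tabloid would belong to a
  tableau of larger \<open>wr\<close>, so only \<open>c u\<close> is left.\<close>

lemma pt_coeffs_zero:
  assumes 0: "(\<Sum>s\<in>SYT D. fscale (c s) (pt s)) = 0" and "t \<in> SYT D"
  shows "c t = 0"
proof (rule ccontr)
  assume "c t \<noteq> 0"
  let ?T = "{s \<in> SYT D. c s \<noteq> 0}"
  have "?T \<noteq> {}" "finite ?T" using \<open>c t \<noteq> 0\<close> assms(2) finite_SYT by auto
  then obtain u where u: "u \<in> ?T" "\<And>s. s \<in> ?T \<Longrightarrow> wr s \<le> wr u"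
    using finite_obtain_max[of ?T wr] by blast
  have "0 = (\<Sum>s\<in>SYT D. c s * pt s (tbd u))"
    using fun_cong[OF 0, of "tbd u"] by (simp add: sum_fun_apply fscale_def)
  also have "\<dots> = (\<Sum>s\<in>SYT D. if s = u then c u else 0)"
  proof (intro sum.cong refl)
    fix s assume s: "s \<in> SYT D"
    show "c s * pt s (tbd u) = (if s = u then c u else 0)"
    proof (cases "s = u")
      case True
      then show ?thesis using pt_leading[OF s] by simp
    next
      case False
      have "c s = 0 \<or> pt s (tbd u) = 0"
        using pt_triangular[OF s _ False] u(1) u(2)[of s] s by force
      then show ?thesis using False by auto
    qed
  qed
  also have "\<dots> = c u" using u finite_SYT by simp
  finally show False using u by simp
qed

lemma inj_on_pt: "inj_on pt (SYT D)"
proof (rule inj_onI, rule ccontr)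
  fix s t assume s: "s \<in> SYT D" "t \<in> SYT D" "pt s = pt t" "s \<noteq> t"
  have "pt s (tbd t) = 1" "pt t (tbd s) = 1" using s pt_leading by metis+
  then have "wr t < wr s" "wr s < wr t" using pt_triangular s by (metis zero_neq_one)+
  then show False by simp
qed

lemma independent_pt: "cfun.independent (pt ` SYT D)"
proof (rule cfun.independent_if_scalars_zero)
  show "finite (pt ` SYT D)" using finite_SYT by simp
  fix f v assume "(\<Sum>x\<in>pt ` SYT D. fscale (f x) x) = 0" "v \<in> pt ` SYT D"
  then show "f v = 0"
    using pt_coeffs_zero[of "\<lambda>s. f (pt s)"] inj_on_pt by (auto simp: sum.reindex)
qed

end

section \<open>Jucys--Murphy elements\<close>

definition cell_content :: "nat \<times> nat \<Rightarrow> int"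
  where "cell_content x = int (snd x) - int (fst x)"

definition JM :: "nat \<Rightarrow> ((nat \<Rightarrow> nat set) \<Rightarrow> complex) \<Rightarrow> ((nat \<Rightarrow> nat set) \<Rightarrow> complex)"
  where "JM m v = (\<Sum>a\<in>{1..<m}. perm_action (transpose a m) v)"

text \<open>\<open>JM_prod k\<close> is the product of the elements \<open>JM 2, \<dots>, JM (k + 1)\<close>. It expands into a sum of
  \<open>k!\<close> cycles, listed by \<open>JM_cycles k\<close>.\<close>

primrec JM_prod :: "nat \<Rightarrow> ((nat \<Rightarrow> nat set) \<Rightarrow> complex) \<Rightarrow> ((nat \<Rightarrow> nat set) \<Rightarrow> complex)" where
  "JM_prod 0 v = v"
| "JM_prod (Suc k) v = JM_prod k (JM (k + 2) v)"

primrec JM_cycles :: "nat \<Rightarrow> (nat \<Rightarrow> nat) list" where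
  "JM_cycles 0 = [id]"
| "JM_cycles (Suc k) = concat (map (\<lambda>c. map (\<lambda>a. c \<circ> transpose a (k + 2)) [1..<k + 2]) (JM_cycles k))"

lemma length_JM_cycles: "length (JM_cycles k) = fact k"
  by (induction k) (auto simp: length_concat o_def sum_list_triv)

lemma linear_JM: "Vector_Spaces.linear fscale fscale (JM m)"
proof -
  interpret Vector_Spaces.linear fscale fscale "perm_action \<sigma>" for \<sigma>
    by (rule perm_action_linear)
  show ?thesis
    by unfold_locales (simp_all only: JM_def add sum.distrib scale cfun.scale_sum_right)
qed

lemma linear_JM_prod: "Vector_Spaces.linear fscale fscale (JM_prod k)"
proof (induction k)
  case 0
  show ?case by unfold_locales auto
next
  case (Suc k)
  have "JM_prod (Suc k) = JM_prod k \<circ> JM (k + 2)" by (simp add: fun_eq_iff)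
  then show ?case using Vector_Spaces.linear_compose[OF linear_JM Suc] by metis
qed

text \<open>Multiplying a cycle on the right by \<open>transpose a (k + 2)\<close> inserts
  \<open>k + 2\<close> directly behind a.\<close>

lemma JM_cycles_cycle:
  assumes "c \<in> set (JM_cycles k)"
  shows "\<exists>cs. distinct cs \<and> set cs = {1..k + 1} \<and> c = cycle_of_list cs"
  using assms
proof (induction k arbitrary: c)
  case 0
  then show ?case by (intro exI[of _ "[1]"]) auto
next
  case (Suc k)
  then obtain c' a where c: "c = c' \<circ> transpose a (k + 2)" "c' \<in> set (JM_cycles k)" "a \<in> {1..k + 1}"
    by auto
  then obtain cs where cs: "distinct cs" "set cs = {1..k + 1}" "c' = cycle_of_list cs"
    using Suc.IH by blast
  obtain xs ys where xy: "cs = xs @ a # ys" using c(3) cs(2) by (metis split_list)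
  \<comment> \<open>The list is rotated until a stands last, so that the new point can be
    appended.\<close>
  let ?zs = "ys @ xs @ [a]"
  have "?zs = rotate (Suc (length xs)) cs"
    using xy rotate_append[of "xs @ [a]" ys] by simp
  then have z: "c' = cycle_of_list ?zs"
    using cycle_of_list_rotate_independent[OF cs(1)] cs(3) by metis
  have snoc: "cycle_of_list (us @ [a, b]) = cycle_of_list (us @ [a]) \<circ> transpose a b" for us :: "nat list" and b
  proof (induction us)
    case (Cons u us)
    then show ?case by (cases us) (auto simp: comp_assoc)
  qed simp
  have "c = cycle_of_list (?zs @ [k + 2])"
    using snoc[of "ys @ xs" "k + 2"] c(1) z by simp
  moreover have "set (?zs @ [k + 2]) = {1..Suc k + 1}"
  proof -
    have "set (?zs @ [k + 2]) = insert (k + 2) (set cs)" using xy by auto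
    also have "\<dots> = {1..Suc k + 1}" unfolding cs(2) by auto
    finally show ?thesis .
  qed
  moreover have "distinct (?zs @ [k + 2])"
  proof -
    have "set ?zs = set cs" "distinct ?zs" using cs(1) xy by auto
    moreover have "k + 2 \<notin> set cs" using cs(2) by simp
    ultimately show ?thesis by (simp only: distinct_append) auto
  qed
  ultimately show ?case by blast
qed

lemma JM_prod_eq_sum: "JM_prod k v = (\<Sum>c\<leftarrow>JM_cycles k. perm_action c v)"
proof (induction k arbitrary: v)
  case 0
  show ?case by (simp add: perm_action_id)
next
  case (Suc k)
  have JM: "JM (k + 2) v = (\<Sum>a\<leftarrow>[1..<k + 2]. perm_action (transpose a (k + 2)) v)"
    unfolding JM_def interv_sum_list_conv_sum_set_nat set_upt ..
  have lin: "perm_action c (\<Sum>a\<leftarrow>as. f a) = (\<Sum>a\<leftarrow>as. perm_action c (f a))" for c f and as :: "nat list"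
    by (induction as) (auto simp: perm_action_def fun_eq_iff)
  have "JM_prod (Suc k) v = (\<Sum>c\<leftarrow>JM_cycles k. perm_action c (JM (k + 2) v))"
    by (simp add: Suc.IH)
  also have "\<dots> = (\<Sum>c\<leftarrow>JM_cycles k. \<Sum>a\<leftarrow>[1..<k + 2]. perm_action (c \<circ> transpose a (k + 2)) v)"
  proof (intro arg_cong[where f = sum_list] map_cong refl)
    fix c assume "c \<in> set (JM_cycles k)"
    then have "bij c" using JM_cycles_cycle cycle_permutes permutes_bij by metis
    then show "perm_action c (JM (k + 2) v) = (\<Sum>a\<leftarrow>[1..<k + 2]. perm_action (c \<circ> transpose a (k + 2)) v)"
      unfolding JM lin by (intro arg_cong[where f = sum_list] map_cong refl)
        (simp add: perm_action_comp)
  qed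
  also have "\<dots> = (\<Sum>c\<leftarrow>JM_cycles (Suc k). perm_action c v)"
  proof -
    have "(\<Sum>c\<leftarrow>xs. \<Sum>a\<leftarrow>ys. h (g c a)) = (\<Sum>x\<leftarrow>concat (map (\<lambda>c. map (g c) ys) xs). h x)"
      for xs :: "(nat \<Rightarrow> nat) list" and ys :: "nat list" and g :: "_ \<Rightarrow> _ \<Rightarrow> nat \<Rightarrow> nat"
        and h :: "_ \<Rightarrow> (nat \<Rightarrow> nat set) \<Rightarrow> complex"
      by (induction xs) (auto simp: o_def)
    from this[where h = "\<lambda>c. perm_action c v" and g = "\<lambda>c a. c \<circ> transpose a (k + 2)"]
    show ?thesis unfolding JM_cycles.simps .
  qed
  finally show ?case .
qed

section \<open>The action on standard polytabloids\<close>

context partition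
begin

definition filt :: "int \<Rightarrow> ((nat \<Rightarrow> nat set) \<Rightarrow> complex) set"
  where "filt d = cfun.span (pt ` {t \<in> tabs. d \<le> wc t})"

lemma filt_eq: "filt d = cfun.span (pt ` {t \<in> SYT D. d \<le> wc t})"
proof
  show "cfun.span (pt ` {t \<in> SYT D. d \<le> wc t}) \<subseteq> filt d"
    unfolding filt_def using SYT_tabs by (intro cfun.span_mono) auto
  have "pt t \<in> cfun.span (pt ` {t \<in> SYT D. d \<le> wc t})" if "t \<in> tabs" "d \<le> wc t" for t
  proof -
    have "cfun.span (pt ` {s \<in> SYT D. wc t \<le> wc s}) \<subseteq> cfun.span (pt ` {t \<in> SYT D. d \<le> wc t})"
      using that(2) by (intro cfun.span_mono) auto
    then show ?thesis using straightening[OF that(1)] by blast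
  qed
  then show "filt d \<subseteq> cfun.span (pt ` {t \<in> SYT D. d \<le> wc t})"
    unfolding filt_def by (intro cfun.span_minimal cfun.subspace_span) auto
qed

lemma pt_filt: "t \<in> tabs \<Longrightarrow> d \<le> wc t \<Longrightarrow> pt t \<in> filt d"
  unfolding filt_def by (rule cfun.span_base) auto

lemma filt_antimono: "d \<le> d' \<Longrightarrow> filt d' \<subseteq> filt d"
  unfolding filt_def by (intro cfun.span_mono) auto

lemmas filt_closed = cfun.span_zero[of "pt ` {t \<in> tabs. d \<le> wc t}", folded filt_def]
  cfun.span_add[of _ "pt ` {t \<in> tabs. d \<le> wc t}", folded filt_def]
  cfun.span_diff[of _ "pt ` {t \<in> tabs. d \<le> wc t}", folded filt_def]
  cfun.span_scale[of _ "pt ` {t \<in> tabs. d \<le> wc t}", folded filt_def]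
  cfun.span_sum[of _ _ "pt ` {t \<in> tabs. d \<le> wc t}", folded filt_def] for d

lemma specht_eq: "specht_module mu = cfun.span (pt ` SYT D)"
proof -
  obtain d where d: "\<And>t. t \<in> tabs \<Longrightarrow> d \<le> wc t"
  proof
    show "0 \<le> wc t" for t unfolding wt_def by (intro sum_nonneg) auto
  qed
  then have "{t \<in> tabs. d \<le> wc t} = tabs" "{t \<in> SYT D. d \<le> wc t} = SYT D"
    using SYT_tabs by auto
  then show ?thesis using filt_eq[of d] unfolding filt_def specht_module_def by simp
qed

text \<open>Sort the transpositions by the column j of the smaller entry a. For j < j0,
  \<open>garnir_one\<close> gives one copy of \<open>pt t\<close>, the terms with a > m being of
  higher weight. In column j0 the smaller entries are the i0 entries above m, and each gives
  \<open>- pt t\<close>. For j > j0 the swap moves m to the right, into higher weight. The total is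
  j0 - i0, the content.\<close>

lemma JM_triangular:
  assumes t: "t \<in> SYT D" and c: "(i0, j0) \<in> D"
  shows "JM (t (i0, j0)) (pt t) - fscale (of_int (cell_content (i0, j0))) (pt t) \<in> filt (wc t + 1)"
proof -
  note tt = SYT_tabs[OF t]
  define m where "m = t (i0, j0)"
  have mcol: "m \<in> colset t j0" using c by (auto simp: m_def colset_def)
  have mn: "m \<in> {1..n}" using mcol colset_sub[OF tt] by blast
  define A where "A j = {a \<in> colset t j. a < m}" for j
  define S where "S j = (\<Sum>a\<in>A j. pt (transpose a m \<circ> t))" for j
  define q where "q j = (if j < j0 then pt t else if j = j0 then fscale (- of_nat i0) (pt t) else 0)" for j
  define M where "M = Suc (Max (snd ` D))"
  have M: "j < M" if "(i, j) \<in> D" for i j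
  proof -
    have "j \<in> snd ` D" using that by force
    then show ?thesis unfolding M_def using finite_D by (simp add: less_Suc_eq_le)
  qed
  have perm: "transpose a m permutes {1..n}" if "a \<in> colset t j" for a j
    using that colset_sub[OF tt] mn by (blast intro: permutes_swap_id)
  have tr: "transpose a m \<circ> t \<in> tabs" if "a \<in> colset t j" for a j
    using tabs_perm[OF tt perm[OF that]] .
  have U: "{1..<m} = (\<Union>j<M. A j)"
  proof
    show "{1..<m} \<subseteq> (\<Union>j<M. A j)"
    proof
      fix a assume a: "a \<in> {1..<m}"
      then obtain i j where "(i, j) \<in> D" "t (i, j) = a" using tabs_cell[OF tt, of a] mn by auto
      then show "a \<in> (\<Union>j<M. A j)" using a M[of i j] by (auto simp: A_def colset_def)
    qed
    show "(\<Union>j<M. A j) \<subseteq> {1..<m}" using colset_sub[OF tt] by (force simp: A_def)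
  qed
  have "JM m (pt t) = (\<Sum>a\<in>{1..<m}. pt (transpose a m \<circ> t))"
    unfolding JM_def using mn by (intro sum.cong refl perm_action_pt permutes_swap_id) auto
  also have "\<dots> = (\<Sum>j<M. S j)"
    unfolding U S_def
    by (rule sum.UNION_disjoint) (auto simp: A_def dest: colset_disjoint[OF tt])
  finally have JM: "JM m (pt t) = (\<Sum>j<M. S j)" .
  have step: "S j - q j \<in> filt (wc t + 1)" for j
  proof -
    consider "j < j0" | "j = j0" | "j > j0" by linarith
    then show ?thesis
    proof cases
      case 1
      have fin: "finite (A j)" "A j \<subseteq> colset t j" by (auto simp: A_def)
      have "pt t = (\<Sum>a\<in>colset t j. pt (transpose a m \<circ> t))"
        using garnir_one[OF tt mcol, of j] 1 clen_antimono[of j j0] by simp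
      also have "\<dots> = (\<Sum>a\<in>colset t j - A j. pt (transpose a m \<circ> t)) + S j"
        unfolding S_def by (rule sum.subset_diff[OF fin(2)]) simp
      finally have "S j - q j = 0 - (\<Sum>a\<in>colset t j - A j. pt (transpose a m \<circ> t))"
        using 1 by (simp add: q_def algebra_simps)
      also have "\<dots> \<in> filt (wc t + 1)"
      proof (intro filt_closed(3) filt_closed(1) filt_closed(5))
        fix a assume "a \<in> colset t j - A j"
        then have a: "a \<in> colset t j" "m < a"
          using mcol colset_disjoint[OF tt, of j j0] 1 by (auto simp: A_def linorder_neq_iff)
        have "wc t < wc (transpose a m \<circ> t)" by (rule wc_transpose[OF tt a(1) mcol 1 a(2)])
        then show "pt (transpose a m \<circ> t) \<in> filt (wc t + 1)"
          using tr[OF a(1)] by (intro pt_filt) auto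
      qed
      finally show ?thesis .
    next
      case 2
      have Aeq: "A j = (\<lambda>i. t (i, j0)) ` {..<i0}"
      proof -
        have inc: "t (i, j0) < t (i', j0)" if "i < i'" "i' < clen j0" for i i'
          using t that by (simp add: SYT_iff D_iff)
        have "t (i, j0) < m \<longleftrightarrow> i < i0" if "i < clen j0" for i
          using inc[of i i0] inc[of i0 i] that c unfolding m_def D_iff
          by (cases i i0 rule: linorder_cases) auto
        then show ?thesis using c 2 by (auto simp: A_def colset_eq D_iff)
      qed
      have "S j = (\<Sum>a\<in>A j. - pt t)"
        unfolding S_def
      proof (intro sum.cong refl)
        fix a assume a: "a \<in> A j"
        then have "transpose a m \<in> cst t" using 2 mcol by (intro transpose_cst[OF tt]) (auto simp: A_def)
        moreover have "sg (transpose a m) = -1" using a by (subst sign_swap_id) (auto simp: A_def)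
        ultimately show "pt (transpose a m \<circ> t) = - pt t"
          by (simp add: pt_cst fscale_def fun_eq_iff)
      qed
      also have "card (A j) = i0"
        unfolding Aeq using c by (subst card_image) (auto simp: inj_on_def tabs_inj[OF tt] D_iff)
      then have "(\<Sum>a\<in>A j. - pt t) = q j"
        using 2 by (simp add: q_def fun_eq_iff sum_fun_apply fscale_def)
      finally show ?thesis using filt_closed(1) by simp
    next
      case 3
      have "S j \<in> filt (wc t + 1)"
        unfolding S_def
      proof (rule filt_closed(5))
        fix a assume "a \<in> A j"
        then have a: "a \<in> colset t j" "a < m" by (auto simp: A_def)
        have "wc t < wc (transpose m a \<circ> t)" by (rule wc_transpose[OF tt mcol a(1) 3 a(2)])
        then show "pt (transpose a m \<circ> t) \<in> filt (wc t + 1)"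
          using tr[OF a(1)] by (intro pt_filt) (auto simp: transpose_commute)
      qed
      moreover have "q j = 0" using 3 by (simp add: q_def zero_fun_def)
      ultimately show ?thesis by (simp only: diff_zero)
    qed
  qed
  have "(\<Sum>j<M. q j) = fscale (of_int (cell_content (i0, j0))) (pt t)"
  proof
    fix X
    have "q j X = (if j < j0 then pt t X else 0) + (if j = j0 then - of_nat i0 * pt t X else 0)" for j
      by (simp add: q_def fscale_def)
    then have "(\<Sum>j<M. q j) X =
        (\<Sum>j<M. (if j < j0 then pt t X else 0) + (if j = j0 then - of_nat i0 * pt t X else 0))"
      unfolding sum_fun_apply by (intro sum.cong refl)
    also have "\<dots> = (\<Sum>j\<in>{..<M} \<inter> {j. j < j0}. pt t X) + (if j0 < M then - of_nat i0 * pt t X else 0)"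
      by (subst sum.inter_restrict) (simp_all add: sum.distrib)
    also have "{..<M} \<inter> {j. j < j0} = {..<j0}" using M[OF c] by auto
    finally show "(\<Sum>j<M. q j) X = fscale (of_int (cell_content (i0, j0))) (pt t) X"
      using M[OF c] by (simp add: cell_content_def fscale_def algebra_simps)
  qed
  then have "JM m (pt t) - fscale (of_int (cell_content (i0, j0))) (pt t) = (\<Sum>j<M. S j - q j)"
    by (simp add: JM sum_subtractf)
  also have "\<dots> \<in> filt (wc t + 1)" by (rule filt_closed(5)[OF step])
  finally show ?thesis by (simp add: m_def)
qed

lemma specht_invariant:
  assumes "\<sigma> permutes {1..n}"
  shows "perm_action \<sigma> ` specht_module mu \<subseteq> specht_module mu"
proof -
  interpret lin: Vector_Spaces.linear fscale fscale "perm_action \<sigma>" by (rule perm_action_linear)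
  have "perm_action \<sigma> ` specht_module mu = cfun.span (perm_action \<sigma> ` pt ` tabs)"
    unfolding specht_module_def by (rule lin.span_image[symmetric])
  also have "\<dots> \<subseteq> cfun.span (pt ` tabs)"
    using perm_action_pt[OF assms] tabs_perm[OF _ assms] by (intro cfun.span_mono) auto
  finally show ?thesis unfolding specht_module_def .
qed

lemma JM_filt:
  assumes m: "m \<in> {1..n}" and v: "v \<in> filt d"
  shows "JM m v \<in> filt d"
proof -
  interpret lin: Vector_Spaces.linear fscale fscale "JM m" by (rule linear_JM)
  have "JM m ` filt d = cfun.span (JM m ` pt ` {t \<in> SYT D. d \<le> wc t})"
    unfolding filt_eq by (rule lin.span_image[symmetric])
  also have "\<dots> \<subseteq> filt d"
  proof (rule cfun.span_minimal)
    show "cfun.subspace (filt d)" unfolding filt_def by (rule cfun.subspace_span)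
    show "JM m ` pt ` {t \<in> SYT D. d \<le> wc t} \<subseteq> filt d"
    proof safe
      fix t assume t: "t \<in> SYT D" "d \<le> wc t"
      obtain i j where ij: "(i, j) \<in> D" "t (i, j) = m" using tabs_cell[OF SYT_tabs[OF t(1)] m] .
      have "fscale (of_int (cell_content (i, j))) (pt t) \<in> filt d"
        using pt_filt[OF SYT_tabs[OF t(1)] t(2)] by (rule filt_closed(4))
      moreover have "JM m (pt t) - fscale (of_int (cell_content (i, j))) (pt t) \<in> filt d"
        using JM_triangular[OF t(1) ij(1)] filt_antimono[of d "wc t + 1"] t(2) ij(2) by auto
      ultimately show "JM m (pt t) \<in> filt d"
        using filt_closed(2)[of "JM m (pt t) - fscale (of_int (cell_content (i, j))) (pt t)" d
            "fscale (of_int (cell_content (i, j))) (pt t)"] by (simp only: diff_add_cancel)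
    qed
  qed
  finally show ?thesis using v by blast
qed

lemma JM_prod_filt: "k < n \<Longrightarrow> v \<in> filt d \<Longrightarrow> JM_prod k v \<in> filt d"
proof (induction k arbitrary: v)
  case (Suc k)
  have "JM (k + 2) v \<in> filt d" using Suc.prems by (intro JM_filt) auto
  then show ?case using Suc by simp
qed simp

text \<open>The entry 1 is left out: its cell (0, 0) has content 0, in accordance with
  \<open>JM 1\<close> being an empty sum, and the product starts with \<open>JM 2\<close>.\<close>

definition content_prod :: "nat \<Rightarrow> (nat \<times> nat \<Rightarrow> nat) \<Rightarrow> int"
  where "content_prod r t = (\<Prod>x | x \<in> D \<and> t x \<in> {2..r}. cell_content x)"

text \<open>Terms of higher weight produced by one factor stay in \<open>filt (wc t + 1)\<close>
  under the remaining factors, so the diagonal entries multiply.\<close>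

lemma JM_prod_triangular:
  assumes t: "t \<in> SYT D" and "k < n"
  shows "JM_prod k (pt t) - fscale (of_int (content_prod (Suc k) t)) (pt t) \<in> filt (wc t + 1)"
  using assms(2)
proof (induction k)
  case 0
  show ?case using filt_closed(1)[of "wc t + 1"] by (simp add: content_prod_def zero_fun_def)
next
  case (Suc k)
  note tt = SYT_tabs[OF t]
  interpret lin: Vector_Spaces.linear fscale fscale "JM_prod k" by (rule linear_JM_prod)
  have "k + 2 \<in> {1..n}" using Suc.prems by auto
  then obtain i j where ij: "(i, j) \<in> D" "t (i, j) = k + 2" using tabs_cell[OF tt] by metis
  define c where "c = (of_int (cell_content (i, j)) :: complex)"
  define p where "p = (of_int (content_prod (Suc k) t) :: complex)"
  define u where "u = JM (k + 2) (pt t) - fscale c (pt t)"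
  have u: "u \<in> filt (wc t + 1)" using JM_triangular[OF t ij(1)] ij(2) by (simp add: u_def c_def)
  have "JM (k + 2) (pt t) = fscale c (pt t) + u" by (simp add: u_def)
  then have "JM_prod (Suc k) (pt t) = fscale c (JM_prod k (pt t)) + JM_prod k u"
    by (simp only: JM_prod.simps lin.add lin.scale)
  moreover have "content_prod (Suc (Suc k)) t = cell_content (i, j) * content_prod (Suc k) t"
  proof -
    have "{x. x \<in> D \<and> t x \<in> {2..Suc (Suc k)}} = insert (i, j) {x. x \<in> D \<and> t x \<in> {2..Suc k}}"
    proof (intro set_eqI iffI)
      fix x assume x: "x \<in> {x. x \<in> D \<and> t x \<in> {2..Suc (Suc k)}}"
      show "x \<in> insert (i, j) {x. x \<in> D \<and> t x \<in> {2..Suc k}}"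
      proof (cases "t x = k + 2")
        case True
        then show ?thesis using x tabs_inj[OF tt _ ij(1), of x] ij(2) by auto
      next
        case False
        then show ?thesis using x by auto
      qed
    qed (use ij in auto)
    moreover have "finite {x. x \<in> D \<and> t x \<in> {2..Suc k}}" using finite_D by simp
    ultimately show ?thesis unfolding content_prod_def using ij(2) by simp
  qed
  then have "of_int (content_prod (Suc (Suc k)) t) = c * p" by (simp add: c_def p_def)
  ultimately have "JM_prod (Suc k) (pt t) - fscale (of_int (content_prod (Suc (Suc k)) t)) (pt t) =
      fscale c (JM_prod k (pt t) - fscale p (pt t)) + JM_prod k u"
    by (simp add: cfun.scale_right_diff_distrib)
  also have "\<dots> \<in> filt (wc t + 1)"
  proof (intro filt_closed(2) filt_closed(4))
    show "JM_prod k (pt t) - fscale p (pt t) \<in> filt (wc t + 1)"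
      unfolding p_def by (rule Suc.IH) (use Suc.prems in simp)
    show "JM_prod k u \<in> filt (wc t + 1)"
      using Suc.prems by (intro JM_prod_filt[OF _ u]) simp
  qed
  finally show ?case .
qed

lemma trace_JM_prod:
  assumes "k < n"
  shows "trace_on (specht_module mu) (JM_prod k) = of_int (\<Sum>t\<in>SYT D. content_prod (Suc k) t)"
proof -
  let ?B = "pt ` SYT D"
  have V: "cfun.span ?B = specht_module mu" by (simp add: specht_eq)
  have inv: "JM_prod k ` specht_module mu \<subseteq> specht_module mu"
  proof -
    have 0: "0 \<le> wc t" for t unfolding wt_def by (intro sum_nonneg) auto
    have "specht_module mu = filt 0" unfolding filt_def specht_module_def using 0 by simp
    then show ?thesis using JM_prod_filt[OF assms] by auto
  qed
  have rep: "cfun.representation ?B (JM_prod k (pt t)) (pt t) = of_int (content_prod (Suc k) t)"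
    if t: "t \<in> SYT D" for t
  proof -
    define u where "u = JM_prod k (pt t) - fscale (of_int (content_prod (Suc k) t)) (pt t)"
    let ?B' = "pt ` {s \<in> SYT D. wc t + 1 \<le> wc s}"
    have u: "u \<in> cfun.span ?B'"
      using JM_prod_triangular[OF t assms] by (simp add: u_def filt_eq)
    have B': "?B' \<subseteq> ?B" by auto
    have "pt t \<notin> ?B'"
    proof
      assume "pt t \<in> ?B'"
      then obtain s where "s \<in> SYT D" "wc t + 1 \<le> wc s" "pt t = pt s" by blast
      then show False using inj_onD[OF inj_on_pt _ t, of s] by simp
    qed
    \<comment> \<open>The remainder u is a combination of standard polytabloids of larger
      \<open>wc\<close>. Since \<open>pt t\<close> is not among them, u has no diagonal
      contribution.\<close>
    then have 0: "cfun.representation ?B u (pt t) = 0"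
      unfolding cfun.representation_extend[OF independent_pt u B']
      using cfun.representation_ne_zero by blast
    have ptB: "pt t \<in> ?B" using t by blast
    have uB: "u \<in> cfun.span ?B" using cfun.span_mono[OF B'] u by blast
    have "JM_prod k (pt t) = u + fscale (of_int (content_prod (Suc k) t)) (pt t)"
      by (simp add: u_def)
    then show ?thesis
      by (simp only: cfun.representation_add[OF independent_pt cfun.span_scale[OF cfun.span_base[OF ptB]] uB]
        cfun.representation_scale[OF independent_pt cfun.span_base[OF ptB]]
        cfun.representation_basis[OF independent_pt ptB] 0) simp
  qed
  have "trace_on (specht_module mu) (JM_prod k) = (\<Sum>v\<in>?B. cfun.representation ?B (JM_prod k v) v)"
    using finite_SYT by (intro trace_on_basis independent_pt V linear_JM_prod inv) simp
  also have "\<dots> = (\<Sum>t\<in>SYT D. cfun.representation ?B (JM_prod k (pt t)) (pt t))"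
    by (simp add: sum.reindex[OF inj_on_pt])
  also have "\<dots> = of_int (\<Sum>t\<in>SYT D. content_prod (Suc k) t)"
    using rep by (simp cong: sum.cong)
  finally show ?thesis .
qed

section \<open>Characters at cycles\<close>

text \<open>Cycles of equal length are conjugate: both lists are padded to enumerations of
  \<open>{1..n}\<close>, and \<tau> matches them position by position. The conjugation disappears by
  \<open>trace_on_commute\<close>.\<close>

lemma irr_char_cycle_cong:
  assumes c: "distinct cs" "set cs \<subseteq> {1..n}" and d: "distinct ds" "set ds \<subseteq> {1..n}"
    and len: "length cs = length ds"
  shows "irr_char mu (cycle_of_list cs) = irr_char mu (cycle_of_list ds)"
proof -
  obtain cs' where cs': "set cs' = {1..n} - set cs" "distinct cs'"
    using finite_distinct_list[of "{1..n} - set cs"] by auto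
  obtain ds' where ds': "set ds' = {1..n} - set ds" "distinct ds'"
    using finite_distinct_list[of "{1..n} - set ds"] by auto
  have card: "card (set cs) = card (set ds)" using c(1) d(1) len distinct_card by metis
  have "length cs' = length ds'"
    using cs' ds' card c(2) d(2) distinct_card[OF cs'(2)] distinct_card[OF ds'(2)]
    by (simp add: card_Diff_subset)
  then have len': "length (cs @ cs') = length (ds @ ds')" using len by simp
  define xs where "xs = zip (cs @ cs') (ds @ ds')"
  define \<tau> where "\<tau> = permutation_of_list xs"
  have xs: "map fst xs = cs @ cs'" "map snd xs = ds @ ds'"
    unfolding xs_def using len' by (auto simp del: zip_append)
  have lp: "list_permutes xs {1..n}"
    unfolding list_permutes_def xs using c d cs' ds' by auto
  have \<tau>: "\<tau> permutes {1..n}" unfolding \<tau>_def by (rule permutation_of_list_permutes[OF lp])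
  have "map \<tau> cs = ds"
  proof (rule nth_equalityI)
    fix i assume i: "i < length (map \<tau> cs)"
    then have "(cs ! i, ds ! i) \<in> set xs"
      unfolding xs_def using len len' by (auto simp: set_zip nth_append simp del: zip_append intro!: exI[of _ i])
    then show "map \<tau> cs ! i = ds ! i"
      using permutation_of_list_unique[OF lp] i by (simp add: \<tau>_def)
  qed (simp add: len)
  then have conj: "cycle_of_list ds = \<tau> \<circ> cycle_of_list cs \<circ> inv \<tau>"
    using conjugation_of_cycle[OF c(1) permutes_bij[OF \<tau>]] by simp
  let ?c = "cycle_of_list cs" and ?V = "specht_module mu"
  have cp: "?c permutes {1..n}" using cycle_permutes permutes_subset c(2) by blast
  have gp: "?c \<circ> inv \<tau> permutes {1..n}" using cp \<tau> by (intro permutes_compose permutes_inv)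
  have "trace_on ?V (\<lambda>v. perm_action \<tau> (perm_action (?c \<circ> inv \<tau>) v)) =
      trace_on ?V (\<lambda>v. perm_action (?c \<circ> inv \<tau>) (perm_action \<tau> v))"
    by (rule trace_on_commute[OF finite_imageI[OF finite_SYT] specht_eq[symmetric]
        perm_action_linear specht_invariant[OF \<tau>] perm_action_linear specht_invariant[OF gp]])
  moreover have "perm_action (cycle_of_list ds) v = perm_action \<tau> (perm_action (?c \<circ> inv \<tau>) v)" for v
    using perm_action_comp[OF permutes_bij[OF \<tau>] permutes_bij[OF gp]] conj by (simp add: comp_assoc)
  moreover have "perm_action ?c v = perm_action (?c \<circ> inv \<tau>) (perm_action \<tau> v)" for v
    using perm_action_comp[OF permutes_bij[OF gp] permutes_bij[OF \<tau>]] permutes_inv_o[OF \<tau>]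
    by (simp add: comp_assoc)
  ultimately show ?thesis by (simp add: irr_char_def fun_eq_iff[symmetric]) (metis (no_types, lifting) ext)
qed

theorem irr_char_cycle:
  assumes "1 \<le> r" "r \<le> n" and \<sigma>: "r_cycle r n \<sigma>"
  shows "fact (r - 1) * irr_char mu \<sigma> = of_int (\<Sum>t\<in>SYT D. content_prod r t)"
proof -
  obtain k where k: "r = Suc k" using assms(1) by (cases r) auto
  obtain cs where cs: "distinct cs" "length cs = r" "set cs \<subseteq> {1..n}" "\<sigma> = cycle_of_list cs"
    using \<sigma> by (auto simp: r_cycle_def)
  let ?V = "specht_module mu"
  have ex: "\<exists>ds. distinct ds \<and> length ds = r \<and> set ds \<subseteq> {1..n} \<and> c = cycle_of_list ds"
    if c: "c \<in> set (JM_cycles k)" for c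
  proof -
    obtain ds where ds: "distinct ds" "set ds = {1..k + 1}" "c = cycle_of_list ds"
      using JM_cycles_cycle[OF c] by blast
    moreover have "length ds = r" using distinct_card[OF ds(1)] ds(2) k by simp
    ultimately show ?thesis using assms(2) k by (intro exI[of _ ds]) auto
  qed
  have eq: "trace_on ?V (perm_action c) = irr_char mu \<sigma>" if "c \<in> set (JM_cycles k)" for c
    using ex[OF that] irr_char_cycle_cong[OF cs(1,3)] cs(2,4) unfolding irr_char_def by metis
  have "of_int (\<Sum>t\<in>SYT D. content_prod r t) = trace_on ?V (JM_prod k)"
    using trace_JM_prod[of k] assms(2) k by simp
  also have "JM_prod k = (\<lambda>v. \<Sum>c\<leftarrow>JM_cycles k. perm_action c v)"
    by (simp add: fun_eq_iff JM_prod_eq_sum)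
  also have "trace_on ?V (\<lambda>v. \<Sum>c\<leftarrow>JM_cycles k. perm_action c v) =
      (\<Sum>c\<leftarrow>JM_cycles k. trace_on ?V (perm_action c))"
  proof (rule trace_on_sum_list[OF _ specht_eq[symmetric]])
    show "finite (pt ` SYT D)" using finite_SYT by simp
    fix c assume "c \<in> set (JM_cycles k)"
    then show "perm_action c ` ?V \<subseteq> ?V"
      using ex cycle_permutes permutes_subset specht_invariant by metis
  qed
  also have "\<dots> = (\<Sum>c\<leftarrow>JM_cycles k. irr_char mu \<sigma>)"
    using eq by (intro arg_cong[where f = sum_list] map_cong refl)
  also have "\<dots> = fact k * irr_char mu \<sigma>"
    by (simp add: sum_list_triv length_JM_cycles)
  finally show ?thesis by (simp add: k)
qed

end

section \<open>Removing the largest entry of a standard tableau\<close>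

text \<open>For arbitrary sets of cells, since it is applied to diagrams as well as to skew
  shapes.\<close>

definition corners :: "(nat \<times> nat) set \<Rightarrow> (nat \<times> nat) set"
  where "corners D = {(i, j) \<in> D. (\<forall>j'. (i, j') \<in> D \<longrightarrow> j' \<le> j) \<and> (\<forall>i'. (i', j) \<in> D \<longrightarrow> i' \<le> i)}"

lemma finite_SYT_set:
  assumes "finite D"
  shows "finite (SYT D)"
proof (rule finite_subset)
  show "SYT D \<subseteq> (D \<rightarrow>\<^sub>E {1..card D})"
    by (auto simp: SYT_def PiE_def bij_betw_def)
  show "finite (D \<rightarrow>\<^sub>E {1..card D})" using assms by (intro finite_PiE) auto
qed

lemma corners_subset: "corners D \<subseteq> D"
  by (auto simp: corners_def)

lemma SYT_remove_max:
  assumes D: "finite D" "D \<noteq> {}" and T: "T \<in> SYT D"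
  defines "c \<equiv> inv_into D T (card D)"
  shows "c \<in> corners D" "restrict T (D - {c}) \<in> SYT (D - {c})" "T c = card D"
proof -
  have bij: "bij_betw T D {1..card D}" using T by (simp add: SYT_def)
  have "card D \<in> {1..card D}" using D by (simp add: Suc_leI card_gt_0_iff)
  then have "card D \<in> T ` D" using bij by (simp add: bij_betw_def)
  then have c: "c \<in> D" and Tc: "T c = card D"
    unfolding c_def by (auto intro: inv_into_into f_inv_into_f)
  show "T c = card D" by fact
  have le: "T x \<le> card D" if "x \<in> D" for x using bij that by (auto simp: bij_betw_def)
  obtain i j where ij: "c = (i, j)" by fastforce
  have "j' \<le> j" if "(i, j') \<in> D" for j'
  proof (rule ccontr)
    assume "\<not> j' \<le> j"
    then have "T (i, j) < T (i, j')" using T c that by (simp add: SYT_def ij)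
    then show False using le[OF that] Tc by (simp add: ij)
  qed
  moreover have "i' \<le> i" if "(i', j) \<in> D" for i'
  proof (rule ccontr)
    assume "\<not> i' \<le> i"
    then have "T (i, j) < T (i', j)" using T c that by (simp add: SYT_def ij)
    then show False using le[OF that] Tc by (simp add: ij)
  qed
  ultimately show "c \<in> corners D" using c by (auto simp: corners_def ij)
  have "bij_betw T (D - {c}) ({1..card D} - {T c})"
  proof -
    have inj: "inj_on T D" and im: "T ` D = {1..card D}" using bij by (auto simp: bij_betw_def)
    have "T ` (D - {c}) = T ` D - T ` {c}" by (rule inj_on_image_set_diff[OF inj]) (use c in auto)
    then show ?thesis using inj im by (auto simp: bij_betw_def inj_on_diff)
  qed
  moreover have "{1..card D} - {T c} = {1..card (D - {c})}"
    using c D(1) Tc by (auto simp: card_Diff_singleton)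
  ultimately have "bij_betw (restrict T (D - {c})) (D - {c}) {1..card (D - {c})}"
    by (subst bij_betw_cong[where g = T]) auto
  then show "restrict T (D - {c}) \<in> SYT (D - {c})"
    using T by (auto simp: SYT_def)
qed

lemma SYT_insert_max:
  assumes D: "finite D" and c: "c \<in> corners D" and T: "T \<in> SYT (D - {c})"
  defines "T' \<equiv> T(c := card D)"
  shows "T' \<in> SYT D" "inv_into D T' (card D) = c"
proof -
  have cD: "c \<in> D" using c corners_subset by blast
  then have D0: "card (D - {c}) = card D - 1" "card D \<noteq> 0" using D by (auto simp: card_Diff_singleton)
  have bij: "bij_betw T (D - {c}) {1..card D - 1}" using T D0 by (simp add: SYT_def)
  have lt: "T x < card D" if x: "x \<in> D - {c}" for x
  proof -
    have "T x \<in> {1..card D - 1}" using bij_betwE[OF bij] x by blast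
    then show ?thesis using D0(2) by auto
  qed
  have "bij_betw T' ({c} \<union> (D - {c})) ({card D} \<union> {1..card D - 1})"
  proof (rule bij_betw_combine)
    show "bij_betw T' {c} {card D}" by (simp add: T'_def)
    show "bij_betw T' (D - {c}) {1..card D - 1}"
      using bij by (subst bij_betw_cong[where g = T]) (auto simp: T'_def)
  qed (use D0 in auto)
  moreover have "{card D} \<union> {1..card D - 1} = {1..card D}" using D0 by auto
  ultimately have bij': "bij_betw T' D {1..card D}" using cD by (simp add: insert_absorb)
  obtain i j where ij: "c = (i, j)" by fastforce
  have corner: "\<And>j'. (i, j') \<in> D \<Longrightarrow> j' \<le> j" "\<And>i'. (i', j) \<in> D \<Longrightarrow> i' \<le> i"
    using c by (auto simp: corners_def ij)
  have "T' \<in> extensional D" using T cD by (auto simp: SYT_def T'_def extensional_def)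
  moreover have "T' (p, q) < T' (p, q')" if "(p, q) \<in> D" "(p, q') \<in> D" "q < q'" for p q q'
  proof -
    have "(p, q) \<noteq> c" using corner that ij by fastforce
    then show ?thesis
      using T that lt[of "(p, q)"] by (auto simp: T'_def SYT_def)
  qed
  moreover have "T' (p, q) < T' (p', q)" if "(p, q) \<in> D" "(p', q) \<in> D" "p < p'" for p p' q
  proof -
    have "(p, q) \<noteq> c" using corner that ij by fastforce
    then show ?thesis
      using T that lt[of "(p, q)"] by (auto simp: T'_def SYT_def)
  qed
  ultimately show "T' \<in> SYT D" using bij' by (simp add: SYT_def)
  have "inj_on T' D" using bij' by (simp add: bij_betw_def)
  from inv_into_f_f[OF this cD] show "inv_into D T' (card D) = c" by (simp add: T'_def)
qed

text \<open>The summand is arbitrary so that the same bijection serves content products and plain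
  counting.\<close>

lemma sum_SYT_remove_max:
  fixes \<Phi> :: "(nat \<times> nat \<Rightarrow> nat) \<Rightarrow> 'b::comm_monoid_add"
  assumes D: "finite D" "D \<noteq> {}"
  shows "(\<Sum>T\<in>SYT D. \<Phi> T) = (\<Sum>c\<in>corners D. \<Sum>T\<in>SYT (D - {c}). \<Phi> (T(c := card D)))"
proof -
  have "(\<Sum>c\<in>corners D. \<Sum>T\<in>SYT (D - {c}). \<Phi> (T(c := card D))) =
      (\<Sum>(c, T)\<in>Sigma (corners D) (\<lambda>c. SYT (D - {c})). \<Phi> (T(c := card D)))"
    using D finite_subset[OF corners_subset] by (intro sum.Sigma) (auto intro: finite_SYT_set)
  also have "\<dots> = (\<Sum>T\<in>SYT D. \<Phi> T)"
  proof (rule sum.reindex_bij_witness[of _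
        "\<lambda>T. (inv_into D T (card D), restrict T (D - {inv_into D T (card D)}))" "\<lambda>(c, T). T(c := card D)"])
    fix x assume "x \<in> Sigma (corners D) (\<lambda>c. SYT (D - {c}))"
    then obtain c T where x: "x = (c, T)" "c \<in> corners D" "T \<in> SYT (D - {c})" by auto
    note ins = SYT_insert_max[OF D(1) x(2,3)]
    have "restrict (T(c := card D)) (D - {c}) = restrict T (D - {c})" by auto
    also have "\<dots> = T" using x(3) by (intro extensional_restrict) (simp add: SYT_def)
    finally show "(inv_into D (case x of (c, T) \<Rightarrow> T(c := card D)) (card D),
          restrict (case x of (c, T) \<Rightarrow> T(c := card D))
            (D - {inv_into D (case x of (c, T) \<Rightarrow> T(c := card D)) (card D)})) = x"
      using ins x(1) by simp
    show "(case x of (c, T) \<Rightarrow> T(c := card D)) \<in> SYT D" using ins x(1) by simp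
    show "\<Phi> (case x of (c, T) \<Rightarrow> T(c := card D)) = (case x of (c, T) \<Rightarrow> \<Phi> (T(c := card D)))"
      by (simp add: x(1))
  next
    fix T assume T: "T \<in> SYT D"
    note rem = SYT_remove_max[OF D T]
    show "(inv_into D T (card D), restrict T (D - {inv_into D T (card D)})) \<in>
        Sigma (corners D) (\<lambda>c. SYT (D - {c}))"
      using rem by simp
    have "T \<in> extensional D" using T by (simp add: SYT_def)
    then show "(case (inv_into D T (card D), restrict T (D - {inv_into D T (card D)})) of
        (c, T) \<Rightarrow> T(c := card D)) = T"
      using rem(3) by (auto simp: fun_eq_iff restrict_def extensional_def)
  qed
  finally show ?thesis by simp
qed

section \<open>Content sums and skew tableau counts as recursions\<close>

text \<open>On the diagram of a partition of n, where 1 \<le> r \<le> n, this is (r - 1)! times the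
  character at an r-cycle, by \<open>irr_char_cycle\<close>.\<close>

definition content_sum :: "nat \<Rightarrow> (nat \<times> nat) set \<Rightarrow> int"
  where "content_sum r D = (\<Sum>T\<in>SYT D. \<Prod>x | x \<in> D \<and> T x \<in> {2..r}. cell_content x)"

lemma SYT_empty: "SYT {} = {\<lambda>_. undefined}"
  by (auto simp: SYT_def bij_betw_def)

lemma content_sum_empty: "content_sum r {} = 1"
  by (simp add: content_sum_def SYT_empty)

text \<open>The entry removed is \<open>card D\<close>. While it exceeds r its cell carries no
  factor, and this is the branching rule; from r down to 2 the factor is the content of the removed
  cell.\<close>

lemma content_sum_rec:
  assumes D: "finite D" "D \<noteq> {}"
  shows "content_sum r D =
    (\<Sum>c\<in>corners D. (if card D \<in> {2..r} then cell_content c else 1) * content_sum r (D - {c}))"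
proof -
  have "(\<Prod>x | x \<in> D \<and> (T(c := card D)) x \<in> {2..r}. cell_content x) =
      (if card D \<in> {2..r} then cell_content c else 1) * (\<Prod>x | x \<in> D - {c} \<and> T x \<in> {2..r}. cell_content x)"
    if "c \<in> corners D" for c T
  proof -
    have c: "c \<in> D" using that corners_subset by blast
    have "{x. x \<in> D \<and> (T(c := card D)) x \<in> {2..r}} =
        (if card D \<in> {2..r} then insert c {x. x \<in> D - {c} \<and> T x \<in> {2..r}}
         else {x. x \<in> D - {c} \<and> T x \<in> {2..r}})"
      using c by (auto split: if_splits)
    then show ?thesis using D(1) by simp
  qed
  then show ?thesis
    unfolding content_sum_def sum_SYT_remove_max[OF D] by (simp add: sum_distrib_left)
qed

definition num_SYT_above :: "(nat \<times> nat) set \<Rightarrow> (nat \<times> nat) set \<Rightarrow> nat"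
  where "num_SYT_above D E = (if E \<subseteq> D then card (SYT (D - E)) else 0)"

lemma num_skew_SYT_eq: "num_skew_SYT lam nu = num_SYT_above (young_diagram lam) (young_diagram nu)"
  by (simp add: num_skew_SYT_def num_SYT_above_def skew_SYT_eq)

lemma num_SYT_above_self: "num_SYT_above D D = 1"
  by (simp add: num_SYT_above_def SYT_empty)

text \<open>By \<open>down\<close>, a corner of \<open>D - E\<close> is a corner of D: a cell of D
  to its right or below it would have to lie in E, and then so would the corner. The inequality of
  sizes makes \<open>D - E\<close> nonempty, so there is a largest entry to remove.\<close>

lemma num_SYT_above_rec:
  assumes D: "finite D" and E: "card E < card D"
    and down: "\<And>i j i' j'. (i, j) \<in> E \<Longrightarrow> i' \<le> i \<Longrightarrow> j' \<le> j \<Longrightarrow> (i', j') \<in> E"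
  shows "num_SYT_above D E = (\<Sum>c\<in>corners D. num_SYT_above (D - {c}) E)"
proof (cases "E \<subseteq> D")
  case False
  then have "num_SYT_above (D - {c}) E = 0" for c by (auto simp: num_SYT_above_def)
  then show ?thesis using False by (simp add: num_SYT_above_def)
next
  case True
  then have ne: "D - E \<noteq> {}" using E by auto
  have fin: "finite (corners D)" using D corners_subset finite_subset by blast
  have cor: "corners (D - E) = corners D - E"
  proof (intro set_eqI iffI)
    fix x assume x: "x \<in> corners (D - E)"
    obtain i j where ij: "x = (i, j)" by fastforce
    have "j' \<le> j" if "(i, j') \<in> D" for j'
      using x down[of i j' i j] that by (cases "j' \<le> j") (auto simp: corners_def ij)
    moreover have "i' \<le> i" if "(i', j) \<in> D" for i'
      using x down[of i' j i j] that by (cases "i' \<le> i") (auto simp: corners_def ij)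
    ultimately show "x \<in> corners D - E" using x by (auto simp: corners_def ij)
  qed (auto simp: corners_def)
  have "num_SYT_above D E = (\<Sum>T\<in>SYT (D - E). 1)" using True by (simp add: num_SYT_above_def)
  also have "\<dots> = (\<Sum>c\<in>corners D - E. card (SYT (D - E - {c})))"
    using D ne by (subst sum_SYT_remove_max) (auto simp: cor)
  also have "\<dots> = (\<Sum>c\<in>corners D - E. num_SYT_above (D - {c}) E)"
  proof (intro sum.cong refl)
    fix c assume "c \<in> corners D - E"
    then have "E \<subseteq> D - {c}" "D - E - {c} = D - {c} - E" using True by blast+
    then show "card (SYT (D - E - {c})) = num_SYT_above (D - {c}) E"
      by (simp only: num_SYT_above_def if_True)
  qed
  \<comment> \<open>Removing a corner that lies in E destroys the inclusion, so the added summands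
    are 0 by convention.\<close>
  also have "\<dots> = (\<Sum>c\<in>corners D. num_SYT_above (D - {c}) E)"
    using fin by (intro sum.mono_neutral_left) (auto simp: num_SYT_above_def)
  finally show ?thesis .
qed

section \<open>Diagrams given by their row lengths\<close>

definition diagram :: "(nat \<Rightarrow> nat) \<Rightarrow> (nat \<times> nat) set"
  where "diagram a = {(i, j). j < a i}"

text \<open>L is only an upper bound for the number of rows. Trailing zeros are allowed, so removing
  a cell is a function update and L stays fixed throughout an induction.\<close>

definition shape :: "nat \<Rightarrow> (nat \<Rightarrow> nat) \<Rightarrow> bool"
  where "shape L a \<longleftrightarrow> antimono a \<and> (\<forall>i\<ge>L. a i = 0)"

lemma shape_le: "shape L a \<Longrightarrow> i \<le> j \<Longrightarrow> a j \<le> a i"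
  by (auto simp: shape_def antimono_def)

lemma diagram_Sigma: "shape L a \<Longrightarrow> diagram a = Sigma {..<L} (\<lambda>i. {..<a i})"
  by (auto simp: diagram_def shape_def) (metis gr_implies_not0 not_le)

lemma finite_diagram: "shape L a \<Longrightarrow> finite (diagram a)"
  by (simp add: diagram_Sigma)

lemma card_diagram: "shape L a \<Longrightarrow> card (diagram a) = (\<Sum>i<L. a i)"
  by (simp add: diagram_Sigma)

lemma shape_remove:
  assumes "shape L a" "a (Suc i) < a i"
  shows "shape L (a(i := a i - 1))"
proof -
  have "(a(i := a i - 1)) (Suc j) \<le> (a(i := a i - 1)) j" for j
    using assms shape_le[OF assms(1), of j "Suc j"] by (cases "j = i"; cases "Suc j = i") auto
  then have "antimono (a(i := a i - 1))" by (simp add: antimono_iff_le_Suc)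
  then show ?thesis using assms(1) by (auto simp: shape_def)
qed

lemma sum_remove:
  fixes a :: "nat \<Rightarrow> nat"
  assumes "i < L" "0 < a i"
  shows "(\<Sum>j<L. (a(i := a i - 1)) j) = (\<Sum>j<L. a j) - 1"
proof -
  have "(\<Sum>j<L. (a(i := a i - 1)) j) = (a i - 1) + (\<Sum>j\<in>{..<L} - {i}. a j)"
    using assms by (subst sum.remove[of _ i]) (auto intro: sum.cong)
  moreover have "(\<Sum>j<L. a j) = a i + (\<Sum>j\<in>{..<L} - {i}. a j)"
    using assms by (subst sum.remove[of _ i]) auto
  ultimately show ?thesis using assms by simp
qed

lemma diagram_remove: "a (Suc i) < a i \<Longrightarrow> diagram a - {(i, a i - 1)} = diagram (a(i := a i - 1))"
  by (auto simp: diagram_def split: if_splits)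

lemma corners_diagram:
  assumes "shape L a"
  shows "corners (diagram a) = (\<lambda>i. (i, a i - 1)) ` {i. i < L \<and> a (Suc i) < a i}"
proof (intro set_eqI iffI)
  fix x assume x: "x \<in> corners (diagram a)"
  obtain i j where ij: "x = (i, j)" by fastforce
  have j: "j < a i" "\<And>j'. j' < a i \<Longrightarrow> j' \<le> j" "\<And>i'. j < a i' \<Longrightarrow> i' \<le> i"
    using x by (auto simp: corners_def diagram_def ij)
  have "j = a i - 1" using j(1) j(2)[of "a i - 1"] by simp
  moreover have "a (Suc i) \<le> j" using j(3)[of "Suc i"] by fastforce
  moreover have "i < L" using j(1) assms by (auto simp: shape_def) (metis gr_implies_not0 not_le)
  ultimately show "x \<in> (\<lambda>i. (i, a i - 1)) ` {i. i < L \<and> a (Suc i) < a i}"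
    using j(1) ij by auto
next
  fix x assume "x \<in> (\<lambda>i. (i, a i - 1)) ` {i. i < L \<and> a (Suc i) < a i}"
  then obtain i where i: "x = (i, a i - 1)" "a (Suc i) < a i" by auto
  have "i' \<le> i" if "a i - 1 < a i'" for i'
  proof (rule ccontr)
    assume "\<not> i' \<le> i"
    then have "a i' \<le> a (Suc i)" by (intro shape_le[OF assms]) simp
    then show False using that i(2) by simp
  qed
  then show "x \<in> corners (diagram a)" using i by (auto simp: corners_def diagram_def)
qed

lemma sum_corners_diagram:
  assumes "shape L a"
  shows "(\<Sum>c\<in>corners (diagram a). g c (diagram a - {c})) =
    (\<Sum>i | i < L \<and> a (Suc i) < a i. g (i, a i - 1) (diagram (a(i := a i - 1))))"
  unfolding corners_diagram[OF assms]
  by (subst sum.reindex) (auto simp: inj_on_def diagram_remove[simplified] intro!: sum.cong)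

lemma shape_threshold:
  assumes "shape L a" "0 < c"
  shows "\<exists>p\<le>L. \<forall>i. c \<le> a i \<longleftrightarrow> i < p"
proof -
  let ?p = "LEAST i. a i < c"
  have L: "a L < c" using assms by (simp add: shape_def)
  have "c \<le> a i \<longleftrightarrow> i < ?p" for i
  proof
    assume "c \<le> a i"
    show "i < ?p"
    proof (rule ccontr)
      assume "\<not> i < ?p"
      then have "a i \<le> a ?p" by (intro shape_le[OF assms(1)]) simp
      then show False using LeastI[of "\<lambda>i. a i < c", OF L] \<open>c \<le> a i\<close> by simp
    qed
  next
    assume "i < ?p"
    then show "c \<le> a i" using not_less_Least[of i "\<lambda>i. a i < c"] by simp
  qed
  moreover have "?p \<le> L" using L by (rule Least_le)
  ultimately show ?thesis by blast
qed

lemma shape_column: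
  assumes "shape L a" "a 0 \<le> 1"
  shows "\<exists>p\<le>L. a = (\<lambda>i. if i < p then 1 else 0)"
proof -
  obtain p where p: "p \<le> L" "\<And>i. 1 \<le> a i \<longleftrightarrow> i < p" using shape_threshold[OF assms(1), of 1] by auto
  have "a i = (if i < p then 1 else 0)" for i
    using p(2)[of i] shape_le[OF assms(1), of 0 i] assms(2) by auto
  then show ?thesis using p(1) by blast
qed

text \<open>For hooks this is a form of the hook length formula; a cell \<open>(1, 1)\<close> has content \<open>0\<close>.\<close>

lemma content_sum_hook:
  assumes "shape L a" "card (diagram a) = Suc m" "Suc m \<le> r"
  shows "content_sum r (diagram a) = (if a 1 \<le> 1 then fact m * (- 1) ^ (Suc m - a 0) else 0)"
  using assms
proof (induction m arbitrary: a)
  case (0 a)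
  obtain x where x: "diagram a = {x}" using 0(2) by (auto simp: card_Suc_eq)
  have 00: "(0, 0) \<in> diagram a"
  proof -
    obtain i j where "(i, j) \<in> diagram a" using x by (metis insertI1 surj_pair)
    then show ?thesis using shape_le[OF 0(1), of 0 i] by (auto simp: diagram_def)
  qed
  have a0: "a 0 = 1"
  proof (rule ccontr)
    assume "a 0 \<noteq> 1"
    then have "(0, 0) \<in> diagram a" "(0, 1) \<in> diagram a" using 00 by (auto simp: diagram_def)
    then show False using x by auto
  qed
  then have "a 1 \<le> 1" using shape_le[OF 0(1), of 0 1] by simp
  moreover have "content_sum r (diagram a) = 1"
  proof -
    have "corners {x} = {x}" by (cases x) (auto simp: corners_def)
    then show ?thesis unfolding x by (subst content_sum_rec) (auto simp: content_sum_empty)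
  qed
  ultimately show ?case using a0 by simp
next
  case (Suc m a)
  note sh = Suc.prems(1)
  let ?R = "{i. i < L \<and> a (Suc i) < a i}"
  have ne: "diagram a \<noteq> {}" using Suc.prems(2) by auto
  have cont: "cell_content (i, a i - 1) = int (a i) - 1 - int i" if "i \<in> ?R" for i
    using that by (auto simp: cell_content_def)
  have "content_sum r (diagram a) = (\<Sum>c\<in>corners (diagram a). cell_content c * content_sum r (diagram a - {c}))"
    using Suc.prems by (subst content_sum_rec[OF finite_diagram[OF sh] ne]) simp
  also have "\<dots> = (\<Sum>i\<in>?R. (int (a i) - 1 - int i) * content_sum r (diagram (a(i := a i - 1))))"
    unfolding sum_corners_diagram[OF sh, of "\<lambda>c E. cell_content c * content_sum r E"]
    by (intro sum.cong refl arg_cong2[of _ _ _ _ "(*)"]) (rule cont)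
  also have "\<dots> = (\<Sum>i\<in>?R. (int (a i) - 1 - int i) *
      (if (a(i := a i - 1)) 1 \<le> 1 then fact m * (- 1) ^ (Suc m - (a(i := a i - 1)) 0) else 0))"
  proof (intro sum.cong refl arg_cong2[of _ _ _ _ "(*)"] Suc.IH)
    fix i assume i: "i \<in> ?R"
    then show shp: "shape L (a(i := a i - 1))" using shape_remove[OF sh] by simp
    have pos: "0 < a i" using i by auto
    have "(\<Sum>j<L. (a(i := a i - 1)) j) = (\<Sum>j<L. a j) - 1"
      by (rule sum_remove) (use i pos in auto)
    then show "card (diagram (a(i := a i - 1))) = Suc m"
      using Suc.prems(2) by (simp only: card_diagram[OF sh] card_diagram[OF shp])
  qed (use Suc.prems in simp)
  also have "\<dots> = (if a 1 \<le> 1 then fact (Suc m) * (- 1) ^ (Suc (Suc m) - a 0) else 0)"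
  proof (cases "a 1 \<le> 1")
    case False
    \<comment> \<open>Only the removal of the cell (1, 1), when \<open>a 1 = 2\<close>, can leave a
      hook, and that cell has content 0.\<close>
    have "(int (a i) - 1 - int i) *
      (if (a(i := a i - 1)) 1 \<le> 1 then fact m * (- 1) ^ (Suc m - (a(i := a i - 1)) 0) else 0) = 0"
      if "i \<in> ?R" for i
      using False by (cases "i = 1"; cases "a 1 = 2") auto
    then show ?thesis unfolding if_not_P[OF False] by (intro sum.neutral ballI)
  next
    case True
    have "shape L (a \<circ> Suc)" using sh by (auto simp: shape_def antimono_def)
    then obtain p where p: "a \<circ> Suc = (\<lambda>i. if i < p then 1 else 0)" "p \<le> L"
      using shape_column[of L "a \<circ> Suc"] True by auto
    have aS: "a (Suc i) = (if i < p then 1 else 0)" for i using fun_cong[OF p(1), of i] by simp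
    have "a 0 \<noteq> 0"
    proof
      assume "a 0 = 0"
      then have "a i = 0" for i using shape_le[OF sh, of 0 i] by simp
      then show False using ne by (auto simp: diagram_def)
    qed
    have L: "0 < L" using \<open>a 0 \<noteq> 0\<close> sh by (auto simp: shape_def)
    have pL: "p < L"
    proof (rule ccontr)
      assume "\<not> p < L"
      then have "a (Suc (L - 1)) = 1" using aS[of "L - 1"] L by simp
      then show False using sh L by (simp add: shape_def)
    qed
    have m: "Suc (Suc m) = a 0 + p"
    proof -
      obtain L' where L': "L = Suc L'" using L by (cases L) auto
      have "(\<Sum>i<L. a i) = a 0 + (\<Sum>i<L'. if i < p then 1 else 0)"
        unfolding L' sum.lessThan_Suc_shift aS ..
      also have "(\<Sum>i<L'. if i < p then 1 else 0) = card ({..<L'} \<inter> {i. i < p})"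
        by (simp add: sum.If_cases)
      also have "{..<L'} \<inter> {i. i < p} = {..<p}" using pL L' by auto
      finally show ?thesis using Suc.prems(2) card_diagram[OF sh] by simp
    qed
    define f where "f i = (int (a i) - 1 - int i) *
      (if (a(i := a i - 1)) 1 \<le> 1 then fact m * (- 1) ^ (Suc m - (a(i := a i - 1)) 0) else 0)" for i
    have f0: "f 0 = (int (a 0) - 1) * (fact m * (- 1) ^ p)"
      using True m \<open>a 0 \<noteq> 0\<close> by (simp add: f_def)
    have fp: "f p = - int p * (fact m * (- 1) ^ (p - 1))" if p0: "p \<noteq> 0"
    proof -
      obtain q where q: "p = Suc q" using p0 by (cases p) auto
      have "a p = 1" using aS[of q] q by simp
      moreover have "Suc m - a 0 = p - 1" using m q by simp
      moreover have "(a(p := a p - 1)) 1 \<le> 1" using True by auto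
      ultimately show ?thesis using q by (simp add: f_def)
    qed
    \<comment> \<open>The removable cells are the end of the arm, i = 0, and the end of the leg, i =
      p. If the arm consists of one cell, 0 need not belong to \<open>?R\<close>, but
      \<open>f 0\<close> has the factor \<open>int (a 0) - 1\<close> = 0.\<close>
    have "sum f ?R = sum f {0, p}"
    proof (rule sum.mono_neutral_cong)
      show "f i = 0" if i: "i \<in> {0, p} - ?R" for i
      proof -
        have "a (Suc p) = 0" using aS[of p] by simp
        have "a p = 1" if "p \<noteq> 0" using aS[of "p - 1"] that by simp
        then have "i = 0" using i pL \<open>a (Suc p) = 0\<close> by (cases "p = 0") auto
        then have "a 0 \<le> 1" using i L aS[of 0] by (auto split: if_splits)
        then show ?thesis using \<open>i = 0\<close> \<open>a 0 \<noteq> 0\<close> by (simp add: f_def)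
      qed
      show "f i = 0" if i: "i \<in> ?R - {0, p}" for i
      proof -
        obtain i' where "i = Suc i'" using i by (cases i) auto
        then show ?thesis using i aS[of i'] aS[of i] by (auto simp: f_def split: if_splits)
      qed
    qed auto
    also have "\<dots> = fact (Suc m) * (- 1) ^ p"
    proof (cases "p = 0")
      case True
      have "int (a 0) - 1 = int (Suc m)" using m True by simp
      with True show ?thesis using f0 by simp
    next
      case False
      have "(- 1 :: int) ^ p = - ((- 1) ^ (p - 1))" using False by (cases p) auto
      then have "sum f {0, p} = (int (a 0) - 1 + int p) * (fact m * (- 1) ^ p)"
        using False f0 fp by (simp only: sum.insert sum.empty finite.intros) (simp add: algebra_simps)
      also have "int (a 0) - 1 + int p = int (Suc m)" using m by simp
      finally show ?thesis by (simp add: algebra_simps)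
    qed
    finally have "sum f ?R = fact (Suc m) * (- 1) ^ p" .
    then show ?thesis unfolding f_def using True m by simp
  qed
  finally show ?case .
qed

section \<open>Characters of cycles in terms of beta numbers\<close>

definition pairs :: "nat \<Rightarrow> (nat \<times> nat) set"
  where "pairs L = {(i, j). i < j \<and> j < L}"

definition sgns :: "nat \<Rightarrow> (nat \<Rightarrow> int) \<Rightarrow> int"
  where "sgns L \<beta> = (\<Prod>(i, j)\<in>pairs L. sgn (\<beta> i - \<beta> j))"

text \<open>\<open>vsign L \<beta>\<close> is the coefficient of \<open>x\<^sup>\<beta>\<close> in the Vandermonde determinant of \<open>L\<close> variables.\<close>

definition vsign :: "nat \<Rightarrow> (nat \<Rightarrow> int) \<Rightarrow> int"
  where "vsign L \<beta> = (if \<beta> ` {..<L} = {0..<int L} then sgns L \<beta> else 0)"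

lemma finite_pairs: "finite (pairs L)"
  by (rule finite_subset[of _ "{..<L} \<times> {..<L}"]) (auto simp: pairs_def)

lemma sgns_Suc: "sgns (Suc L) \<beta> = (\<Prod>j<L. sgn (\<beta> 0 - \<beta> (Suc j))) * sgns L (\<lambda>i. \<beta> (Suc i))"
proof -
  let ?A = "(\<lambda>j. (0, Suc j)) ` {..<L}" and ?B = "(\<lambda>(i, j). (Suc i, Suc j)) ` pairs L"
  let ?f = "\<lambda>(i, j). sgn (\<beta> i - \<beta> j)"
  have "pairs (Suc L) = ?A \<union> ?B"
  proof (intro set_eqI iffI)
    fix x assume "x \<in> pairs (Suc L)"
    then obtain i j where x: "x = (i, j)" "i < j" "j < Suc L" by (auto simp: pairs_def)
    then obtain j' where j': "j = Suc j'" by (cases j) auto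
    show "x \<in> ?A \<union> ?B"
    proof (cases i)
      case 0
      then show ?thesis using x j' by auto
    next
      case (Suc i')
      then show ?thesis using x j' by (auto simp: pairs_def)
    qed
  qed (auto simp: pairs_def)
  moreover have "?A \<inter> ?B = {}" by auto
  ultimately have "sgns (Suc L) \<beta> = prod ?f ?A * prod ?f ?B"
    unfolding sgns_def using finite_pairs by (simp add: prod.union_disjoint)
  also have "prod ?f ?A = (\<Prod>j<L. sgn (\<beta> 0 - \<beta> (Suc j)))"
    by (subst prod.reindex) (auto simp: inj_on_def)
  also have "prod ?f ?B = sgns L (\<lambda>i. \<beta> (Suc i))"
    unfolding sgns_def by (subst prod.reindex) (auto simp: inj_on_def intro!: prod.cong)
  finally show ?thesis .
qed

lemma sgns_decreasing:
  assumes "\<And>i j. i < j \<Longrightarrow> j < L \<Longrightarrow> \<beta> j < \<beta> i"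
  shows "sgns L \<beta> = 1"
  unfolding sgns_def using assms by (intro prod.neutral) (auto simp: pairs_def)

text \<open>An adjacent transposition permutes the other pairs without reversing any of them, so
  only the factor of \<open>(k, Suc k)\<close> changes sign. General transpositions do reverse
  further pairs and are built from adjacent ones in \<open>beta_char_swap\<close>.\<close>

lemma sgns_swap:
  assumes "Suc k < L"
  shows "sgns L (\<beta> \<circ> transpose k (Suc k)) = - sgns L \<beta>"
proof -
  let ?t = "transpose k (Suc k)"
  let ?f = "\<lambda>\<beta>. \<lambda>(i, j). sgn (\<beta> i - \<beta> j :: int)"
  have kP: "(k, Suc k) \<in> pairs L" using assms by (simp add: pairs_def)
  have "prod (?f (\<beta> \<circ> ?t)) (pairs L - {(k, Suc k)}) = prod (?f \<beta>) (pairs L - {(k, Suc k)})"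
  proof (rule prod.reindex_bij_witness[of _ "\<lambda>(i, j). (?t i, ?t j)" "\<lambda>(i, j). (?t i, ?t j)"])
    fix x assume x: "x \<in> pairs L - {(k, Suc k)}"
    show "(case x of (i, j) \<Rightarrow> (?t i, ?t j)) \<in> pairs L - {(k, Suc k)}"
      using x assms by (auto simp: pairs_def transpose_def split: if_splits)
    then show "(case x of (i, j) \<Rightarrow> (?t i, ?t j)) \<in> pairs L - {(k, Suc k)}" .
  qed auto
  moreover have "sgns L \<beta>' = sgn (\<beta>' k - \<beta>' (Suc k)) * prod (?f \<beta>') (pairs L - {(k, Suc k)})" for \<beta>'
    unfolding sgns_def by (subst prod.remove[OF finite_pairs kP]) simp
  moreover have "sgn (\<beta> (Suc k) - \<beta> k) = - sgn (\<beta> k - \<beta> (Suc k))"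
    by (simp add: sgn_if)
  ultimately show ?thesis by simp
qed

lemma transpose_image_lessThan:
  fixes k l L :: nat
  assumes "k < L" "l < L"
  shows "transpose k l ` {..<L} = {..<L}"
  using assms by (intro transpose_image_eq) simp

lemma vsign_swap:
  assumes "Suc k < L"
  shows "vsign L (\<beta> \<circ> transpose k (Suc k)) = - vsign L \<beta>"
proof -
  have "(\<beta> \<circ> transpose k (Suc k)) ` {..<L} = \<beta> ` {..<L}"
    using transpose_image_lessThan[of k L "Suc k"] assms by (simp only: image_comp[symmetric])
  then show ?thesis using sgns_swap[OF assms] by (simp add: vsign_def)
qed

text \<open>By Frobenius' formula \<open>beta_char L r d\<close> is the value of an irreducible character of the symmetric
  group on \<open>r + d\<close> points at an \<open>r\<close>-cycle, as an antisymmetric function of the beta numbers. The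
  recursion is the branching rule; the start is the multiplication of the Vandermonde determinant
  with the \<open>r\<close>-th power sum.\<close>

primrec beta_char :: "nat \<Rightarrow> nat \<Rightarrow> nat \<Rightarrow> (nat \<Rightarrow> int) \<Rightarrow> int" where
  "beta_char L r 0 \<beta> = (\<Sum>i<L. vsign L (\<beta>(i := \<beta> i - int r)))"
| "beta_char L r (Suc d) \<beta> = (\<Sum>i<L. beta_char L r d (\<beta>(i := \<beta> i - 1)))"

text \<open>Lowering an entry after the swap is swapping after lowering the entry at the swapped
  index, so the sum over all indices inherits antisymmetry. Taken with c = r for the start of
  \<open>beta_char\<close> and with c = 1 for its recursion.\<close>

lemma sum_update_swap:
  assumes F: "\<And>\<beta>. F (\<beta> \<circ> transpose k (Suc k)) = - F \<beta>" and k: "Suc k < L"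
  shows "(\<Sum>i<L. F ((\<beta> \<circ> transpose k (Suc k))(i := (\<beta> \<circ> transpose k (Suc k)) i - c))) =
    - (\<Sum>i<L. F (\<beta>(i := \<beta> i - c)) :: int)"
proof -
  let ?t = "transpose k (Suc k)"
  have "(\<beta> \<circ> ?t)(i := (\<beta> \<circ> ?t) i - c) = (\<beta>(?t i := \<beta> (?t i) - c)) \<circ> ?t" for i
    by (auto simp: fun_eq_iff transpose_eq_iff)
  then have "(\<Sum>i<L. F ((\<beta> \<circ> ?t)(i := (\<beta> \<circ> ?t) i - c))) = (\<Sum>i<L. - F (\<beta>(?t i := \<beta> (?t i) - c)))"
    by (simp only: F)
  also have "\<dots> = (\<Sum>i<L. - F (\<beta>(i := \<beta> i - c)))"
    using k transpose_image_lessThan[of k L "Suc k"]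
    by (intro sum.reindex_bij_betw[of ?t "{..<L}" "{..<L}" "\<lambda>i. - F (\<beta>(i := \<beta> i - c))"])
      (simp add: bij_betw_def inj_on_subset[OF inj_transpose])
  finally show ?thesis by (simp add: sum_negf)
qed

lemma beta_char_swap_Suc:
  assumes "Suc k < L"
  shows "beta_char L r d (\<beta> \<circ> transpose k (Suc k)) = - beta_char L r d \<beta>"
proof (induction d arbitrary: \<beta>)
  case 0
  show ?case
    unfolding beta_char.simps by (rule sum_update_swap[where F = "vsign L", OF vsign_swap[OF assms] assms])
next
  case (Suc d)
  show ?case
    unfolding beta_char.simps by (rule sum_update_swap[where F = "beta_char L r d", OF Suc assms])
qed

lemma beta_char_swap:
  assumes "i < j" "j < L"
  shows "beta_char L r d (\<beta> \<circ> transpose i j) = - beta_char L r d \<beta>"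
  using assms
proof (induction j arbitrary: \<beta>)
  case (Suc j)
  show ?case
  proof (cases "i = j")
    case True
    show ?thesis unfolding True by (rule beta_char_swap_Suc[OF Suc.prems(2)])
  next
    case False
    let ?s = "transpose j (Suc j)"
    have "transpose i (Suc j) = ?s \<circ> transpose i j \<circ> ?s"
      using False Suc.prems(1) by (auto simp: fun_eq_iff transpose_def)
    then have "beta_char L r d (\<beta> \<circ> transpose i (Suc j)) = beta_char L r d (\<beta> \<circ> ?s \<circ> transpose i j \<circ> ?s)"
      by (simp add: comp_assoc)
    also have "\<dots> = - beta_char L r d \<beta>"
    proof -
      have IH: "beta_char L r d (\<gamma> \<circ> transpose i j) = - beta_char L r d \<gamma>" for \<gamma>
        using False Suc.prems by (intro Suc.IH) auto
      show ?thesis unfolding beta_char_swap_Suc[OF Suc.prems(2)] IH by simp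
    qed
    finally show ?thesis .
  qed
qed simp

lemma beta_char_eq_0:
  assumes "i < j" "j < L" "\<beta> i = \<beta> j"
  shows "beta_char L r d \<beta> = 0"
proof -
  have "\<beta> \<circ> transpose i j = \<beta>" using assms(3) by (auto simp: fun_eq_iff transpose_def)
  then show ?thesis using beta_char_swap[OF assms(1,2), of r d \<beta>] by simp
qed

text \<open>The recursion only lowers entries, and \<open>vsign\<close> is 0 as soon as one is
  negative.\<close>

lemma beta_char_neg:
  assumes "i < L" "\<beta> i < 0"
  shows "beta_char L r d \<beta> = 0"
  using assms(2)
proof (induction d arbitrary: \<beta>)
  case 0
  have "vsign L (\<beta>(k := \<beta> k - int r)) = 0" for k
  proof -
    have "(\<beta>(k := \<beta> k - int r)) i < 0" using 0 by auto
    then have "(\<beta>(k := \<beta> k - int r)) ` {..<L} \<noteq> {0..<int L}"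
      using assms(1) by (metis atLeastLessThan_iff imageI lessThan_iff not_le)
    then show ?thesis unfolding vsign_def by (simp only: if_False)
  qed
  then show ?case unfolding beta_char.simps by (intro sum.neutral ballI)
next
  case (Suc d)
  have "(\<beta>(k := \<beta> k - 1)) i < 0" for k using Suc.prems by auto
  then show ?case unfolding beta_char.simps using Suc.IH by (intro sum.neutral ballI) blast
qed

definition beta :: "nat \<Rightarrow> (nat \<Rightarrow> nat) \<Rightarrow> nat \<Rightarrow> int"
  where "beta L a i = int (a i) + int L - 1 - int i"

lemma beta_remove: "0 < a i \<Longrightarrow> (beta L a)(i := beta L a i - 1) = beta L (a(i := a i - 1))"
  by (auto simp: beta_def fun_eq_iff)

text \<open>Lowering a row that equals the next one makes two beta numbers collide; lowering an
  empty last row gives -1. The offset \<open>L' - L\<close> is 0 for a diagram itself and 1 below an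
  added first row.\<close>

lemma beta_char_no_corner:
  assumes "shape L a" "i < L" "\<not> a (Suc i) < a i" "L \<le> L'"
    "\<And>j. j < L \<Longrightarrow> \<beta> (j + (L' - L)) = beta L a j"
  shows "beta_char L' r d (\<beta>(i + (L' - L) := \<beta> (i + (L' - L)) - 1)) = 0"
proof (cases "Suc i < L")
  case True
  have "a (Suc i) = a i" using assms(3) shape_le[OF assms(1), of i "Suc i"] by simp
  then show ?thesis
    using True assms(4) assms(5)[of i] assms(5)[of "Suc i"]
    by (intro beta_char_eq_0[of "i + (L' - L)" "Suc i + (L' - L)"]) (auto simp: beta_def)
next
  case False
  then have "a (Suc i) = 0" "Suc i = L" using assms(1,2) by (auto simp: shape_def)
  then have "a i = 0" using assms(3) by simp
  then show ?thesis
    using \<open>Suc i = L\<close> assms(4) assms(5)[of i]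
    by (intro beta_char_neg[of "i + (L' - L)"]) (auto simp: beta_def)
qed

section \<open>The values on partitions of \<open>r\<close>\<close>

lemma prod_sgn_threshold:
  assumes "p \<le> N" "\<And>j. j < N \<Longrightarrow> sgn (x - f j) = (if j < p then - 1 else 1 :: int)"
  shows "(\<Prod>j<N. sgn (x - f j)) = (- 1) ^ p"
proof -
  have "(\<Prod>j<N. sgn (x - f j)) = (\<Prod>j<N. if j < p then - 1 else 1)"
    using assms(2) by (intro prod.cong) auto
  also have "\<dots> = (\<Prod>j\<in>{..<N} \<inter> {j. j < p}. - 1)"
    by (subst prod.inter_restrict) simp_all
  also have "{..<N} \<inter> {j. j < p} = {..<p}" using assms(1) by auto
  finally show ?thesis by simp
qed

lemma vsign_out_of_range:
  assumes "i < L" "\<beta> i < 0 \<or> int L \<le> \<beta> i"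
  shows "vsign L \<beta> = 0"
proof -
  have "\<beta> ` {..<L} \<noteq> {0..<int L}"
  proof
    assume "\<beta> ` {..<L} = {0..<int L}"
    then have "\<beta> i \<in> {0..<int L}" using assms(1) by blast
    then show False using assms(2) by auto
  qed
  then show ?thesis unfolding vsign_def by (simp only: if_False)
qed

lemma vsign_missing:
  assumes "0 \<le> y" "y < int L" "\<And>i. i < L \<Longrightarrow> \<beta> i \<noteq> y"
  shows "vsign L \<beta> = 0"
proof -
  have "y \<notin> \<beta> ` {..<L}" using assms(3) by blast
  then have "\<beta> ` {..<L} \<noteq> {0..<int L}" using assms(1,2) by auto
  then show ?thesis unfolding vsign_def by (simp only: if_False)
qed

text \<open>\<open>row_beta l r d k a\<close> extends the beta numbers of \<open>a\<close>, of size \<open>k\<close>, by a first row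
  of possibly negative length \<open>r + d - k\<close>.\<close>

definition row_beta :: "nat \<Rightarrow> nat \<Rightarrow> nat \<Rightarrow> nat \<Rightarrow> (nat \<Rightarrow> nat) \<Rightarrow> nat \<Rightarrow> int"
  where "row_beta l r d k a = case_nat (int r + int d - int k + int l) (beta l a)"

lemma row_beta_simps [simp]:
  "row_beta l r d k a 0 = int r + int d - int k + int l"
  "row_beta l r d k a (Suc i) = beta l a i"
  by (simp_all add: row_beta_def)

text \<open>For k < r the first entry exceeds l, so it is the one to be lowered by r; it becomes l -
  k, the gap left by the column, with k larger entries behind it. For k \<ge> r the first entry
  coincides with the beta number of row k - r.\<close>

lemma beta_char_column:
  assumes a: "a = (\<lambda>i. if i < k then 1 else 0)" and "k \<le> l" "1 \<le> r"
  shows "beta_char (Suc l) r 0 (row_beta l r 0 k a) = (if k < r then (- 1) ^ k else 0)"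
proof (cases "k < r")
  case False
  have "beta_char (Suc l) r 0 (row_beta l r 0 k a) = 0"
    using False assms by (intro beta_char_eq_0[of 0 "Suc (k - r)"]) (auto simp: beta_def)
  then show ?thesis using False by simp
next
  case True
  let ?b = "row_beta l r 0 k a"
  let ?c = "?b(0 := ?b 0 - int r)"
  have 0: "vsign (Suc l) (?b(i := ?b i - int r)) = 0" if "i \<in> {..<Suc l} - {0}" for i
  proof (rule vsign_out_of_range[of 0])
    show "(?b(i := ?b i - int r)) 0 < 0 \<or> int (Suc l) \<le> (?b(i := ?b i - int r)) 0"
    proof (rule disjI2)
      have "i \<noteq> 0" using that by simp
      then have "(?b(i := ?b i - int r)) 0 = int r - int k + int l" by (subst fun_upd_other) auto
      then show "int (Suc l) \<le> (?b(i := ?b i - int r)) 0" using True by linarith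
    qed
  qed simp
  have "beta_char (Suc l) r 0 ?b = vsign (Suc l) ?c"
    unfolding beta_char.simps by (subst sum.remove[of _ 0]) (use 0 in \<open>auto simp: sum.neutral\<close>)
  also have "\<dots> = sgns (Suc l) ?c"
  proof -
    have "?c ` {..<Suc l} = {0..<int (Suc l)}"
    proof (intro set_eqI iffI)
      fix y assume "y \<in> ?c ` {..<Suc l}"
      then obtain i where i: "i < Suc l" "y = ?c i" by blast
      then show "y \<in> {0..<int (Suc l)}"
        using assms(2) by (cases i) (auto simp: a beta_def)
    next
      fix y assume y: "y \<in> {0..<int (Suc l)}"
      \<comment> \<open>The index at which y is attained: the gap by the first entry, larger values
        by rows of length 1, smaller values by empty rows.\<close>
      define i where "i = (if y = int l - int k then 0 else if y > int l - int k then Suc (nat (int l - y))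
        else Suc (nat (int l - 1 - y)))"
      have "i < Suc l" "y = ?c i" using y assms(2) by (auto simp: i_def a beta_def)
      then show "y \<in> ?c ` {..<Suc l}" by blast
    qed
    then show ?thesis unfolding vsign_def by (rule if_P)
  qed
  also have "\<dots> = (- 1) ^ k"
  proof -
    have "(\<Prod>j<l. sgn (?c 0 - ?c (Suc j))) = (- 1) ^ k"
      by (rule prod_sgn_threshold[OF assms(2)]) (auto simp: a beta_def sgn_if)
    moreover have "sgns l (\<lambda>i. ?c (Suc i)) = 1"
      by (rule sgns_decreasing) (auto simp: a beta_def)
    ultimately show ?thesis unfolding sgns_Suc by simp
  qed
  finally show ?thesis using True by simp
qed

text \<open>The entry at index 1 is \<open>a 0 + l - 1\<close>, hence at least l + 1 and out of
  range; no other entry may be lowered in its place.\<close>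

lemma beta_char_not_column:
  assumes sh: "shape l a" and "2 \<le> a 0"
  shows "beta_char (Suc l) r 0 (row_beta l r 0 k a) =
    vsign (Suc l) ((row_beta l r 0 k a)(1 := beta l a 0 - int r))"
proof -
  let ?b = "row_beta l r 0 k a"
  have l: "0 < l" using assms by (auto simp: shape_def intro: ccontr)
  have "vsign (Suc l) (?b(i := ?b i - int r)) = 0" if "i \<in> {..<Suc l} - {1}" for i
    using that assms(2) l by (intro vsign_out_of_range[of 1]) (auto simp: beta_def)
  then have "(\<Sum>i\<in>{..<Suc l} - {1}. vsign (Suc l) (?b(i := ?b i - int r))) = 0"
    by (intro sum.neutral ballI)
  then show ?thesis
    unfolding beta_char.simps using l by (subst sum.remove[of _ 1]) auto
qed

text \<open>The entry at index 2 is out of range as well, and only one entry can be lowered.\<close>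

lemma beta_char_three:
  assumes sh: "shape l a" and "2 \<le> a 0" "3 \<le> a 1"
  shows "beta_char (Suc l) r 0 (row_beta l r 0 k a) = 0"
proof -
  have "1 < l" using assms by (auto simp: shape_def intro: ccontr)
  then show ?thesis
    unfolding beta_char_not_column[OF assms(1,2)] using assms(3)
    by (intro vsign_out_of_range[of 2]) (auto simp: beta_def numeral_2_eq_2)
qed

text \<open>The entries from index 2 on cover 0, ..., l except for l - u and l - u - v - 1. The two
  remaining entries must fill these gaps, and the two possible orders force k = r + u or k = r + 1 +
  u + v: the two infinite families of candidates for primary shapes. The gaps have u and u + v
  larger entries behind them, giving (-1)^v, and the second order costs one more sign.\<close>

lemma beta_char_double_hook:
  assumes a: "a = case_nat x (\<lambda>i. if i < u then 2 else if i < u + v then 1 else 0)"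
    and "2 \<le> x" "u + v < l" "k = x + 2 * u + v"
  shows "beta_char (Suc l) r 0 (row_beta l r 0 k a) =
    (if k = r + u then (- 1) ^ v else if k = r + 1 + u + v then (- 1) ^ Suc v else 0)"
proof -
  have sh: "shape l a"
    unfolding shape_def antimono_iff_le_Suc using assms by (auto split: nat.split)
  let ?b = "(row_beta l r 0 k a)(1 := beta l a 0 - int r)"
  have b0: "?b 0 = int r - int k + int l" by simp
  have b1: "?b (Suc 0) = int k - 2 * int u - int v + int l - 1 - int r"
    using assms by (simp add: beta_def)
  have b2: "?b (Suc (Suc i)) = (if i < u then int l - int i else if i < u + v then int l - 1 - int i
      else int l - 2 - int i)" for i
    by (auto simp: a beta_def)
  obtain l' where l': "l = Suc l'" using assms(3) by (cases l) auto
  have vs: "vsign (Suc l) ?b = sgns (Suc l) ?b"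
    if "{?b 0, ?b (Suc 0)} = {int l - int u, int l - int u - int v - 1}"
  proof -
    have "?b ` {..<Suc l} = {0..<int (Suc l)}"
    proof (intro set_eqI iffI)
      fix y assume "y \<in> ?b ` {..<Suc l}"
      then obtain i where i: "i < Suc l" "y = ?b i" by blast
      consider "i = 0" | "i = Suc 0" | i' where "i = Suc (Suc i')" by (metis not0_implies_Suc)
      then show "y \<in> {0..<int (Suc l)}"
      proof cases
        case 3
        then show ?thesis using i b2[of i'] assms(3) by (auto split: if_splits)
      qed (use that i assms(3) in \<open>auto simp del: fun_upd_apply simp: doubleton_eq_iff\<close>)
    next
      fix y assume y: "y \<in> {0..<int (Suc l)}"
      consider "y = int l - int u" | "y = int l - int u - int v - 1" | "y > int l - int u"
        | "y < int l - int u" "y > int l - int u - int v - 1" | "y < int l - int u - int v - 1"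
        by linarith
      then show "y \<in> ?b ` {..<Suc l}"
      proof cases
        case 1
        then have "y \<in> ?b ` {0, Suc 0}" using that by (simp del: fun_upd_apply)
        moreover have "{0, Suc 0} \<subseteq> {..<Suc l}" using l' by auto
        ultimately show ?thesis using image_mono by blast
      next
        case 2
        then have "y \<in> ?b ` {0, Suc 0}" using that by (simp del: fun_upd_apply)
        moreover have "{0, Suc 0} \<subseteq> {..<Suc l}" using l' by auto
        ultimately show ?thesis using image_mono by blast
      next
        case 3
        then have "y = ?b (Suc (Suc (nat (int l - y))))" "Suc (Suc (nat (int l - y))) < Suc l"
          using y assms(3) unfolding b2 by auto
        then show ?thesis by blast
      next
        case 4
        then have "y = ?b (Suc (Suc (nat (int l - 1 - y))))" "Suc (Suc (nat (int l - 1 - y))) < Suc l"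
          using y assms(3) unfolding b2 by auto
        then show ?thesis by blast
      next
        case 5
        then have "y = ?b (Suc (Suc (nat (int l - 2 - y))))" "Suc (Suc (nat (int l - 2 - y))) < Suc l"
          using y assms(3) unfolding b2 by auto
        then show ?thesis by blast
      qed
    qed
    then show ?thesis unfolding vsign_def by (rule if_P)
  qed
  have sg: "sgns (Suc l) ?b = sgn (?b 0 - ?b (Suc 0)) * (\<Prod>j<l'. sgn (?b 0 - ?b (Suc (Suc j)))) *
      (\<Prod>j<l'. sgn (?b (Suc 0) - ?b (Suc (Suc j))))"
  proof -
    have "sgns l' (\<lambda>i. ?b (Suc (Suc i))) = 1"
      by (rule sgns_decreasing) (simp only: b2, auto)
    then show ?thesis
      unfolding l' sgns_Suc prod.lessThan_Suc_shift by simp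
  qed
  have pu: "(\<Prod>j<l'. sgn (int l - int u - ?b (Suc (Suc j)))) = (- 1) ^ u"
    unfolding b2 by (rule prod_sgn_threshold) (use assms(3) l' in \<open>auto simp: sgn_if\<close>)
  have puv: "(\<Prod>j<l'. sgn (int l - int u - int v - 1 - ?b (Suc (Suc j)))) = (- 1) ^ (u + v)"
    unfolding b2 by (rule prod_sgn_threshold) (use assms(3) l' in \<open>auto simp: sgn_if\<close>)
  have pow: "(- 1 :: int) ^ u * (- 1) ^ (u + v) = (- 1) ^ v"
    by (simp only: power_add mult.assoc[symmetric] power_mult_distrib[symmetric]) simp
  consider "k = r + u" | "k = r + 1 + u + v" "k \<noteq> r + u" | "k \<noteq> r + u" "k \<noteq> r + 1 + u + v" by blast
  then have "vsign (Suc l) ?b =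
    (if k = r + u then (- 1) ^ v else if k = r + 1 + u + v then (- 1) ^ Suc v else 0)"
  proof cases
    case 1
    then have b: "?b 0 = int l - int u" "?b (Suc 0) = int l - int u - int v - 1"
      unfolding b0 b1 by auto
    have "vsign (Suc l) ?b = sgn (1 + int v) * (- 1) ^ u * (- 1) ^ (u + v)"
      unfolding vs[unfolded b, OF refl] sg b pu puv by simp
    then show ?thesis using 1 pow by simp
  next
    case 2
    then have b: "?b 0 = int l - int u - int v - 1" "?b (Suc 0) = int l - int u"
      unfolding b0 b1 by auto
    have "vsign (Suc l) ?b = sgn (- 1 - int v) * (- 1) ^ (u + v) * (- 1) ^ u"
      unfolding vs[unfolded b, OF insert_commute] sg b pu puv by simp
    then show ?thesis using 2 pow by (simp add: mult.commute)
  next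
    case 3
    \<comment> \<open>The value l - u would be attained by entry 0 exactly if k = r + u, and by
      entry 1 exactly if k = r + 1 + u + v.\<close>
    have "?b i \<noteq> int l - int u" if "i < Suc l" for i
    proof -
      consider "i = 0" | "i = Suc 0" | i' where "i = Suc (Suc i')" by (metis not0_implies_Suc)
      then show ?thesis
      proof cases
        case 1
        show ?thesis unfolding 1 b0 using 3 by auto
      next
        case 2
        show ?thesis unfolding 2 b1 using 3 by auto
      next
        case i: 3
        show ?thesis unfolding i b2 by auto
      qed
    qed
    then have "vsign (Suc l) ?b = 0"
      using assms(3) by (intro vsign_missing[of "int l - int u"]) auto
    then show ?thesis using 3 by simp
  qed
  then show ?thesis using beta_char_not_column[OF sh, of r k] assms(1,2) by simp
qed

section \<open>Primary partitions\<close>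

definition rows :: "nat list \<Rightarrow> nat \<Rightarrow> nat"
  where "rows nu i = (if i < length nu then nu ! i else 0)"

lemma young_diagram_rows: "young_diagram nu = diagram (rows nu)"
  by (auto simp: young_diagram_def diagram_def rows_def split: if_splits)

lemma diagram_eq_iff: "diagram a = diagram b \<longleftrightarrow> a = b"
proof
  assume *: "diagram a = diagram b"
  have "j < a i \<longleftrightarrow> j < b i" for i j
  proof -
    have "(i, j) \<in> diagram a \<longleftrightarrow> (i, j) \<in> diagram b" using * by simp
    then show ?thesis by (simp add: diagram_def)
  qed
  then show "a = b" by (metis ext linorder_neqE_nat less_irrefl)
qed simp

lemma shape_rows:
  assumes "nu \<turnstile>\<^sub>p h"
  shows "shape (length nu) (rows nu)"
proof -
  have "rows nu (Suc i) \<le> rows nu i" for i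
    using assms sorted_wrt_nth_less[of "(\<ge>)" nu i "Suc i"] by (auto simp: rows_def partition_of_def)
  then show ?thesis by (simp add: shape_def antimono_iff_le_Suc rows_def)
qed

lemma sum_rows: "nu \<turnstile>\<^sub>p h \<Longrightarrow> (\<Sum>i<length nu. rows nu i) = h"
  by (simp add: partition_of_def rows_def sum_list_sum_nth atLeast0LessThan)

lemma card_diagram_rows: "nu \<turnstile>\<^sub>p h \<Longrightarrow> card (diagram (rows nu)) = h"
  using card_diagram[OF shape_rows] sum_rows by metis

lemma rows_inject:
  assumes "nu \<turnstile>\<^sub>p h" "nu' \<turnstile>\<^sub>p h'" "rows nu = rows nu'"
  shows "nu = nu'"
proof -
  have pos: "0 < rows xs i \<longleftrightarrow> i < length xs" if xs: "xs \<turnstile>\<^sub>p m" for xs i m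
  proof -
    have "xs ! i \<noteq> 0" if "i < length xs"
      using nth_mem[OF that] xs unfolding partition_of_def by metis
    then show ?thesis by (simp add: rows_def)
  qed
  have "i < length nu \<longleftrightarrow> i < length nu'" for i
    using pos[OF assms(1), of i] pos[OF assms(2), of i] assms(3) by simp
  then have len: "length nu = length nu'" by (metis linorder_neqE_nat less_irrefl)
  show ?thesis
  proof (rule nth_equalityI[OF len])
    fix i assume "i < length nu"
    then show "nu ! i = nu' ! i" using fun_cong[OF assms(3), of i] len by (simp add: rows_def)
  qed
qed

lemma finite_r_primary: "finite (r_primary r h)"
proof (rule finite_subset)
  have "length nu \<le> sum_list nu" if "0 \<notin> set nu" for nu :: "nat list"
    using that by (induction nu) auto
  then show "r_primary r h \<subseteq> {xs. set xs \<subseteq> {..h} \<and> length xs \<le> h}"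
    using member_le_sum_list by (fastforce simp: r_primary_def partition_of_def)
  show "finite {xs. set xs \<subseteq> {..h} \<and> length xs \<le> h}" by (rule finite_lists_length_le) simp
qed

lemma r_sign_eqI: "primary_sign r nu e \<Longrightarrow> r_sign r nu = e"
  unfolding r_sign_def using primary_sign_unique by blast

section \<open>The claimed coefficients\<close>

text \<open>The right-hand side of the theorem with the diagram of \<lambda> replaced by a set of
  cells, so that cells can be removed from it.\<close>

definition bcoef :: "nat \<Rightarrow> (nat \<times> nat) set \<Rightarrow> nat \<Rightarrow> int"
  where "bcoef r D h = (\<Sum>nu\<in>r_primary r h. r_sign r nu * int (num_SYT_above D (young_diagram nu)))"

text \<open>With h below the number of cells every \<nu> is smaller than the shape, so each skew
  tableau has a largest entry to remove; the signs depend on \<nu> only.\<close>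

lemma bcoef_rec:
  assumes sh: "shape L a" and h: "h < (\<Sum>i<L. a i)"
  shows "bcoef r (diagram a) h = (\<Sum>i | i < L \<and> a (Suc i) < a i. bcoef r (diagram (a(i := a i - 1))) h)"
proof -
  have "num_SYT_above (diagram a) (young_diagram nu) =
      (\<Sum>i | i < L \<and> a (Suc i) < a i. num_SYT_above (diagram (a(i := a i - 1))) (young_diagram nu))"
    if nu: "nu \<in> r_primary r h" for nu
  proof -
    have part: "nu \<turnstile>\<^sub>p h" using nu by (simp add: r_primary_def)
    have "card (diagram (rows nu)) < card (diagram a)"
      using h card_diagram[OF sh] card_diagram_rows[OF part] by simp
    moreover have "(i', j') \<in> diagram (rows nu)" if "(i, j) \<in> diagram (rows nu)" "i' \<le> i" "j' \<le> j" for i j i' j'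
      using that shape_le[OF shape_rows[OF part] that(2)] by (simp add: diagram_def)
    ultimately have "num_SYT_above (diagram a) (diagram (rows nu)) =
        (\<Sum>c\<in>corners (diagram a). num_SYT_above (diagram a - {c}) (diagram (rows nu)))"
      using finite_diagram[OF sh] by (intro num_SYT_above_rec)
    then show ?thesis
      unfolding young_diagram_rows
      using sum_corners_diagram[OF sh, of "\<lambda>c E. num_SYT_above E (diagram (rows nu))"] by simp
  qed
  then have "bcoef r (diagram a) h = (\<Sum>nu\<in>r_primary r h. \<Sum>i | i < L \<and> a (Suc i) < a i.
      r_sign r nu * int (num_SYT_above (diagram (a(i := a i - 1))) (young_diagram nu)))"
    unfolding bcoef_def by (intro sum.cong refl) (simp add: sum_distrib_left)
  also have "\<dots> = (\<Sum>i | i < L \<and> a (Suc i) < a i. bcoef r (diagram (a(i := a i - 1))) h)"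
    unfolding bcoef_def by (rule sum.swap)
  finally show ?thesis .
qed

lemma num_SYT_above_same_size:
  assumes sh: "shape L a" and k: "(\<Sum>i<L. a i) = k" and nu: "nu \<turnstile>\<^sub>p k"
  shows "num_SYT_above (diagram a) (young_diagram nu) = (if rows nu = a then 1 else 0)"
proof (cases "rows nu = a")
  case True
  then show ?thesis by (simp add: young_diagram_rows num_SYT_above_self)
next
  case False
  have "\<not> diagram (rows nu) \<subseteq> diagram a"
  proof
    assume "diagram (rows nu) \<subseteq> diagram a"
    then have "diagram (rows nu) = diagram a"
      using card_diagram[OF sh] k card_diagram_rows[OF nu]
      by (intro card_subset_eq finite_diagram[OF sh]) simp_all
    then show False using False diagram_eq_iff by simp
  qed
  then show ?thesis using False by (simp add: num_SYT_above_def young_diagram_rows)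
qed

text \<open>For equal sizes containment means equality, so the sum reduces to one sign.\<close>

lemma bcoef_top:
  assumes sh: "shape L a" and k: "(\<Sum>i<L. a i) = k" and nu: "nu \<turnstile>\<^sub>p k" "rows nu = a"
    and e: "primary_sign r nu e"
  shows "bcoef r (diagram a) k = e"
proof -
  have nu_in: "nu \<in> r_primary r k" using nu e by (auto simp: r_primary_def)
  have "bcoef r (diagram a) k = (\<Sum>nu'\<in>r_primary r k. if nu' = nu then r_sign r nu else 0)"
    unfolding bcoef_def
  proof (intro sum.cong refl)
    fix nu' assume "nu' \<in> r_primary r k"
    then have nu': "nu' \<turnstile>\<^sub>p k" by (simp add: r_primary_def)
    have "rows nu' = a \<longleftrightarrow> nu' = nu" using rows_inject[OF nu' nu(1)] nu(2) by auto
    then show "r_sign r nu' * int (num_SYT_above (diagram a) (young_diagram nu')) =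
        (if nu' = nu then r_sign r nu else 0)"
      using num_SYT_above_same_size[OF sh k nu'] by simp
  qed
  also have "\<dots> = e" using nu_in r_sign_eqI[OF e] finite_r_primary by simp
  finally show ?thesis .
qed

lemma bcoef_top_0:
  assumes sh: "shape L a" and k: "(\<Sum>i<L. a i) = k"
    and none: "\<And>nu e. nu \<turnstile>\<^sub>p k \<Longrightarrow> rows nu = a \<Longrightarrow> \<not> primary_sign r nu e"
  shows "bcoef r (diagram a) k = 0"
  unfolding bcoef_def
proof (intro sum.neutral ballI)
  fix nu assume nu: "nu \<in> r_primary r k"
  then have "rows nu \<noteq> a" using none by (auto simp: r_primary_def)
  moreover have "nu \<turnstile>\<^sub>p k" using nu by (simp add: r_primary_def)
  ultimately show "r_sign r nu * int (num_SYT_above (diagram a) (young_diagram nu)) = 0"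
    using num_SYT_above_same_size[OF sh k, of nu] by simp
qed

lemma rows_column: "rows (replicate t 1) = (\<lambda>i. if i < t then 1 else 0)"
  by (auto simp: rows_def fun_eq_iff)

lemma rows_double_hook:
  "rows (x # replicate u 2 @ replicate v 1) = case_nat x (\<lambda>i. if i < u then 2 else if i < u + v then 1 else 0)"
  by (auto simp: rows_def fun_eq_iff nth_append split: nat.split)

lemma partition_column: "replicate t 1 \<turnstile>\<^sub>p t"
  by (auto simp: partition_of_def sum_list_replicate sorted_wrt_iff_nth_less)

lemma partition_double_hook: "2 \<le> x \<Longrightarrow> x # replicate u 2 @ replicate v 1 \<turnstile>\<^sub>p x + 2 * u + v"
proof -
  have "sorted_wrt (\<ge>) (replicate m (c :: nat))" for m c
    by (induction m) auto
  then show "2 \<le> x \<Longrightarrow> x # replicate u 2 @ replicate v 1 \<turnstile>\<^sub>p x + 2 * u + v"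
    by (auto simp: partition_of_def sum_list_replicate sorted_wrt_append)
qed

lemma primary_column:
  assumes "primary_sign r nu e" "nu \<turnstile>\<^sub>p k" "rows nu 0 \<le> 1"
  shows "k < r"
  using assms(1)
proof cases
  case (column t)
  then show ?thesis using assms(2) by (simp add: partition_of_def sum_list_replicate)
qed (use assms(3) in \<open>auto simp: rows_def\<close>)

text \<open>The families are told apart by their sizes, which is the form of the conditions in
  \<open>beta_char_double_hook\<close>.\<close>

lemma primary_not_column:
  assumes "primary_sign r nu e" "nu \<turnstile>\<^sub>p k" "2 \<le> rows nu 0"
  obtains u v where "nu = (r - u - v) # replicate u 2 @ replicate v 1" "k = r + u" "rows nu 1 \<le> 2"
  | u v where "nu = (r + 1 - u) # replicate u 2 @ replicate v 1" "k = r + 1 + u + v" "rows nu 1 \<le> 2"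
  using assms(1)
proof cases
  case (column t)
  then show ?thesis using assms(3) by (auto simp: rows_def split: if_splits)
next
  case (short u v)
  have "k = r + u" using assms(2) short by (simp add: partition_of_def sum_list_replicate)
  moreover have "rows nu 1 \<le> 2" unfolding short(1) rows_double_hook by auto
  ultimately show ?thesis using short that(1) by blast
next
  case (long u v)
  have "k = r + 1 + u + v" using assms(2) long by (simp add: partition_of_def sum_list_replicate)
  moreover have "rows nu 1 \<le> 2" unfolding long(1) rows_double_hook by auto
  ultimately show ?thesis using long that(2) by blast
qed

lemma shape_double_hook:
  assumes sh: "shape l a" and "2 \<le> a 0" "a 1 \<le> 2"
  obtains u v where "a = case_nat (a 0) (\<lambda>i. if i < u then 2 else if i < u + v then 1 else 0)" "u + v < l"
proof -
  have sh': "shape (l - 1) (a \<circ> Suc)" using sh by (auto simp: shape_def antimono_def)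
  obtain p where p: "p \<le> l - 1" "\<And>i. 1 \<le> a (Suc i) \<longleftrightarrow> i < p"
    using shape_threshold[OF sh', of 1] by auto
  obtain u where u: "\<And>i. 2 \<le> a (Suc i) \<longleftrightarrow> i < u"
    using shape_threshold[OF sh', of 2] by auto
  have "u \<le> p"
  proof (rule ccontr)
    assume "\<not> u \<le> p"
    then have "2 \<le> a (Suc p)" using u by simp
    then show False using p(2)[of p] by simp
  qed
  have "a (Suc i) = (if i < u then 2 else if i < u + (p - u) then 1 else 0)" for i
    using p(2)[of i] u[of i] shape_le[OF sh, of 1 "Suc i"] assms(3) \<open>u \<le> p\<close> by auto
  then have "a = case_nat (a 0) (\<lambda>i. if i < u then 2 else if i < u + (p - u) then 1 else 0)"
    by (auto simp: fun_eq_iff split: nat.split)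
  moreover have "0 < l" using sh assms(2) by (auto simp: shape_def intro: ccontr)
  ultimately show thesis using p(1) \<open>u \<le> p\<close> by (intro that) auto
qed

text \<open>The nonzero cases match the clauses of \<open>primary_sign\<close>. For a double hook
  with first part x, k = x + 2u + v; so the factor (-1)^k turns the sign (-1)^v into (-1)^x.\<close>

lemma beta_char_base:
  assumes sh: "shape l a" and k: "(\<Sum>i<l. a i) = k" and "1 \<le> r"
  shows "beta_char (Suc l) r 0 (row_beta l r 0 k a) = (- 1) ^ k * bcoef r (diagram a) k"
proof -
  consider "a 0 \<le> 1" | "2 \<le> a 0" "3 \<le> a 1" | "2 \<le> a 0" "a 1 \<le> 2" by linarith
  then show ?thesis
  proof cases
    case 1
    obtain p where p: "p \<le> l" "a = (\<lambda>i. if i < p then 1 else 0)" using shape_column[OF sh 1] by blast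
    have "p = k"
      using card_diagram[OF sh] k card_diagram_rows[OF partition_column[of p]] rows_column[of p] p(2) by simp
    then have eq: "beta_char (Suc l) r 0 (row_beta l r 0 k a) = (if k < r then (- 1) ^ k else 0)"
      using beta_char_column[OF _ p(1) assms(3), of a] p(2) by simp
    have rows: "rows (replicate k 1) = a" using rows_column p(2) \<open>p = k\<close> by simp
    show ?thesis
    proof (cases "k < r")
      case True
      then have "bcoef r (diagram a) k = 1"
        by (intro bcoef_top[OF sh k partition_column rows] primary_sign.column)
      then show ?thesis using eq True by simp
    next
      case False
      have "bcoef r (diagram a) k = 0"
        using primary_column False 1 by (intro bcoef_top_0[OF sh k]) blast
      then show ?thesis using eq False by simp
    qed
  next
    case 2
    have "bcoef r (diagram a) k = 0"
    proof (rule bcoef_top_0[OF sh k])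
      fix nu e assume nu: "nu \<turnstile>\<^sub>p k" "rows nu = a"
      show "\<not> primary_sign r nu e"
      proof
        assume "primary_sign r nu e"
        from primary_not_column[OF this nu(1)] have "rows nu 1 \<le> 2" using nu(2) 2(1) by metis
        then show False using nu(2) 2(2) by simp
      qed
    qed
    then show ?thesis using beta_char_three[OF sh 2] by simp
  next
    case 3
    obtain u v where uv: "a = case_nat (a 0) (\<lambda>i. if i < u then 2 else if i < u + v then 1 else 0)" "u + v < l"
      using shape_double_hook[OF sh 3] by blast
    define x where "x = a 0"
    let ?nu = "x # replicate u 2 @ replicate v 1"
    have x: "2 \<le> x" using 3 by (simp add: x_def)
    have rows: "rows ?nu = a" unfolding rows_double_hook x_def by (rule uv(1)[symmetric])
    have kx: "k = x + 2 * u + v"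
      using card_diagram[OF sh] k card_diagram_rows[OF partition_double_hook[OF x], of u v] rows by simp
    have nu: "?nu \<turnstile>\<^sub>p k" unfolding kx by (rule partition_double_hook[OF x])
    have eq: "beta_char (Suc l) r 0 (row_beta l r 0 k a) =
        (if k = r + u then (- 1) ^ v else if k = r + 1 + u + v then (- 1) ^ Suc v else 0)"
      by (rule beta_char_double_hook[OF uv(1)[folded x_def] x uv(2) kx])
    have one: "(- 1 :: int) ^ x * (- 1) ^ x = 1" for x :: nat
      by (simp only: power_mult_distrib[symmetric]) simp
    have sgn: "(- 1 :: int) ^ k = (- 1) ^ x * (- 1) ^ v"
      unfolding kx power_add by (simp add: power_mult)
    consider "k = r + u" | "k = r + 1 + u + v" "k \<noteq> r + u" | "k \<noteq> r + u" "k \<noteq> r + 1 + u + v" by blast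
    then show ?thesis
    proof cases
      case 1
      \<comment> \<open>The bound in the clause \<open>short\<close> is exactly
        \<open>2 \<le> x\<close>, and likewise \<open>u < r\<close> in the clause
        \<open>long\<close>.\<close>
      then have x': "x = r - u - v" and le: "u + v + 2 \<le> r" using kx x by auto
      have "bcoef r (diagram a) k = (- 1) ^ x"
        using primary_sign.short[OF le, folded x'] by (rule bcoef_top[OF sh k nu rows])
      then show ?thesis unfolding eq sgn using 1 one[of x] by simp
    next
      case 2
      then have x': "x = r + 1 - u" and lt: "u < r" using kx x by auto
      have "bcoef r (diagram a) k = (- 1) ^ (r - u)"
        using primary_sign.long[OF lt, of v, folded x'] by (rule bcoef_top[OF sh k nu rows])
      moreover have "x = Suc (r - u)" using x' lt by simp
      ultimately show ?thesis unfolding eq sgn using 2 one[of "r - u"] by simp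
    next
      case none: 3
      have "bcoef r (diagram a) k = 0"
      proof (rule bcoef_top_0[OF sh k])
        fix nu' e assume nu': "nu' \<turnstile>\<^sub>p k" "rows nu' = a"
        have eq: "nu' = ?nu" using rows_inject[OF nu'(1) nu] nu'(2) rows by simp
        have hook: "u' = u \<and> v' = v" if "?nu = y # replicate u' 2 @ replicate v' 1" for y u' v'
        proof -
          have "u + v = u' + v'" using arg_cong[OF that, of length] by simp
          moreover have "x = y" using that by simp
          then have "2 * u + v = 2 * u' + v'"
            using arg_cong[OF that, of sum_list] by (simp add: sum_list_replicate)
          ultimately show ?thesis by simp
        qed
        have two: "2 \<le> rows nu' 0" using nu'(2) 3 by simp
        show "\<not> primary_sign r nu' e"
        proof
          assume "primary_sign r nu' e"
          then show False
            using nu'(1) two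
          proof (cases rule: primary_not_column)
            case (1 u' v')
            show False using hook[OF trans[OF eq[symmetric] 1(1)]] 1(2) none(1) by blast
          next
            case (2 u' v')
            show False using hook[OF trans[OF eq[symmetric] 2(1)]] 2(2) none(2) by blast
          qed
        qed
      qed
      then show ?thesis unfolding eq using none by simp
    qed
  qed
qed

section \<open>Binomial expansion of the beta number function\<close>

lemma beta_char_row:
  assumes "shape l a" "(\<Sum>i<l. a i) = k" "1 \<le> r"
  shows "beta_char (Suc l) r d (row_beta l r d k a) =
    (\<Sum>h\<le>k. (- 1) ^ h * bcoef r (diagram a) h * int (d choose (k - h)))"
  using assms(1,2)
proof (induction d arbitrary: a k)
  case (0 a k)
  have "(\<Sum>h\<le>k. (- 1) ^ h * bcoef r (diagram a) h * int (0 choose (k - h))) =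
      (\<Sum>h\<le>k. if h = k then (- 1) ^ k * bcoef r (diagram a) k else 0)"
    by (intro sum.cong refl) auto
  then show ?case using beta_char_base[OF 0 assms(3)] by simp
next
  case (Suc d a k)
  note sh = Suc.prems(1)
  let ?R = "{i. i < l \<and> a (Suc i) < a i}"
  let ?b = "row_beta l r (Suc d) k a"
  let ?S = "\<lambda>d k a. \<Sum>h\<le>k. (- 1) ^ h * bcoef r (diagram a) h * int (d choose (k - h))"
  have upd0: "?b(0 := ?b 0 - 1) = row_beta l r d k a"
    by (auto simp: fun_eq_iff row_beta_def split: nat.split)
  have upd: "beta_char (Suc l) r d (?b(Suc i := ?b (Suc i) - 1)) = ?S d (k - 1) (a(i := a i - 1))"
    if i: "i \<in> ?R" for i
  proof -
    have pos: "0 < a i" using i by auto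
    have "0 < k" using i Suc.prems(2) pos by (metis (mono_tags, lifting) finite_lessThan gr0I lessThan_iff mem_Collect_eq not_less_zero sum_eq_0_iff)
    \<comment> \<open>Here d and k drop together, so the first entry, which depends on d - k, is
      unchanged.\<close>
    have "?b(Suc i := ?b (Suc i) - 1) = row_beta l r d (k - 1) (a(i := a i - 1))"
    proof
      fix j
      show "(?b(Suc i := ?b (Suc i) - 1)) j = row_beta l r d (k - 1) (a(i := a i - 1)) j"
      proof (cases j)
        case 0
        then show ?thesis using \<open>0 < k\<close> by simp
      next
        case (Suc j')
        then show ?thesis using fun_cong[OF beta_remove[of a i l, OF pos], of j'] by auto
      qed
    qed
    then have "beta_char (Suc l) r d (?b(Suc i := ?b (Suc i) - 1)) =
        beta_char (Suc l) r d (row_beta l r d (k - 1) (a(i := a i - 1)))"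
      by (simp only:)
    also have "\<dots> = ?S d (k - 1) (a(i := a i - 1))"
    proof (rule Suc.IH)
      show "shape l (a(i := a i - 1))" using shape_remove[OF sh] i by blast
      show "(\<Sum>j<l. (a(i := a i - 1)) j) = k - 1"
        using sum_remove[of i l a, OF _ pos] i Suc.prems(2) by simp
    qed
    finally show ?thesis .
  qed
  have no: "beta_char (Suc l) r d (?b(Suc i := ?b (Suc i) - 1)) = 0" if "i \<in> {..<l} - ?R" for i
    using beta_char_no_corner[OF sh, of i "Suc l" ?b r d] that by simp
  have "beta_char (Suc l) r (Suc d) ?b =
      beta_char (Suc l) r d (row_beta l r d k a) + (\<Sum>i<l. beta_char (Suc l) r d (?b(Suc i := ?b (Suc i) - 1)))"
    unfolding beta_char.simps sum.lessThan_Suc_shift upd0 ..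
  also have "(\<Sum>i<l. beta_char (Suc l) r d (?b(Suc i := ?b (Suc i) - 1))) =
      (\<Sum>i\<in>?R. ?S d (k - 1) (a(i := a i - 1)))"
    by (rule sum.mono_neutral_cong_right) (use no upd in auto)
  also have "\<dots> = (\<Sum>h<k. (- 1) ^ h * bcoef r (diagram a) h * int (d choose (k - 1 - h)))"
  proof (cases "k = 0")
    case True
    then have "a i = 0" if "i < l" for i using Suc.prems(2) that by simp
    then have R: "?R = {}" by auto
    show ?thesis unfolding R True by simp
  next
    case False
    have "(\<Sum>i\<in>?R. ?S d (k - 1) (a(i := a i - 1))) =
        (\<Sum>h\<le>k - 1. \<Sum>i\<in>?R. (- 1) ^ h * bcoef r (diagram (a(i := a i - 1))) h * int (d choose (k - 1 - h)))"
      by (rule sum.swap)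
    also have "\<dots> = (\<Sum>h\<le>k - 1. (- 1) ^ h * bcoef r (diagram a) h * int (d choose (k - 1 - h)))"
    proof (intro sum.cong refl)
      fix h assume "h \<in> {..k - 1}"
      then have "h < (\<Sum>i<l. a i)" using False Suc.prems(2) by auto
      then show "(\<Sum>i\<in>?R. (- 1) ^ h * bcoef r (diagram (a(i := a i - 1))) h * int (d choose (k - 1 - h))) =
          (- 1) ^ h * bcoef r (diagram a) h * int (d choose (k - 1 - h))"
        using bcoef_rec[OF sh, of h r] by (simp only: sum_distrib_left sum_distrib_right)
    qed
    finally show ?thesis using False by (simp only: lessThan_Suc_atMost[symmetric]) simp
  qed
  also have "beta_char (Suc l) r d (row_beta l r d k a) + \<dots> = ?S (Suc d) k a"
  proof -
    \<comment> \<open>The term h = k is kept apart: its binomial coefficient is 1 for d and for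
      \<open>Suc d\<close>, whereas \<open>k - 1 - h\<close> would be truncated to 0 and count it
      twice.\<close>
    have split: "(\<Sum>h\<le>k. f h) = (\<Sum>h<k. f h) + f k" for f :: "nat \<Rightarrow> int"
      by (simp add: lessThan_Suc_atMost[symmetric])
    have "int (Suc d choose (k - h)) = int (d choose (k - h)) + int (d choose (k - 1 - h))" if "h < k" for h
    proof -
      have "k - h = Suc (k - 1 - h)" using that by simp
      then show ?thesis by simp
    qed
    then have "?S (Suc d) k a = ?S d k a + (\<Sum>h<k. (- 1) ^ h * bcoef r (diagram a) h * int (d choose (k - 1 - h)))"
      unfolding split by (simp add: sum.distrib[symmetric] distrib_left)
    then show ?thesis using Suc.IH[OF Suc.prems] by simp
  qed
  finally show ?case .
qed

lemma beta_Suc: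
  assumes "a 0 + k = r + d"
  shows "beta (Suc l) a = row_beta l r d k (a \<circ> Suc)"
  using assms by (auto simp: fun_eq_iff beta_def row_beta_def split: nat.split)

text \<open>At d = 0 the first row is nonempty, hence k < r; of the primary shapes this leaves only
  columns, so both sides vanish unless the diagram is a hook. For larger d both sides obey the
  branching rule, rows without corner contributing 0 on the right.\<close>

lemma content_sum_eq_beta_char:
  assumes "shape (Suc l) a" "(\<Sum>i<Suc l. a i) = r + d" "1 \<le> r"
  shows "content_sum r (diagram a) = fact (r - 1) * beta_char (Suc l) r d (beta (Suc l) a)"
  using assms(1,2)
proof (induction d arbitrary: a)
  case (0 a)
  note sh = 0(1)
  define k where "k = (\<Sum>i<l. a (Suc i))"
  have k: "a 0 + k = r" using 0(2) unfolding k_def sum.lessThan_Suc_shift by simp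
  have sh': "shape l (a \<circ> Suc)" using sh by (auto simp: shape_def antimono_def)
  have k': "(\<Sum>i<l. (a \<circ> Suc) i) = k" by (simp add: k_def)
  have "a 0 \<noteq> 0"
  proof
    assume "a 0 = 0"
    then have "a i = 0" for i using shape_le[OF sh, of 0 i] by simp
    then show False using 0(2) assms(3) by simp
  qed
  then have kr: "k < r" using k by simp
  have card: "card (diagram a) = Suc (r - 1)" and "Suc (r - 1) - a 0 = k"
    using card_diagram[OF sh] 0(2) assms(3) k by simp_all
  then have lhs: "content_sum r (diagram a) = (if a 1 \<le> 1 then fact (r - 1) * (- 1) ^ k else 0)"
    using content_sum_hook[OF sh card, of r] assms(3) by simp
  have rhs: "beta_char (Suc l) r 0 (beta (Suc l) a) = (- 1) ^ k * bcoef r (diagram (a \<circ> Suc)) k"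
    unfolding beta_Suc[of a k r 0 l, simplified, OF k] by (rule beta_char_base[OF sh' k' assms(3)])
  show ?case
  proof (cases "a 1 \<le> 1")
    case True
    obtain p where p: "p \<le> l" "a \<circ> Suc = (\<lambda>i. if i < p then 1 else 0)"
      using shape_column[OF sh'] True by auto
    have "p = k"
      using card_diagram[OF sh'] k' card_diagram_rows[OF partition_column[of p]] rows_column[of p] p(2) by simp
    then have "bcoef r (diagram (a \<circ> Suc)) k = 1"
      using p(2) rows_column by (intro bcoef_top[OF sh' k' partition_column _ primary_sign.column[OF kr]]) simp
    then show ?thesis using lhs rhs True by simp
  next
    case False
    have "bcoef r (diagram (a \<circ> Suc)) k = 0"
    proof (rule bcoef_top_0[OF sh' k'])
      fix nu e assume nu: "nu \<turnstile>\<^sub>p k" "rows nu = a \<circ> Suc"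
      have two: "2 \<le> rows nu 0" using nu(2) False by simp
      show "\<not> primary_sign r nu e"
      proof
        assume "primary_sign r nu e"
        then show False
          using nu(1) two by (cases rule: primary_not_column) (use kr in auto)
      qed
    qed
    then show ?thesis using lhs rhs False by simp
  qed
next
  case (Suc d a)
  note sh = Suc.prems(1)
  let ?R = "{i. i < Suc l \<and> a (Suc i) < a i}"
  let ?b = "beta (Suc l) a"
  have card: "card (diagram a) = r + Suc d" using card_diagram[OF sh] Suc.prems(2) by simp
  have "content_sum r (diagram a) = (\<Sum>c\<in>corners (diagram a). content_sum r (diagram a - {c}))"
    using card by (subst content_sum_rec[OF finite_diagram[OF sh]]) auto
  also have "\<dots> = (\<Sum>i\<in>?R. content_sum r (diagram (a(i := a i - 1))))"
    by (rule sum_corners_diagram[OF sh])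
  also have "\<dots> = (\<Sum>i\<in>?R. fact (r - 1) * beta_char (Suc l) r d (?b(i := ?b i - 1)))"
  proof (intro sum.cong refl)
    fix i assume i: "i \<in> ?R"
    then have pos: "0 < a i" by auto
    have "content_sum r (diagram (a(i := a i - 1))) =
        fact (r - 1) * beta_char (Suc l) r d (beta (Suc l) (a(i := a i - 1)))"
      using i sum_remove[of i "Suc l" a, OF _ pos] Suc.prems(2)
      by (intro Suc.IH shape_remove[OF sh]) auto
    then show "content_sum r (diagram (a(i := a i - 1))) = fact (r - 1) * beta_char (Suc l) r d (?b(i := ?b i - 1))"
      by (simp only: beta_remove[of a i "Suc l", OF pos])
  qed
  also have "\<dots> = fact (r - 1) * (\<Sum>i\<in>?R. beta_char (Suc l) r d (?b(i := ?b i - 1)))"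
    by (simp only: sum_distrib_left)
  also have "(\<Sum>i\<in>?R. beta_char (Suc l) r d (?b(i := ?b i - 1))) = beta_char (Suc l) r (Suc d) ?b"
    unfolding beta_char.simps
  proof (rule sum.mono_neutral_left)
    show "\<forall>i\<in>{..<Suc l} - ?R. beta_char (Suc l) r d (?b(i := ?b i - 1)) = 0"
      using beta_char_no_corner[OF sh, of _ "Suc l" ?b r d] by simp
  qed auto
  finally show ?case .
qed

section \<open>Comparison of coefficients\<close>

text \<open>The forward difference in d removes the constant term and turns
  \<open>d choose Suc j\<close> into \<open>d choose j\<close>; vanishing from N on is preserved, so
  induction on k applies.\<close>

lemma binomial_coeffs_zero:
  fixes c :: "nat \<Rightarrow> complex"
  assumes "\<And>d. N \<le> d \<Longrightarrow> (\<Sum>j\<le>k. c j * of_nat (d choose j)) = 0" "j \<le> k"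
  shows "c j = 0"
  using assms
proof (induction k arbitrary: c j)
  case 0
  then show ?case using 0(1)[of N] by simp
next
  case (Suc k)
  have "c (Suc i) = 0" if "i \<le> k" for i
  proof (rule Suc.IH[of "\<lambda>i. c (Suc i)", OF _ that])
    fix d assume d: "N \<le> d"
    have "0 = (\<Sum>j\<le>Suc k. c j * of_nat (Suc d choose j)) - (\<Sum>j\<le>Suc k. c j * of_nat (d choose j))"
      using Suc.prems(1)[of d] Suc.prems(1)[of "Suc d"] d by simp
    also have "\<dots> = (\<Sum>j\<le>k. c (Suc j) * of_nat (d choose j))"
      unfolding sum.atMost_Suc_shift by (simp add: sum_subtractf[symmetric] algebra_simps)
    finally show "(\<Sum>j\<le>k. c (Suc j) * of_nat (d choose j)) = 0" by simp
  qed
  moreover from this have "c 0 = 0"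
    using Suc.prems(1)[of N] unfolding sum.atMost_Suc_shift by simp
  ultimately show ?case using Suc.prems(2) by (cases j) auto
qed

lemma content_prod_sum:
  assumes "mu \<turnstile>\<^sub>p n"
  shows "(\<Sum>t\<in>SYT (young_diagram mu). partition.content_prod mu r t) = content_sum r (young_diagram mu)"
proof -
  interpret partition mu n by unfold_locales (rule assms)
  show ?thesis by (simp add: content_sum_def content_prod_def)
qed

text \<open>The strict bound makes \<open>n - k\<close> a nonzero first part at least as long as the
  others, so \<open>?mu\<close> is a partition.\<close>

lemma irr_char_expansion:
  assumes lam: "lam \<turnstile>\<^sub>p k" and "1 \<le> r" and n: "n = r + d" "k + largest_part lam < n"
    and \<sigma>: "r_cycle r n \<sigma>"
  shows "irr_char ((n - k) # lam) \<sigma> =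
    (\<Sum>h\<le>k. (- 1) ^ h * of_int (bcoef r (young_diagram lam) h) * of_nat (d choose (k - h)))"
proof -
  let ?mu = "(n - k) # lam" and ?l = "length lam"
  have "x \<le> largest_part lam" if "x \<in> set lam" for x
    using that by (auto simp: largest_part_def)
  then have mu: "?mu \<turnstile>\<^sub>p n"
    using lam n(2) by (force simp: partition_of_def)
  interpret partition ?mu n by unfold_locales (rule mu)
  have rows: "rows ?mu = case_nat (n - k) (rows lam)"
    by (auto simp: fun_eq_iff rows_def split: nat.split)
  have sh: "shape (Suc ?l) (rows ?mu)" using shape_rows[OF mu] by simp
  have "fact (r - 1) * irr_char ?mu \<sigma> = of_int (\<Sum>t\<in>SYT (young_diagram ?mu). content_prod r t)"
    using n(1) by (intro irr_char_cycle[OF assms(2) _ \<sigma>]) simp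
  also have "(\<Sum>t\<in>SYT (young_diagram ?mu). content_prod r t) = content_sum r (young_diagram ?mu)"
    by (rule content_prod_sum[OF mu])
  also have "young_diagram ?mu = diagram (rows ?mu)" by (rule young_diagram_rows)
  also have "content_sum r (diagram (rows ?mu)) = fact (r - 1) * beta_char (Suc ?l) r d (beta (Suc ?l) (rows ?mu))"
    using sum_rows[OF mu] n(1) by (intro content_sum_eq_beta_char[OF sh _ assms(2)]) simp
  also have "beta (Suc ?l) (rows ?mu) = row_beta ?l r d k (rows ?mu \<circ> Suc)"
    using n by (intro beta_Suc) (simp add: rows_def)
  also have "rows ?mu \<circ> Suc = rows lam" by (simp add: rows fun_eq_iff)
  also have "beta_char (Suc ?l) r d (row_beta ?l r d k (rows lam)) =
      (\<Sum>h\<le>k. (- 1) ^ h * bcoef r (diagram (rows lam)) h * int (d choose (k - h)))"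
    by (rule beta_char_row[OF shape_rows[OF lam] sum_rows[OF lam] assms(2)])
  finally show ?thesis by (simp add: young_diagram_rows)
qed

theorem theorem3p5:
  fixes lam :: "nat list" and k r :: nat
    and \<sigma> :: "nat \<Rightarrow> nat \<Rightarrow> nat"
    and P :: "complex poly" and b :: "nat \<Rightarrow> complex"
  assumes "lam \<turnstile>\<^sub>p k" and "r \<ge> 2"
    and "\<And>n. n \<ge> max (k + largest_part lam) r \<Longrightarrow> r_cycle r n (\<sigma> n)"
    and "\<And>n. n \<ge> max (k + largest_part lam) r \<Longrightarrow>
      poly P (of_nat n) = irr_char ((n - k) # lam) (\<sigma> n)"
    and "\<And>x. poly P x = (\<Sum>h = 0..k. (- 1) ^ h * b h * ((x - of_nat r) gchoose (k - h)))"
  shows "\<forall>h. h \<le> min k (length lam + r) \<longrightarrow>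
    b h = of_int (\<Sum>nu\<in>r_primary r h. r_sign r nu * int (num_skew_SYT lam nu))"
proof -
  define D where "D = young_diagram lam"
  \<comment> \<open>The differences of the two coefficient families, reindexed by j = k - h so that
    \<open>c j\<close> stands before \<open>d choose j\<close>.\<close>
  define c where "c j = (- 1) ^ (k - j) * (b (k - j) - of_int (bcoef r D (k - j)))" for j
  \<comment> \<open>At n = r + d the argument x - r of the generalised binomial coefficients is d;
    the summand 1 supplies the strict inequality of \<open>irr_char_expansion\<close>.\<close>
  have "(\<Sum>j\<le>k. c j * of_nat (d choose j)) = 0" if d: "k + largest_part lam + 1 \<le> d" for d
  proof -
    let ?n = "r + d"
    have n: "max (k + largest_part lam) r \<le> ?n" using d by simp
    have "(\<Sum>h\<le>k. (- 1) ^ h * b h * of_nat (d choose (k - h))) = poly P (of_nat ?n)"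
      by (simp add: assms(5) binomial_gbinomial atLeast0AtMost)
    also have "\<dots> = irr_char ((?n - k) # lam) (\<sigma> ?n)" by (rule assms(4)[OF n])
    also have "\<dots> = (\<Sum>h\<le>k. (- 1) ^ h * of_int (bcoef r D h) * of_nat (d choose (k - h)))"
      unfolding D_def using assms(2) d by (intro irr_char_expansion[OF assms(1) _ refl _ assms(3)[OF n]]) auto
    finally have "(\<Sum>h\<le>k. (- 1) ^ h * (b h - of_int (bcoef r D h)) * of_nat (d choose (k - h))) = 0"
      by (simp add: algebra_simps sum_subtractf)
    moreover have "(\<Sum>j\<le>k. c j * of_nat (d choose j)) =
        (\<Sum>h\<le>k. (- 1) ^ h * (b h - of_int (bcoef r D h)) * of_nat (d choose (k - h)))"
      by (rule sum.reindex_bij_witness[of _ "\<lambda>h. k - h" "\<lambda>j. k - j"]) (auto simp: c_def)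
    ultimately show ?thesis by simp
  qed
  then have c0: "c j = 0" if "j \<le> k" for j using binomial_coeffs_zero that by blast
  have "b h = of_int (bcoef r D h)" if "h \<le> k" for h
    using c0[of "k - h"] that by (simp add: c_def)
  then show ?thesis
    by (simp add: bcoef_def D_def num_skew_SYT_eq)
qed

end
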